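(* For each $n\ge 1$, the following hold. (1) The Weyman module $W(n)=\mathcal{W}(V_n, V_{2n-2})$ has finite dimension as a $\mathbb{C}$-vector space. (2) Given an $\mathfrak{sl}_2(\mathbb{C})$-submodule $K\subset V_n\wedge V_n$, the corresponding Koszul module $\mathcal{W}(V_n,K)$ is finite-dimensional over $\mathbb{C}$ if and only if $\mathcal{W}(V_n,K)$ is a quotient of $W(n)$.
   Context: For $n\ge 0$, $V_n=\mathrm{Sym}_n(V_1)$ is the irreducible $\mathfrak{sl}_2(\mathbb{C})$-module of dimension $n+1$, where $V_1$ is the defining $2$-dimensional representation. By the Clebsch–Gordan rule, for $n\ge1$, $V_n\wedge V_n=\bigoplus_{j\ge 0,\ 2n-2-4j\ge 0} V_{2n-2-4j}$, a multiplicity-free decomposition; in particular $V_{2n-2}$ is identified with a unique submodule of $V_n\wedge V_n$. For a finite-dimensional complex vector space $V$ and a subspace $K\subseteq V\wedge V$, with $S=\mathrm{Sym}(V)$, the Koszul module $\mathcal{W}(V,K)$ is the graded $S$-module which is the cokernel of $\delta_3+\mathrm{id}\otimes\iota\colon S\otimes_{\mathbb{C}}(\bigwedge^3V\oplus K)\to S\otimes_{\mathbb{C}}\bigwedge^2V$, where $\iota\colon K\to V\wedge V$ is the inclusion, $\delta_3(v_1\wedge v_2\wedge v_3)=v_1\otimes(v_2\wedge v_3)-v_2\otimes(v_1\wedge v_3)+v_3\otimes(v_1\wedge v_2)$, $\bigwedge^2V$ and $K$ are in degree $0$ and $\bigwedge^3V$ in degree $1$. "Quotient" refers to graded modules over $\mathrm{Sym}(V_n)$.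 *)

theory Defs
  imports
    "HOL-Analysis.Determinants"
    "HOL-Algebra.Module"
    "HOL-Algebra.AbelCoset"
    "HOL-Library.Poly_Mapping"
    "HOL-Library.Numeral_Type"
begin

section \<open>Modules\<close>

text \<open>
  The fields \<open>mult\<close> and \<open>one\<close>, which the record type \<open>module\<close> inherits from \<open>ring\<close>, play no
  role in a module and are left \<open>undefined\<close> throughout.
\<close>

definition ring_on :: "'a::ring_1 set \<Rightarrow> 'a ring"
  where "ring_on A = \<lparr>carrier = A, mult = (*), one = 1, zero = 0, add = (+)\<rparr>"

abbreviation complex_field :: "complex ring"
  where "complex_field \<equiv> ring_on UNIV"

definition module_span :: "('a, 'c) ring_scheme \<Rightarrow> ('a, 'b, 'd) module_scheme \<Rightarrow> 'b set \<Rightarrow> 'b set"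
  where "module_span R M X = \<Inter>{H. submodule H R M \<and> X \<subseteq> H}"

text \<open>The free module \<open>R\<^sup>J\<close> (for finite \<open>J\<close>): families indexed by \<open>J\<close>, extended by zero.\<close>

definition free_module :: "('a, 'c) ring_scheme \<Rightarrow> 'j set \<Rightarrow> ('a, 'j \<Rightarrow> 'a) module"
  where "free_module R J =
    \<lparr>carrier = {f. (\<forall>j\<in>J. f j \<in> carrier R) \<and> (\<forall>j. j \<notin> J \<longrightarrow> f j = \<zero>\<^bsub>R\<^esub>)},
     mult = undefined, one = undefined,
     zero = (\<lambda>j. \<zero>\<^bsub>R\<^esub>), add = (\<lambda>f g j. f j \<oplus>\<^bsub>R\<^esub> g j),
     smult = (\<lambda>a f j. a \<otimes>\<^bsub>R\<^esub> f j)\<rparr>"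

definition quot_module :: "('a, 'b, 'c) module_scheme \<Rightarrow> 'b set \<Rightarrow> ('a, 'b set) module"
  where "quot_module M N =
    \<lparr>carrier = a_rcosets\<^bsub>M\<^esub> N, mult = undefined, one = undefined,
     zero = N, add = (\<lambda>C D. C <+>\<^bsub>M\<^esub> D),
     smult = (\<lambda>a C. \<Union>c\<in>C. N +>\<^bsub>M\<^esub> (a \<odot>\<^bsub>M\<^esub> c))\<rparr>"

record ('a, 'b) graded_module = "('a, 'b) module" +
  hpart :: "nat \<Rightarrow> 'b set"

definition graded_quotient_of ::
  "('a, 'c) ring_scheme \<Rightarrow> ('a, 'b, 'd) graded_module_scheme \<Rightarrow> ('a, 'e, 'f) graded_module_scheme \<Rightarrow> bool"
  where "graded_quotient_of R M' M \<longleftrightarrow>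
    (\<exists>\<phi>. \<phi> ` carrier M = carrier M' \<and>
         (\<forall>x\<in>carrier M. \<forall>y\<in>carrier M. \<phi> (x \<oplus>\<^bsub>M\<^esub> y) = \<phi> x \<oplus>\<^bsub>M'\<^esub> \<phi> y) \<and>
         (\<forall>a\<in>carrier R. \<forall>x\<in>carrier M. \<phi> (a \<odot>\<^bsub>M\<^esub> x) = a \<odot>\<^bsub>M'\<^esub> \<phi> x) \<and>
         (\<forall>d. \<phi> ` hpart M d \<subseteq> hpart M' d))"


section \<open>Symmetric algebras and exterior powers of a vector space with a finite basis\<close>

text \<open>
  A finite-dimensional space \<open>V\<close> is given by a finite basis \<open>I\<close>, as the space \<open>lincombs I\<close> of formal
  linear combinations of elements of \<open>I\<close>. Then \<open>Sym V\<close> is the polynomial ring in the variables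
  \<open>I\<close>. Since the monomials of degree \<open>d\<close> are a basis of its degree-\<open>d\<close> part \<open>Sym\<^sub>d V\<close>, that
  part is again of the form \<open>lincombs J\<close>.
\<close>

type_synonym 'i cpoly = "('i \<Rightarrow>\<^sub>0 nat) \<Rightarrow>\<^sub>0 complex"

definition lincombs :: "'i set \<Rightarrow> ('i \<Rightarrow>\<^sub>0 complex) set"
  where "lincombs I = {v. Poly_Mapping.keys v \<subseteq> I}"

definition cst :: "complex \<Rightarrow> 'i cpoly"
  where "cst c = Poly_Mapping.single 0 c"

definition mvar :: "'i \<Rightarrow> 'i cpoly"
  where "mvar i = Poly_Mapping.single (Poly_Mapping.single i 1) 1"

definition linform :: "('i \<Rightarrow>\<^sub>0 complex) \<Rightarrow> 'i cpoly"
  where "linform v = (\<Sum>i\<in>Poly_Mapping.keys v. cst (Poly_Mapping.lookup v i) * mvar i)"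

definition mdeg :: "('i \<Rightarrow>\<^sub>0 nat) \<Rightarrow> nat"
  where "mdeg m = (\<Sum>i\<in>Poly_Mapping.keys m. Poly_Mapping.lookup m i)"

definition monomials :: "'i set \<Rightarrow> nat \<Rightarrow> ('i \<Rightarrow>\<^sub>0 nat) set"
  where "monomials I d = {m. Poly_Mapping.keys m \<subseteq> I \<and> mdeg m = d}"

definition Sym :: "'i set \<Rightarrow> 'i cpoly ring"
  where "Sym I = ring_on (lincombs {m. Poly_Mapping.keys m \<subseteq> I})"

definition Sym_part :: "'i set \<Rightarrow> nat \<Rightarrow> 'i cpoly set"
  where "Sym_part I d = lincombs (monomials I d)"

text \<open>Exterior powers are realised as spaces of antisymmetric tensors, with no factor \<open>1/k!\<close>.\<close>

definition wedge2 :: "('i \<Rightarrow>\<^sub>0 complex) \<Rightarrow> ('i \<Rightarrow>\<^sub>0 complex) \<Rightarrow> 'i \<times> 'i \<Rightarrow> complex"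
  where "wedge2 v w = (\<lambda>(i, j).
    Poly_Mapping.lookup v i * Poly_Mapping.lookup w j -
    Poly_Mapping.lookup w i * Poly_Mapping.lookup v j)"

definition wedge3 ::
  "('i \<Rightarrow>\<^sub>0 complex) \<Rightarrow> ('i \<Rightarrow>\<^sub>0 complex) \<Rightarrow> ('i \<Rightarrow>\<^sub>0 complex) \<Rightarrow> 'i \<times> 'i \<times> 'i \<Rightarrow> complex"
  where "wedge3 u v w = (\<lambda>(i, j, k).
    let t = (\<lambda>a b c. Poly_Mapping.lookup a i * Poly_Mapping.lookup b j * Poly_Mapping.lookup c k)
    in t u v w + t v w u + t w u v - t v u w - t u w v - t w v u)"

definition ext2 :: "'i set \<Rightarrow> ('i \<times> 'i \<Rightarrow> complex) set"
  where "ext2 I = module_span complex_field (free_module complex_field (I \<times> I))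
    {wedge2 v w | v w. v \<in> lincombs I \<and> w \<in> lincombs I}"

definition ext3 :: "'i set \<Rightarrow> ('i \<times> 'i \<times> 'i \<Rightarrow> complex) set"
  where "ext3 I = module_span complex_field (free_module complex_field (I \<times> I \<times> I))
    {wedge3 u v w | u v w. u \<in> lincombs I \<and> v \<in> lincombs I \<and> w \<in> lincombs I}"


section \<open>Koszul modules\<close>

text \<open>
  For a subspace \<open>U\<close> of \<open>\<complex>\<^sup>J\<close>, the module \<open>S \<otimes> U\<close> is embedded in the free module \<open>S \<otimes> \<complex>\<^sup>J\<close>;
  the tensor \<open>s \<otimes> u\<close> is the family \<open>\<lambda>j. s * cst (u j)\<close>.
\<close>

definition sym_tensor :: "'i set \<Rightarrow> 'j set \<Rightarrow> ('j \<Rightarrow> complex) set \<Rightarrow> ('j \<Rightarrow> 'i cpoly) set"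
  where "sym_tensor I J U =
    module_span (Sym I) (free_module (Sym I) J) {\<lambda>j. cst (u j) | u. u \<in> U}"

text \<open>
  In coordinates, the map \<open>\<delta>\<^sub>3\<close> from \<open>S \<otimes> \<And>\<^sup>3V\<close> to \<open>S \<otimes> \<And>\<^sup>2V\<close> multiplies the first tensor factor
  into \<open>S\<close>; see \<open>delta3_wedge3\<close> for its value on \<open>s \<otimes> (u \<and> v \<and> w)\<close>.
\<close>

definition delta3 :: "'i set \<Rightarrow> ('i \<times> 'i \<times> 'i \<Rightarrow> 'i cpoly) \<Rightarrow> 'i \<times> 'i \<Rightarrow> 'i cpoly"
  where "delta3 I t = (\<lambda>(j, k). \<Sum>i\<in>I. mvar i * t (i, j, k))"

lemma sum_keys_superset:
  assumes "finite I" "Poly_Mapping.keys v \<subseteq> I"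
    and "\<And>i. Poly_Mapping.lookup v i = 0 \<Longrightarrow> g i = 0"
  shows "(\<Sum>i\<in>Poly_Mapping.keys v. g i) = (\<Sum>i\<in>I. g i)"
  using assms by (intro sum.mono_neutral_left) (auto simp: in_keys_iff)

lemma cst_simps: "cst 0 = 0" "cst (a + b) = cst a + cst b" "cst (a - b) = cst a - cst b"
  "cst (a * b) = cst a * cst b"
  by (auto simp: cst_def single_add single_diff mult_single)

lemma delta3_wedge3:
  assumes "finite I" "u \<in> lincombs I" "v \<in> lincombs I" "w \<in> lincombs I"
  shows "delta3 I (\<lambda>x. s * cst (wedge3 u v w x)) =
    (\<lambda>y. s * linform u * cst (wedge2 v w y) - s * linform v * cst (wedge2 u w y)
          + s * linform w * cst (wedge2 u v y))"
proof -
  have lin: "linform z = (\<Sum>i\<in>I. cst (Poly_Mapping.lookup z i) * mvar i)" if "z \<in> lincombs I" for z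
    unfolding linform_def using that assms(1)
    by (intro sum_keys_superset) (auto simp: lincombs_def cst_simps)
  have "delta3 I (\<lambda>x. s * cst (wedge3 u v w x)) (j, k) =
      s * linform u * cst (wedge2 v w (j, k)) - s * linform v * cst (wedge2 u w (j, k))
        + s * linform w * cst (wedge2 u v (j, k))" for j k
    unfolding lin[OF assms(2)] lin[OF assms(3)] lin[OF assms(4)] sum_distrib_left sum_distrib_right
      sum_subtractf[symmetric] sum.distrib[symmetric] delta3_def prod.case
    by (intro sum.cong refl) (simp add: wedge3_def wedge2_def cst_simps algebra_simps)
  then show ?thesis by auto
qed

definition koszul_ambient ::
  "'i set \<Rightarrow> ('i cpoly, 'i \<times> 'i \<Rightarrow> 'i cpoly) module"
  where "koszul_ambient I =
    (free_module (Sym I) (I \<times> I))\<lparr>carrier := sym_tensor I (I \<times> I) (ext2 I)\<rparr>"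

definition koszul_relations ::
  "'i set \<Rightarrow> ('i \<times> 'i \<Rightarrow> complex) set \<Rightarrow> ('i \<times> 'i \<Rightarrow> 'i cpoly) set"
  where "koszul_relations I K =
    {delta3 I t \<oplus>\<^bsub>koszul_ambient I\<^esub> k | t k.
      t \<in> sym_tensor I (I \<times> I \<times> I) (ext3 I) \<and> k \<in> sym_tensor I (I \<times> I) K}"

text \<open>
  The Koszul module \<open>W(V, K)\<close> for \<open>V = lincombs I\<close>. Its degree-\<open>d\<close> part is the image of
  \<open>Sym\<^sub>d V \<otimes> \<And>\<^sup>2V\<close>.
\<close>

definition koszul_module ::
  "'i set \<Rightarrow> ('i \<times> 'i \<Rightarrow> complex) set \<Rightarrow> ('i cpoly, ('i \<times> 'i \<Rightarrow> 'i cpoly) set) graded_module"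
  where "koszul_module I K =
    module.extend (quot_module (koszul_ambient I) (koszul_relations I K))
      (graded_module.fields (\<lambda>d.
        {koszul_relations I K +>\<^bsub>koszul_ambient I\<^esub> f | f.
          f \<in> carrier (koszul_ambient I) \<and> (\<forall>x. f x \<in> Sym_part I d)}))"

definition restrict_to_complex :: "('i cpoly, 'b, 'c) module_scheme \<Rightarrow> (complex, 'b) module"
  where "restrict_to_complex M =
    \<lparr>carrier = carrier M, mult = mult M, one = one M, zero = zero M, add = add M,
     smult = (\<lambda>c x. cst c \<odot>\<^bsub>M\<^esub> x)\<rparr>"

definition finite_dim_complex :: "('i cpoly, 'b, 'c) module_scheme \<Rightarrow> bool"
  where "finite_dim_complex M \<longleftrightarrow>
    (\<exists>B. finite B \<and> B \<subseteq> carrier M \<and>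
      module_span complex_field (restrict_to_complex M) B = carrier M)"


section \<open>Representations of \<open>sl\<^sub>2\<close>\<close>

definition sl2 :: "(complex^2^2) set"
  where "sl2 = {X. trace X = 0}"

record 'b sl2_module = "(complex, 'b) module" +
  act :: "complex^2^2 \<Rightarrow> 'b \<Rightarrow> 'b"

definition sl2_submodule :: "'b set \<Rightarrow> ('b, 'c) sl2_module_scheme \<Rightarrow> bool"
  where "sl2_submodule K M \<longleftrightarrow>
    submodule K complex_field M \<and> (\<forall>X\<in>sl2. \<forall>u\<in>K. act M X u \<in> K)"

definition sl2_isomorphic :: "('b, 'c) sl2_module_scheme \<Rightarrow> ('e, 'f) sl2_module_scheme \<Rightarrow> bool"
  where "sl2_isomorphic M N \<longleftrightarrow>
    (\<exists>\<phi>. bij_betw \<phi> (carrier M) (carrier N) \<and>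
         (\<forall>x\<in>carrier M. \<forall>y\<in>carrier M. \<phi> (x \<oplus>\<^bsub>M\<^esub> y) = \<phi> x \<oplus>\<^bsub>N\<^esub> \<phi> y) \<and>
         (\<forall>c. \<forall>x\<in>carrier M. \<phi> (c \<odot>\<^bsub>M\<^esub> x) = c \<odot>\<^bsub>N\<^esub> \<phi> x) \<and>
         (\<forall>X\<in>sl2. \<forall>x\<in>carrier M. \<phi> (act M X x) = act N X (\<phi> x)))"

text \<open>
  The defining representation \<open>V\<^sub>1\<close> has basis indexed by the two-element type \<open>2\<close>. A matrix
  \<open>X\<close> sends the \<open>j\<close>-th basis vector to the \<open>j\<close>-th column of \<open>X\<close> and acts on \<open>Sym V\<^sub>1\<close> as the
  derivation extending this map.
\<close>

definition mpoly_deriv :: "'i \<Rightarrow> 'i cpoly \<Rightarrow> 'i cpoly"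
  where "mpoly_deriv j p =
    (\<Sum>m\<in>Poly_Mapping.keys p. Poly_Mapping.single (m - Poly_Mapping.single j 1)
        (of_nat (Poly_Mapping.lookup m j) * Poly_Mapping.lookup p m))"

definition sym_act :: "complex^2^2 \<Rightarrow> 2 cpoly \<Rightarrow> 2 cpoly"
  where "sym_act X p = (\<Sum>j\<in>UNIV. (\<Sum>i\<in>UNIV. cst (X $ i $ j) * mvar i) * mpoly_deriv j p)"

lemma lookup_mpoly_deriv:
  "Poly_Mapping.lookup (mpoly_deriv j p) k =
    of_nat (Poly_Mapping.lookup k j + 1) * Poly_Mapping.lookup p (k + Poly_Mapping.single j 1)"
proof -
  have eq: "m - Poly_Mapping.single j 1 = k \<longleftrightarrow> m = k + Poly_Mapping.single j 1"
    if "Poly_Mapping.lookup m j \<noteq> 0" for m :: "'a \<Rightarrow>\<^sub>0 nat"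
    using that
    by (fastforce simp: poly_mapping_eq_iff fun_eq_iff lookup_add lookup_minus lookup_single when_def)
  have "Poly_Mapping.lookup (mpoly_deriv j p) k =
      (\<Sum>m\<in>Poly_Mapping.keys p. if m = k + Poly_Mapping.single j 1
        then of_nat (Poly_Mapping.lookup k j + 1) * Poly_Mapping.lookup p (k + Poly_Mapping.single j 1)
        else 0)"
    unfolding mpoly_deriv_def lookup_sum
  proof (rule sum.cong[OF refl])
    fix m
    show "Poly_Mapping.lookup (Poly_Mapping.single (m - Poly_Mapping.single j 1)
        (of_nat (Poly_Mapping.lookup m j) * Poly_Mapping.lookup p m)) k =
      (if m = k + Poly_Mapping.single j 1
       then of_nat (Poly_Mapping.lookup k j + 1) * Poly_Mapping.lookup p (k + Poly_Mapping.single j 1)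
       else 0)"
      using eq[of m]
      by (cases "Poly_Mapping.lookup m j = 0") (auto simp: lookup_single lookup_add)
  qed
  then show ?thesis
    by (simp add: in_keys_iff)
qed

lemma mpoly_deriv_add: "mpoly_deriv j (p + q) = mpoly_deriv j p + mpoly_deriv j q"
  by (rule poly_mapping_eqI) (simp add: lookup_mpoly_deriv lookup_add algebra_simps)

lemma mpoly_deriv_single:
  "mpoly_deriv j (Poly_Mapping.single m c) =
    Poly_Mapping.single (m - Poly_Mapping.single j 1) (of_nat (Poly_Mapping.lookup m j) * c)"
  by (cases "c = 0") (auto simp: mpoly_deriv_def)

lemma cpoly_induct [case_names single add]:
  fixes p :: "'i cpoly"
  assumes "\<And>m c. P (Poly_Mapping.single m c)" "\<And>p q. P p \<Longrightarrow> P q \<Longrightarrow> P (p + q)"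
  shows "P p"
proof -
  have "P (\<Sum>m\<in>A. Poly_Mapping.single m (Poly_Mapping.lookup p m))" if "finite A" for A
    using that
  proof (induction A)
    case empty
    then show ?case using assms(1)[of 0 0] by simp
  qed (simp add: assms)
  moreover have "p = (\<Sum>m\<in>Poly_Mapping.keys p. Poly_Mapping.single m (Poly_Mapping.lookup p m))"
    by (rule poly_mapping_eqI) (simp add: lookup_sum lookup_single when_def in_keys_iff)
  ultimately show ?thesis by (metis finite_keys)
qed

lemma mpoly_deriv_mult: "mpoly_deriv j (p * q) = mpoly_deriv j p * q + p * mpoly_deriv j q"
proof (induction p rule: cpoly_induct)
  case (single m c)
  show ?case
  proof (induction q rule: cpoly_induct)
    case (single m' c')
    let ?e = "Poly_Mapping.single j (1::nat)"
    have e: "m + m' - ?e = (m - ?e) + m'" if "Poly_Mapping.lookup m j \<noteq> 0" for m m' :: "'a \<Rightarrow>\<^sub>0 nat"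
      using that by (intro poly_mapping_eqI) (auto simp: lookup_add lookup_minus lookup_single when_def)
    have s: "Poly_Mapping.single (m + m' - ?e) (of_nat (Poly_Mapping.lookup m j) * d) =
        Poly_Mapping.single (m - ?e + m') (of_nat (Poly_Mapping.lookup m j) * d)"
      for m m' and d :: complex
      using e[of m m'] by (cases "Poly_Mapping.lookup m j = 0") simp_all
    have "mpoly_deriv j (Poly_Mapping.single m c * Poly_Mapping.single m' c') =
        Poly_Mapping.single (m + m' - ?e) (of_nat (Poly_Mapping.lookup m j) * (c * c')) +
        Poly_Mapping.single (m' + m - ?e) (of_nat (Poly_Mapping.lookup m' j) * (c * c'))"
      by (simp add: mult_single mpoly_deriv_single lookup_add single_add[symmetric] algebra_simps)
    also have "\<dots> = mpoly_deriv j (Poly_Mapping.single m c) * Poly_Mapping.single m' c' +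
        Poly_Mapping.single m c * mpoly_deriv j (Poly_Mapping.single m' c')"
      unfolding s mpoly_deriv_single mult_single by (simp add: add.commute mult.left_commute mult.assoc)
    finally show ?case .
  next
    case (add p q)
    then show ?case by (simp add: distrib_left mpoly_deriv_add algebra_simps)
  qed
next
  case (add p q)
  then show ?case by (simp add: distrib_right mpoly_deriv_add algebra_simps)
qed

lemma sym_act_mult: "sym_act X (p * q) = sym_act X p * q + p * sym_act X q"
  by (simp add: sym_act_def mpoly_deriv_mult sum.distrib sum_distrib_left sum_distrib_right algebra_simps)

lemma sym_act_mvar: "sym_act X (mvar j) = (\<Sum>i\<in>UNIV. cst (X $ i $ j) * mvar i)"
proof -
  have "mpoly_deriv k (mvar j) = (if k = j then 1 else 0)" for k
    by (simp add: mvar_def mpoly_deriv_single lookup_single when_def)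
  then show ?thesis
    by (simp add: sym_act_def if_distrib[of "\<lambda>x. _ * x"] cong: if_cong)
qed

text \<open>
  The carrier of \<open>V\<^sub>n = Sym\<^sub>n V\<^sub>1\<close> is \<open>lincombs (irrep_basis n)\<close>, so the constructions above apply to
  it, with \<open>I = irrep_basis n\<close>.
\<close>

definition irrep_basis :: "nat \<Rightarrow> (2 \<Rightarrow>\<^sub>0 nat) set"
  where "irrep_basis n = monomials UNIV n"

definition irrep :: "nat \<Rightarrow> 2 cpoly sl2_module"
  where "irrep n =
    \<lparr>carrier = Sym_part UNIV n, mult = undefined, one = undefined,
     zero = 0, add = (+), smult = (\<lambda>c p. cst c * p), act = sym_act\<rparr>"

text \<open>
  The action of an endomorphism \<open>A\<close> of \<open>lincombs I\<close> on the tensor square, that is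
  \<open>A \<otimes> 1 + 1 \<otimes> A\<close>; see \<open>tensor2_act_wedge2\<close>.
\<close>

definition tensor2_act ::
  "'i set \<Rightarrow> (('i \<Rightarrow>\<^sub>0 complex) \<Rightarrow> ('i \<Rightarrow>\<^sub>0 complex)) \<Rightarrow> ('i \<times> 'i \<Rightarrow> complex) \<Rightarrow> 'i \<times> 'i \<Rightarrow> complex"
  where "tensor2_act I A u = (\<lambda>(i, j).
    \<Sum>k\<in>I. Poly_Mapping.lookup (A (Poly_Mapping.single k 1)) i * u (k, j) +
          Poly_Mapping.lookup (A (Poly_Mapping.single k 1)) j * u (i, k))"

definition wedge_square :: "nat \<Rightarrow> ((2 \<Rightarrow>\<^sub>0 nat) \<times> (2 \<Rightarrow>\<^sub>0 nat) \<Rightarrow> complex) sl2_module"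
  where "wedge_square n =
    module.extend
      ((free_module complex_field (irrep_basis n \<times> irrep_basis n))\<lparr>carrier := ext2 (irrep_basis n)\<rparr>)
      (sl2_module.fields (\<lambda>X. tensor2_act (irrep_basis n) (sym_act X)))"

text \<open>The submodule of \<open>V\<^sub>n \<and> V\<^sub>n\<close> isomorphic to \<open>V\<^sub>m\<close>, when there is exactly one.\<close>

definition wedge_summand :: "nat \<Rightarrow> nat \<Rightarrow> ((2 \<Rightarrow>\<^sub>0 nat) \<times> (2 \<Rightarrow>\<^sub>0 nat) \<Rightarrow> complex) set"
  where "wedge_summand n m =
    (THE U. sl2_submodule U (wedge_square n) \<and>
            sl2_isomorphic (irrep m) ((wedge_square n)\<lparr>carrier := U\<rparr>))"

definition weyman_module :: "nat \<Rightarrow>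
    ((2 \<Rightarrow>\<^sub>0 nat) cpoly, ((2 \<Rightarrow>\<^sub>0 nat) \<times> (2 \<Rightarrow>\<^sub>0 nat) \<Rightarrow> (2 \<Rightarrow>\<^sub>0 nat) cpoly) set) graded_module"
  where "weyman_module n = koszul_module (irrep_basis n) (wedge_summand n (2 * n - 2))"

lemma tensor2_act_wedge2:
  assumes "finite I" "v \<in> lincombs I" "w \<in> lincombs I"
    and add: "\<And>x y. A (x + y) = A x + A y"
    and scale: "\<And>c x. A (Poly_Mapping.map ((*) c) x) = Poly_Mapping.map ((*) c) (A x)"
  shows "tensor2_act I A (wedge2 v w) = (\<lambda>x. wedge2 (A v) w x + wedge2 v (A w) x)"
proof -
  have lookup_map: "Poly_Mapping.lookup (Poly_Mapping.map ((*) c) x) i = c * Poly_Mapping.lookup x i"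
    for c :: complex and x and i :: 'a
    by (simp add: Poly_Mapping.map.rep_eq when_def)
  have A0: "A 0 = 0" using add[of 0 0] by simp
  have A_sum: "A (sum f J) = (\<Sum>k\<in>J. A (f k))" if "finite J" for f and J :: "'a set"
    using that by (induction J) (auto simp: A0 add)
  have A_lookup: "Poly_Mapping.lookup (A z) i =
      (\<Sum>k\<in>I. Poly_Mapping.lookup z k * Poly_Mapping.lookup (A (Poly_Mapping.single k 1)) i)"
    if z: "z \<in> lincombs I" for z i
  proof -
    have "z = (\<Sum>k\<in>I. Poly_Mapping.map ((*) (Poly_Mapping.lookup z k)) (Poly_Mapping.single k 1))"
    proof (rule poly_mapping_eqI)
      fix i
      have "(\<Sum>k\<in>I. Poly_Mapping.lookup z k * Poly_Mapping.lookup (Poly_Mapping.single k (1::complex)) i)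
          = (\<Sum>k\<in>I. if k = i then Poly_Mapping.lookup z i else 0)"
        by (intro sum.cong) (auto simp: lookup_single)
      also have "\<dots> = Poly_Mapping.lookup z i"
        using z assms(1) by (auto simp: lincombs_def in_keys_iff)
      finally show "Poly_Mapping.lookup z i = Poly_Mapping.lookup
          (\<Sum>k\<in>I. Poly_Mapping.map ((*) (Poly_Mapping.lookup z k)) (Poly_Mapping.single k 1)) i"
        by (simp only: lookup_sum lookup_map)
    qed
    then have "A z =
        (\<Sum>k\<in>I. Poly_Mapping.map ((*) (Poly_Mapping.lookup z k)) (A (Poly_Mapping.single k 1)))"
      by (metis (no_types, lifting) A_sum[OF assms(1)] scale sum.cong)
    then show ?thesis by (simp add: lookup_sum lookup_map)
  qed
  have "tensor2_act I A (wedge2 v w) (i, j) = wedge2 (A v) w (i, j) + wedge2 v (A w) (i, j)" for i j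
    unfolding tensor2_act_def wedge2_def prod.case A_lookup[OF assms(2)] A_lookup[OF assms(3)]
      sum_distrib_left sum_distrib_right sum_subtractf[symmetric] sum.distrib[symmetric]
    by (intro sum.cong refl) (simp add: algebra_simps)
  then show ?thesis by auto
qed

end

(*
  Write x_i = C(n,i) e_i for the monomial basis e_0, ..., e_n of V_n. The summand V_{2n-2} of
  V_n /\ V_n is spanned by the tensors u_c = sum_{i+j=c} j x_i /\ x_j for 1 <= c <= 2n - 1, with
  highest weight vector u_1, a multiple of e_0 /\ e_1.

  Finiteness of W(n): it suffices that every e_p acts nilpotently, and by induction on p one may work
  modulo e_0, ..., e_{p-1}. Multiplying u_{p+l} by e_p and applying the Koszul relations gives
  sum_{i+j=p+l} (j - i) x_i (e_p /\ x_j) = 0; modulo the e_i with i < p, and modulo the elements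
  e_p /\ e_j with j < l already known to be killed by a power of e_p, only (l - p) x_p (e_p /\ x_l)
  is left. So all e_p /\ e_l, and then all e_i /\ e_j, are killed by powers of e_p.

  Conversely, if every element of K has e_0 /\ e_1-coordinate 0, then the coefficient of e_0^d in that
  coordinate vanishes on all relations for every d, so the Koszul module has infinite dimension.
  Hence finiteness produces an element of K with a component of weight 2n - 2; the Cartan element
  isolates this component, lowering generates V_{2n-2} from it, and K contains V_{2n-2}.
*)
theory Submission
  imports Defs
begin

section \<open>Modules\<close>

text \<open>With X_1, X_2 the basis of V_1, the x_i are the coefficients of x(t) = (X_1 + t X_2)^n,
  the rational normal curve, and the u_c those of its tangent lines x(t) \<and> x'(t). Hence their
  span is a copy of V_{2n-2}, and each u_c has nonzero coordinates at all pairs i \<noteq> j with i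
  + j = c. This nonvanishing is all that the nilpotence argument takes from sl_2.

  Nilpotence suffices because the module is generated by the finitely many e_i \<and> e_j. Earlier
  variables may be set to zero because they already act nilpotently.

  The summand is given by a definite description, so V_{2n-2} must also be shown to occur only once.
  No decomposition into irreducibles is involved: the space of weight 2n - 2 is a line, and V_{2n-2}
  is generated by its highest weight vector. Likewise, products of shifted Cartan elements take the
  place of complete reducibility when a weight component is isolated in K.

  Once K contains V_{2n-2}, its relations contain those of W(n), and the identity on tensors induces
  the graded surjection. The other implication only transports a finite spanning set.\<close>

lemma (in module) submodule_iff:
  "submodule H R M \<longleftrightarrow> H \<subseteq> carrier M \<and> \<zero>\<^bsub>M\<^esub> \<in> H \<and>
    (\<forall>x\<in>H. \<forall>y\<in>H. x \<oplus>\<^bsub>M\<^esub> y \<in> H) \<and> (\<forall>a\<in>carrier R. \<forall>x\<in>H. a \<odot>\<^bsub>M\<^esub> x \<in> H)"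
proof (intro iffI)
  assume H: "submodule H R M"
  then have "\<zero>\<^bsub>M\<^esub> \<in> H"
    using subgroup.one_closed[of H "add_monoid M"] by (simp add: submodule_def)
  with submoduleE[OF H] show "H \<subseteq> carrier M \<and> \<zero>\<^bsub>M\<^esub> \<in> H \<and>
    (\<forall>x\<in>H. \<forall>y\<in>H. x \<oplus>\<^bsub>M\<^esub> y \<in> H) \<and> (\<forall>a\<in>carrier R. \<forall>x\<in>H. a \<odot>\<^bsub>M\<^esub> x \<in> H)"
    by blast
next
  assume H: "H \<subseteq> carrier M \<and> \<zero>\<^bsub>M\<^esub> \<in> H \<and>
    (\<forall>x\<in>H. \<forall>y\<in>H. x \<oplus>\<^bsub>M\<^esub> y \<in> H) \<and> (\<forall>a\<in>carrier R. \<forall>x\<in>H. a \<odot>\<^bsub>M\<^esub> x \<in> H)"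
  \<comment> \<open>Negation is scaling by -1, so the subgroup condition follows from the other
    closures.\<close>
  have "\<ominus>\<^bsub>M\<^esub> x \<in> H" if "x \<in> H" for x
  proof -
    have "(\<ominus> \<one>) \<odot>\<^bsub>M\<^esub> x \<in> H" using H that by auto
    moreover have "(\<ominus> \<one>) \<odot>\<^bsub>M\<^esub> x = \<ominus>\<^bsub>M\<^esub> x" using H that by (subst smult_l_minus) auto
    ultimately show ?thesis by simp
  qed
  then show "submodule H R M" using H by (intro submoduleI) auto
qed

lemma module_span_least: "submodule H R M \<Longrightarrow> X \<subseteq> H \<Longrightarrow> module_span R M X \<subseteq> H"
  by (auto simp: module_span_def)

lemma module_span_superset: "X \<subseteq> module_span R M X"
  by (auto simp: module_span_def)

lemma (in module) module_span_submodule: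
  assumes "X \<subseteq> carrier M"
  shows "submodule (module_span R M X) R M"
proof -
  \<comment> \<open>The whole module takes part in the intersection, which keeps the span inside the
    carrier.\<close>
  have "module_span R M X \<subseteq> carrier M"
    using assms carrier_is_submodule by (rule module_span_least[rotated])
  then show ?thesis
    unfolding submodule_iff by (auto simp: module_span_def submodule_iff)
qed

lemma (in module) submodule_abelian_subgroup:
  assumes "submodule N R M"
  shows "abelian_subgroup N M"
  using assms by (intro abelian_subgroupI3 additive_subgroup.intro) (auto simp: submodule_def abelian_group_axioms)

lemma (in module) a_rcos_eq_iff:
  assumes N: "submodule N R M" and "x \<in> carrier M" "y \<in> carrier M"
  shows "N +>\<^bsub>M\<^esub> x = N +>\<^bsub>M\<^esub> y \<longleftrightarrow> x \<oplus>\<^bsub>M\<^esub> \<ominus>\<^bsub>M\<^esub> y \<in> N"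
proof -
  interpret N: abelian_subgroup N M using N by (rule submodule_abelian_subgroup)
  show ?thesis
    using N.a_rcos_module[OF assms(3,2)] N.a_repr_independence'[of x y] N.a_repr_independenceD[of x y] assms
    by metis
qed

text \<open>Two representatives differ by an element of \<open>N\<close>, and \<open>N\<close>
  absorbs scalars, so all members of the union coincide. The action on the quotient can thus be
  computed on any one representative.\<close>

lemma (in module) quot_smult:
  assumes N: "submodule N R M" and "a \<in> carrier R" "x \<in> carrier M"
  shows "(\<Union>c\<in>N +>\<^bsub>M\<^esub> x. N +>\<^bsub>M\<^esub> (a \<odot>\<^bsub>M\<^esub> c)) = N +>\<^bsub>M\<^esub> (a \<odot>\<^bsub>M\<^esub> x)"
proof -
  interpret N: abelian_subgroup N M using N by (rule submodule_abelian_subgroup)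
  have "N +>\<^bsub>M\<^esub> (a \<odot>\<^bsub>M\<^esub> c) = N +>\<^bsub>M\<^esub> (a \<odot>\<^bsub>M\<^esub> x)" if c: "c \<in> N +>\<^bsub>M\<^esub> x" for c
  proof -
    have cM: "c \<in> carrier M" using c assms(3) by (rule N.a_elemrcos_carrier[rotated])
    have "c \<oplus>\<^bsub>M\<^esub> \<ominus>\<^bsub>M\<^esub> x \<in> N" using N.a_rcos_module_imp[OF assms(3) c] .
    then have "a \<odot>\<^bsub>M\<^esub> (c \<oplus>\<^bsub>M\<^esub> \<ominus>\<^bsub>M\<^esub> x) \<in> N" using N assms(2) by (simp add: submodule_iff)
    also have "a \<odot>\<^bsub>M\<^esub> (c \<oplus>\<^bsub>M\<^esub> \<ominus>\<^bsub>M\<^esub> x) = a \<odot>\<^bsub>M\<^esub> c \<oplus>\<^bsub>M\<^esub> \<ominus>\<^bsub>M\<^esub> (a \<odot>\<^bsub>M\<^esub> x)"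
      using cM assms by (simp add: smult_r_distr smult_r_minus)
    finally show ?thesis using cM assms by (simp add: a_rcos_eq_iff)
  qed
  moreover have "x \<in> N +>\<^bsub>M\<^esub> x" using assms(3) by (rule N.a_rcos_self)
  ultimately show ?thesis by blast
qed

lemma (in module) quot_module:
  assumes N: "submodule N R M"
  shows "module R (quot_module M N)"
proof -
  interpret N: abelian_subgroup N M using N by (rule submodule_abelian_subgroup)
  have add: "N +>\<^bsub>M\<^esub> x <+>\<^bsub>M\<^esub> (N +>\<^bsub>M\<^esub> y) = N +>\<^bsub>M\<^esub> (x \<oplus>\<^bsub>M\<^esub> y)"
    if "x \<in> carrier M" "y \<in> carrier M" for x y
    using that by (rule N.a_rcos_sum)
  have coset: "\<exists>x\<in>carrier M. C = N +>\<^bsub>M\<^esub> x" if "C \<in> a_rcosets\<^bsub>M\<^esub> N" for C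
    using that by (auto simp: A_RCOSETS_def')
  have cosetI: "N +>\<^bsub>M\<^esub> x \<in> a_rcosets\<^bsub>M\<^esub> N" if "x \<in> carrier M" for x
    using that by (auto simp: A_RCOSETS_def')
  have N_coset: "N +>\<^bsub>M\<^esub> \<zero>\<^bsub>M\<^esub> = N" using N.a_subset by simp
  have ab: "abelian_group (quot_module M N)"
  proof (rule abelian_groupI)
    fix x y z
    assume "x \<in> carrier (quot_module M N)" "y \<in> carrier (quot_module M N)" "z \<in> carrier (quot_module M N)"
    then obtain x' y' z' where x': "x' \<in> carrier M" "x = N +>\<^bsub>M\<^esub> x'"
      and y': "y' \<in> carrier M" "y = N +>\<^bsub>M\<^esub> y'" and z': "z' \<in> carrier M" "z = N +>\<^bsub>M\<^esub> z'"
      using coset[of x] coset[of y] coset[of z] by (auto simp: quot_module_def)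
    then show "x \<oplus>\<^bsub>quot_module M N\<^esub> y \<oplus>\<^bsub>quot_module M N\<^esub> z =
        x \<oplus>\<^bsub>quot_module M N\<^esub> (y \<oplus>\<^bsub>quot_module M N\<^esub> z)"
      by (simp add: quot_module_def add M.a_assoc)
  next
    fix x y
    assume "x \<in> carrier (quot_module M N)" "y \<in> carrier (quot_module M N)"
    then obtain x' y' where x': "x' \<in> carrier M" "x = N +>\<^bsub>M\<^esub> x'"
      and y': "y' \<in> carrier M" "y = N +>\<^bsub>M\<^esub> y'"
      using coset[of x] coset[of y] by (auto simp: quot_module_def)
    then show "x \<oplus>\<^bsub>quot_module M N\<^esub> y \<in> carrier (quot_module M N)"
      and "x \<oplus>\<^bsub>quot_module M N\<^esub> y = y \<oplus>\<^bsub>quot_module M N\<^esub> x"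
      by (simp_all add: quot_module_def add cosetI M.a_comm)
  next
    show "\<zero>\<^bsub>quot_module M N\<^esub> \<in> carrier (quot_module M N)"
      using cosetI[OF M.zero_closed] by (simp add: quot_module_def N_coset)
  next
    fix x assume "x \<in> carrier (quot_module M N)"
    then obtain x' where x': "x' \<in> carrier M" "x = N +>\<^bsub>M\<^esub> x'"
      using coset by (auto simp: quot_module_def)
    then show "\<zero>\<^bsub>quot_module M N\<^esub> \<oplus>\<^bsub>quot_module M N\<^esub> x = x"
      using add[OF M.zero_closed, of x'] by (simp add: quot_module_def N_coset)
    show "\<exists>y\<in>carrier (quot_module M N). y \<oplus>\<^bsub>quot_module M N\<^esub> x = \<zero>\<^bsub>quot_module M N\<^esub>"
      using x' by (intro bexI[where x = "N +>\<^bsub>M\<^esub> (\<ominus>\<^bsub>M\<^esub> x')"])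
        (simp_all add: quot_module_def add cosetI M.l_neg N_coset)
  qed
  show ?thesis
  proof (rule moduleI[OF R.cring_axioms ab])
    fix a b x y
    assume a: "a \<in> carrier R" and b: "b \<in> carrier R" and
      x: "x \<in> carrier (quot_module M N)" and y: "y \<in> carrier (quot_module M N)"
    then obtain x' y' where x': "x' \<in> carrier M" "x = N +>\<^bsub>M\<^esub> x'" and y': "y' \<in> carrier M" "y = N +>\<^bsub>M\<^esub> y'"
      using coset[of x] coset[of y] by (auto simp: quot_module_def)
    show "a \<odot>\<^bsub>quot_module M N\<^esub> x \<in> carrier (quot_module M N)"
      using a x' by (auto simp: quot_module_def quot_smult[OF N] intro!: cosetI)
    show "(a \<oplus>\<^bsub>R\<^esub> b) \<odot>\<^bsub>quot_module M N\<^esub> x = a \<odot>\<^bsub>quot_module M N\<^esub> x \<oplus>\<^bsub>quot_module M N\<^esub> b \<odot>\<^bsub>quot_module M N\<^esub> x"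
      using a b x' by (simp add: quot_module_def quot_smult[OF N] add smult_l_distr)
    show "a \<odot>\<^bsub>quot_module M N\<^esub> (x \<oplus>\<^bsub>quot_module M N\<^esub> y) = a \<odot>\<^bsub>quot_module M N\<^esub> x \<oplus>\<^bsub>quot_module M N\<^esub> a \<odot>\<^bsub>quot_module M N\<^esub> y"
      using a x' y' by (simp add: quot_module_def quot_smult[OF N] add smult_r_distr)
    show "(a \<otimes>\<^bsub>R\<^esub> b) \<odot>\<^bsub>quot_module M N\<^esub> x = a \<odot>\<^bsub>quot_module M N\<^esub> (b \<odot>\<^bsub>quot_module M N\<^esub> x)"
      using a b x' by (simp add: quot_module_def quot_smult[OF N] smult_assoc1)
  next
    fix x assume x: "x \<in> carrier (quot_module M N)"
    then obtain x' where x': "x' \<in> carrier M" "x = N +>\<^bsub>M\<^esub> x'"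
      using coset by (auto simp: quot_module_def)
    then show "\<one>\<^bsub>R\<^esub> \<odot>\<^bsub>quot_module M N\<^esub> x = x"
      by (simp add: quot_module_def quot_smult[OF N])
  qed
qed

section \<open>Concrete rings and free modules\<close>

lemma cring_ring_on:
  fixes A :: "'a::comm_ring_1 set"
  assumes "0 \<in> A" "1 \<in> A" "\<And>x y. x \<in> A \<Longrightarrow> y \<in> A \<Longrightarrow> x + y \<in> A"
    "\<And>x y. x \<in> A \<Longrightarrow> y \<in> A \<Longrightarrow> x * y \<in> A" "\<And>x. x \<in> A \<Longrightarrow> - x \<in> A"
  shows "cring (ring_on A)"
proof (rule cringI)
  show "abelian_group (ring_on A)"
    by (rule abelian_groupI) (use assms in \<open>auto simp: ring_on_def add_ac intro: bexI[where x = "- x" for x]\<close>)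
  show "comm_monoid (ring_on A)"
    by (rule comm_monoidI) (use assms in \<open>auto simp: ring_on_def mult_ac\<close>)
qed (auto simp: ring_on_def algebra_simps)

lemma carrier_ring_on [simp]: "carrier (ring_on A) = A"
  and mult_ring_on [simp]: "a \<otimes>\<^bsub>ring_on A\<^esub> b = a * b"
  and one_ring_on [simp]: "\<one>\<^bsub>ring_on A\<^esub> = 1"
  and zero_ring_on [simp]: "\<zero>\<^bsub>ring_on A\<^esub> = 0"
  and add_ring_on [simp]: "a \<oplus>\<^bsub>ring_on A\<^esub> b = a + b"
  by (simp_all add: ring_on_def)

lemma cring_complex_field: "cring complex_field"
  by (rule cring_ring_on) auto

lemma module_free_module:
  assumes "cring R"
  shows "module R (free_module R J)"
proof -
  interpret R: cring R by fact
  show ?thesis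
  proof (rule moduleI[OF assms])
    show "abelian_group (free_module R J)"
    proof (rule abelian_groupI)
      fix f assume f: "f \<in> carrier (free_module R J)"
      show "\<exists>g\<in>carrier (free_module R J). g \<oplus>\<^bsub>free_module R J\<^esub> f = \<zero>\<^bsub>free_module R J\<^esub>"
      proof (intro bexI[where x = "\<lambda>j. if j \<in> J then \<ominus>\<^bsub>R\<^esub> f j else \<zero>\<^bsub>R\<^esub>"])
        show "(\<lambda>j. if j \<in> J then \<ominus>\<^bsub>R\<^esub> f j else \<zero>\<^bsub>R\<^esub>) \<oplus>\<^bsub>free_module R J\<^esub> f = \<zero>\<^bsub>free_module R J\<^esub>"
          using f by (auto simp: free_module_def fun_eq_iff R.l_neg)
      qed (use f in \<open>auto simp: free_module_def\<close>)
    next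
      fix x y z
      assume "x \<in> carrier (free_module R J)" "y \<in> carrier (free_module R J)" "z \<in> carrier (free_module R J)"
      then have "x j \<in> carrier R \<and> y j \<in> carrier R \<and> z j \<in> carrier R" for j
        by (cases "j \<in> J") (auto simp: free_module_def)
      then show "x \<oplus>\<^bsub>free_module R J\<^esub> y \<oplus>\<^bsub>free_module R J\<^esub> z = x \<oplus>\<^bsub>free_module R J\<^esub> (y \<oplus>\<^bsub>free_module R J\<^esub> z)"
        by (auto simp: free_module_def fun_eq_iff R.a_assoc)
    next
      fix x y
      assume "x \<in> carrier (free_module R J)" "y \<in> carrier (free_module R J)"
      then have "x j \<in> carrier R \<and> y j \<in> carrier R" for j
        by (cases "j \<in> J") (auto simp: free_module_def)
      then show "x \<oplus>\<^bsub>free_module R J\<^esub> y = y \<oplus>\<^bsub>free_module R J\<^esub> x"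
        by (auto simp: free_module_def fun_eq_iff R.a_comm)
    next
      fix x
      assume "x \<in> carrier (free_module R J)"
      then have "x j \<in> carrier R" for j
        by (cases "j \<in> J") (auto simp: free_module_def)
      then show "\<zero>\<^bsub>free_module R J\<^esub> \<oplus>\<^bsub>free_module R J\<^esub> x = x"
        by (auto simp: free_module_def fun_eq_iff)
    qed (auto simp: free_module_def)
  next
    fix a b x y
    assume ab: "a \<in> carrier R" "b \<in> carrier R" "x \<in> carrier (free_module R J)" "y \<in> carrier (free_module R J)"
    then have "x j \<in> carrier R \<and> y j \<in> carrier R" for j
      by (cases "j \<in> J") (auto simp: free_module_def)
    with ab show "(a \<oplus>\<^bsub>R\<^esub> b) \<odot>\<^bsub>free_module R J\<^esub> x =
        a \<odot>\<^bsub>free_module R J\<^esub> x \<oplus>\<^bsub>free_module R J\<^esub> b \<odot>\<^bsub>free_module R J\<^esub> x"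
      and "a \<odot>\<^bsub>free_module R J\<^esub> (x \<oplus>\<^bsub>free_module R J\<^esub> y) =
        a \<odot>\<^bsub>free_module R J\<^esub> x \<oplus>\<^bsub>free_module R J\<^esub> a \<odot>\<^bsub>free_module R J\<^esub> y"
      and "(a \<otimes>\<^bsub>R\<^esub> b) \<odot>\<^bsub>free_module R J\<^esub> x = a \<odot>\<^bsub>free_module R J\<^esub> (b \<odot>\<^bsub>free_module R J\<^esub> x)"
      by (auto simp: free_module_def fun_eq_iff R.l_distr R.r_distr R.m_assoc)
  next
    fix x assume x: "x \<in> carrier (free_module R J)"
    then have "x j \<in> carrier R" for j
      by (cases "j \<in> J") (auto simp: free_module_def)
    then show "\<one>\<^bsub>R\<^esub> \<odot>\<^bsub>free_module R J\<^esub> x = x" by (auto simp: free_module_def)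
  qed (auto simp: free_module_def)
qed

lemma restrict_to_complex_simps [simp]:
  "carrier (restrict_to_complex M) = carrier M" "zero (restrict_to_complex M) = zero M"
  "add (restrict_to_complex M) = add M" "smult (restrict_to_complex M) = (\<lambda>c x. cst c \<odot>\<^bsub>M\<^esub> x)"
  by (simp_all add: restrict_to_complex_def)

text \<open>The Koszul module and the wedge square are records with additional fields; this carries
  the module axioms over to them from a plain quotient and a plain submodule.\<close>

lemma module_cong:
  assumes "module R M"
    and eq: "carrier M' = carrier M" "add M' = add M" "zero M' = zero M" "smult M' = smult M"
  shows "module R M'"
proof -
  interpret module R M by fact
  have "abelian_group M'"
    by (rule abelian_groupI)
      (auto simp: eq M.a_ac M.l_neg intro!: bexI[where x = "\<ominus>\<^bsub>M\<^esub> x" for x])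
  then show ?thesis
    by (rule moduleI[OF R.cring_axioms])
      (auto simp: eq smult_l_distr smult_r_distr smult_assoc1)
qed

section \<open>Polynomials and alternating tensors\<close>

abbreviation polys :: "'i set \<Rightarrow> 'i cpoly set"
  where "polys I \<equiv> lincombs {m. Poly_Mapping.keys m \<subseteq> I}"

lemma lincombs_iff: "v \<in> lincombs A \<longleftrightarrow> (\<forall>i. i \<notin> A \<longrightarrow> Poly_Mapping.lookup v i = 0)"
  by (auto simp: lincombs_def in_keys_iff)

lemma lincombs_closed:
  "0 \<in> lincombs A" "v \<in> lincombs A \<Longrightarrow> w \<in> lincombs A \<Longrightarrow> v + w \<in> lincombs A"
  "v \<in> lincombs A \<Longrightarrow> - v \<in> lincombs A"
  by (auto simp: lincombs_iff lookup_add)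

lemma polys_closed:
  "1 \<in> polys I" "p \<in> polys I \<Longrightarrow> q \<in> polys I \<Longrightarrow> p * q \<in> polys I"
  "cst c \<in> polys I" "i \<in> I \<Longrightarrow> mvar i \<in> polys I"
proof -
  show "p * q \<in> polys I" if "p \<in> polys I" "q \<in> polys I"
  proof -
    have "Poly_Mapping.keys m \<subseteq> I" if m: "m \<in> Poly_Mapping.keys (p * q)" for m
    proof -
      obtain a b where "m = a + b" "a \<in> Poly_Mapping.keys p" "b \<in> Poly_Mapping.keys q"
        using m subsetD[OF keys_mult[of p q]] by blast
      then show ?thesis
        using \<open>p \<in> polys I\<close> \<open>q \<in> polys I\<close> keys_add[of a b] unfolding lincombs_def by blast
    qed
    then show ?thesis by (auto simp: lincombs_def)
  qed
qed (auto simp: lincombs_def cst_def mvar_def)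

lemma cring_polys: "cring (ring_on (polys I))"
  by (rule cring_ring_on) (auto intro: lincombs_closed polys_closed)

lemma cring_Sym: "cring (Sym I)"
  unfolding Sym_def by (rule cring_polys)

lemma submodule_free_iff:
  fixes A :: "'a::comm_ring_1 set"
  assumes "cring (ring_on A)"
  shows "submodule H (ring_on A) (free_module (ring_on A) J) \<longleftrightarrow>
    H \<subseteq> {f. (\<forall>j\<in>J. f j \<in> A) \<and> (\<forall>j. j \<notin> J \<longrightarrow> f j = 0)} \<and> (\<lambda>j. 0) \<in> H \<and>
    (\<forall>f\<in>H. \<forall>g\<in>H. (\<lambda>j. f j + g j) \<in> H) \<and> (\<forall>a\<in>A. \<forall>f\<in>H. (\<lambda>j. a * f j) \<in> H)"
  using module.submodule_iff[OF module_free_module[OF assms], of H J] by (simp add: free_module_def)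

lemmas submodule_complex_iff = submodule_free_iff[OF cring_complex_field, simplified]
lemmas submodule_polys_iff = submodule_free_iff[OF cring_polys]

lemma submodule_span_free:
  assumes "cring (ring_on A)" "\<And>f j. f \<in> X \<Longrightarrow> j \<in> J \<Longrightarrow> f j \<in> A" "\<And>f j. f \<in> X \<Longrightarrow> j \<notin> J \<Longrightarrow> f j = 0"
  shows "submodule (module_span (ring_on A) (free_module (ring_on A) J) X) (ring_on A) (free_module (ring_on A) J)"
  by (rule module.module_span_submodule[OF module_free_module[OF assms(1)]])
    (use assms in \<open>auto simp: free_module_def\<close>)

lemma sum_mem_if_closed:
  assumes "finite B" "(\<lambda>j. 0) \<in> H" "\<And>f g. f \<in> H \<Longrightarrow> g \<in> H \<Longrightarrow> (\<lambda>j. f j + g j) \<in> H"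
    "\<And>b. b \<in> B \<Longrightarrow> h b \<in> H"
  shows "(\<lambda>j. \<Sum>b\<in>B. h b j) \<in> H"
  using assms(1,4) by (induction B) (simp_all add: assms)

text \<open>Pointwise form of the second exterior power, for complex and for polynomial entries
  alike. The diagonal vanishes by itself, because 2 is invertible in both cases.\<close>

definition alternating :: "'i set \<Rightarrow> ('i \<times> 'i \<Rightarrow> 'a::comm_ring_1) set"
  where "alternating I = {u. (\<forall>x. x \<notin> I \<times> I \<longrightarrow> u x = 0) \<and> (\<forall>i j. - u (i, j) = u (j, i))}"

text \<open>An upper bound for \<open>ext3\<close>, weaker than full antisymmetry. The sign under
  exchange of the last two indices makes \<open>delta3\<close> alternating; the zeros at
  \<open>(i, i, k)\<close> exclude pure powers of a variable in
  \<open>finite_dim_koszul_nonvanishing\<close>.\<close>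

definition alternating3 :: "'i set \<Rightarrow> ('i \<times> 'i \<times> 'i \<Rightarrow> 'a::comm_ring_1) set"
  where "alternating3 I = {u. (\<forall>x. x \<notin> I \<times> I \<times> I \<longrightarrow> u x = 0) \<and>
    (\<forall>i j k. - u (i, j, k) = u (i, k, j)) \<and> (\<forall>i k. u (i, i, k) = 0)}"

text \<open>The tensor e_i \<and> e_j over any ring, so that the same term denotes an element of
  \<open>ext2\<close> and its image among the polynomial tensors.\<close>

definition wedge_unit :: "'i \<Rightarrow> 'i \<Rightarrow> 'i \<times> 'i \<Rightarrow> 'a::comm_ring_1"
  where "wedge_unit i j = (\<lambda>x. of_bool (x = (i, j)) - of_bool (x = (j, i)))"

lemma wedge2_single: "wedge2 (Poly_Mapping.single i 1) (Poly_Mapping.single j 1) = wedge_unit i j"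
proof -
  have "wedge2 (Poly_Mapping.single i 1) (Poly_Mapping.single j 1) (k, l) = wedge_unit i j (k, l)" for k l
    by (cases "k = i"; cases "l = j"; cases "k = j"; cases "l = i")
      (simp_all add: wedge2_def wedge_unit_def lookup_single)
  then show ?thesis by auto
qed

lemma cst_1: "cst 1 = 1"
  by (simp add: cst_def)

lemma cst_neg: "cst (- c) = - cst c"
  using cst_simps(3)[of 0 c] by (simp add: cst_simps)

lemma cst_of_bool: "cst (of_bool P) = of_bool P"
  by (simp add: cst_simps cst_1)

lemma cst_wedge_unit: "cst (wedge_unit i j x) = wedge_unit i j x"
  unfolding wedge_unit_def cst_simps cst_of_bool ..

lemma minus_wedge_unit: "- wedge_unit i j (k, l) = wedge_unit i j (l, k)"
proof -
  have "(l, k) = (i, j) \<longleftrightarrow> (k, l) = (j, i)" "(l, k) = (j, i) \<longleftrightarrow> (k, l) = (i, j)" by blast+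
  then show ?thesis unfolding wedge_unit_def by (simp only: minus_diff_eq)
qed

lemma wedge_unit_alternating:
  assumes "i \<in> I" "j \<in> I"
  shows "wedge_unit i j \<in> alternating I"
proof -
  have "wedge_unit i j x = 0" if "x \<notin> I \<times> I" for x
    using that assms by (auto simp: wedge_unit_def)
  then show ?thesis unfolding alternating_def by (simp only: mem_Collect_eq minus_wedge_unit) blast
qed

lemma single_in_lincombs: "i \<in> I \<Longrightarrow> Poly_Mapping.single i c \<in> lincombs I"
  by (auto simp: lincombs_def)

text \<open>The sum over ordered pairs meets each e_i \<and> e_j twice, the second time with both
  signs reversed; the factor \<open>h\<close>, a half, corrects this and spares an order on
  \<open>I\<close>. It is abstract because the half is taken in the complex numbers and in the
  polynomial ring.\<close>

lemma alternating_decomp: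
  fixes f :: "'i \<times> 'i \<Rightarrow> 'a::comm_ring_1"
  assumes "finite I" "f \<in> alternating I" "h + h = 1"
  shows "f = (\<lambda>x. \<Sum>(i, j)\<in>I \<times> I. (h * f (i, j)) * wedge_unit i j x)"
proof
  fix x :: "'i \<times> 'i"
  obtain k l where x: "x = (k, l)" by (cases x)
  have "(\<Sum>(i, j)\<in>I \<times> I. (h * f (i, j)) * wedge_unit i j x) =
      (\<Sum>y\<in>I \<times> I. (if y = x then h * f y else 0) - (if y = prod.swap x then h * f y else 0))"
  proof (intro sum.cong refl)
    fix y :: "'i \<times> 'i"
    have "h * f y * (of_bool (x = y) - of_bool (x = prod.swap y)) =
        (if y = x then h * f y else 0) - (if y = prod.swap x then h * f y else 0)"
      by (cases "y = x"; cases "y = prod.swap x") auto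
    then show "(case y of (i, j) \<Rightarrow> h * f (i, j) * wedge_unit i j x) =
        (if y = x then h * f y else 0) - (if y = prod.swap x then h * f y else 0)"
      by (simp add: wedge_unit_def split_beta prod.swap_def)
  qed
  also have "\<dots> = h * f x - h * f (prod.swap x)"
    unfolding sum_subtractf using assms(1,2) by (auto simp: alternating_def x)
  also have "f (prod.swap x) = - f x" using assms(2) by (simp add: alternating_def x)
  also have "h * f x - h * - f x = (h + h) * f x" by (simp add: algebra_simps)
  finally show "f x = (\<Sum>(i, j)\<in>I \<times> I. (h * f (i, j)) * wedge_unit i j x)"
    by (simp add: assms(3))
qed

lemma alternating_outside: "f \<in> alternating I \<Longrightarrow> x \<notin> I \<times> I \<Longrightarrow> f x = 0"
  unfolding alternating_def by blast

lemma wedge2_alternating: "v \<in> lincombs I \<Longrightarrow> w \<in> lincombs I \<Longrightarrow> wedge2 v w \<in> alternating I"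
  by (auto simp: wedge2_def alternating_def lincombs_iff)

text \<open>Each \<open>wedge2 v w\<close> is alternating, and \<open>alternating_decomp\<close>
  writes every alternating tensor through wedges of basis vectors. Membership in the span becomes a
  condition on coordinates.\<close>

lemma ext2_eq:
  assumes "finite I"
  shows "ext2 I = alternating I"
proof
  show "ext2 I \<subseteq> alternating I"
    unfolding ext2_def
  proof (rule module_span_least)
    show "submodule (alternating I) complex_field (free_module complex_field (I \<times> I))"
      unfolding submodule_complex_iff by (auto simp: alternating_def minus_mult_right simp del: mult_minus_right)
    show "{wedge2 v w |v w. v \<in> lincombs I \<and> w \<in> lincombs I} \<subseteq> alternating I"
      by (auto intro: wedge2_alternating)
  qed
  have "submodule (ext2 I) complex_field (free_module complex_field (I \<times> I))"
    unfolding ext2_def by (rule submodule_span_free[OF cring_complex_field])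
      (use alternating_outside[OF wedge2_alternating] in blast)+
  note H = this[unfolded submodule_complex_iff]
  show "alternating I \<subseteq> ext2 I"
  proof
    fix f :: "'a \<times> 'a \<Rightarrow> complex" assume f: "f \<in> alternating I"
    have unit: "wedge_unit i j \<in> ext2 I" if "i \<in> I" "j \<in> I" for i j
      unfolding ext2_def wedge2_single[symmetric]
      by (rule subsetD[OF module_span_superset]) (use that in \<open>auto intro: single_in_lincombs\<close>)
    have "f = (\<lambda>x. \<Sum>y\<in>I \<times> I. (case y of (i, j) \<Rightarrow> \<lambda>x. (1/2 * f (i, j)) * wedge_unit i j x) x)"
      by (subst alternating_decomp[OF assms f, of "1/2"]) (auto intro!: sum.cong)
    also have "\<dots> \<in> ext2 I"
    proof (rule sum_mem_if_closed)
      fix y assume "y \<in> I \<times> I"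
      then obtain i j where y: "y = (i, j)" "i \<in> I" "j \<in> I" by auto
      then have "(\<lambda>x. (1/2 * f (i, j)) * wedge_unit i j x) \<in> ext2 I"
        using H unit[of i j] by blast
      then show "(case y of (i, j) \<Rightarrow> \<lambda>x. (1/2 * f (i, j)) * wedge_unit i j x) \<in> ext2 I"
        by (simp only: y prod.case)
    qed (use assms H in blast)+
    finally show "f \<in> ext2 I" .
  qed
qed

lemma ext3_subset:
  "ext3 I \<subseteq> alternating3 I"
  unfolding ext3_def
proof (rule module_span_least)
  show "submodule (alternating3 I) complex_field (free_module complex_field (I \<times> I \<times> I))"
    unfolding submodule_complex_iff by (auto simp: alternating3_def minus_mult_right simp del: mult_minus_right)
  show "{wedge3 u v w |u v w. u \<in> lincombs I \<and> v \<in> lincombs I \<and> w \<in> lincombs I} \<subseteq> alternating3 I"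
    by (auto simp: wedge3_def alternating3_def lincombs_iff Let_def algebra_simps)
qed

lemma sym_tensor_least:
  assumes "submodule H (Sym I) (free_module (Sym I) J)" "\<And>u. u \<in> U \<Longrightarrow> (\<lambda>j. cst (u j)) \<in> H"
  shows "sym_tensor I J U \<subseteq> H"
  unfolding sym_tensor_def by (rule module_span_least) (use assms in auto)

lemma sym_tensor_submodule:
  assumes "\<And>u j. u \<in> U \<Longrightarrow> j \<notin> J \<Longrightarrow> u j = 0"
  shows "submodule (sym_tensor I J U) (Sym I) (free_module (Sym I) J)"
  unfolding sym_tensor_def Sym_def
  by (rule submodule_span_free[OF cring_polys]) (auto simp: polys_closed assms cst_simps)

lemma cst_in_sym_tensor: "u \<in> U \<Longrightarrow> (\<lambda>j. cst (u j)) \<in> sym_tensor I J U"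
  unfolding sym_tensor_def by (rule subsetD[OF module_span_superset]) auto

lemma half_poly: "cst (1/2) + cst (1/2) = 1"
  by (simp add: cst_simps(2)[symmetric] cst_1)

definition poly_alternating :: "'i set \<Rightarrow> ('i \<times> 'i \<Rightarrow> 'i cpoly) set"
  where "poly_alternating I = {f \<in> alternating I. \<forall>x. f x \<in> polys I}"

text \<open>The analogue of \<open>ext2_eq\<close> after extension of scalars, with
  \<open>cst (1/2)\<close> as the half. It turns the ambient module of the Koszul construction into
  an explicit set of functions.\<close>

lemma sym_tensor_ext2:
  assumes "finite I"
  shows "sym_tensor I (I \<times> I) (ext2 I) = poly_alternating I"
proof
  show "sym_tensor I (I \<times> I) (ext2 I) \<subseteq> poly_alternating I"
  proof (rule sym_tensor_least)
    show "submodule (poly_alternating I) (Sym I) (free_module (Sym I) (I \<times> I))"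
      unfolding Sym_def submodule_polys_iff
      by (auto simp: alternating_def poly_alternating_def minus_mult_right
          simp del: mult_minus_right intro: lincombs_closed polys_closed)
  qed (auto simp: poly_alternating_def ext2_eq[OF assms] alternating_def cst_simps cst_neg[symmetric] polys_closed)
  have "submodule (sym_tensor I (I \<times> I) (ext2 I)) (Sym I) (free_module (Sym I) (I \<times> I))"
    by (rule sym_tensor_submodule) (auto simp: ext2_eq[OF assms] alternating_def)
  note H = this[unfolded Sym_def submodule_polys_iff]
  show "poly_alternating I \<subseteq> sym_tensor I (I \<times> I) (ext2 I)"
  proof
    fix f assume f: "f \<in> poly_alternating I"
    have unit: "wedge_unit i j \<in> sym_tensor I (I \<times> I) (ext2 I)" if "i \<in> I" "j \<in> I" for i j
    proof -
      have "wedge_unit i j \<in> ext2 I"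
        using that by (simp add: ext2_eq[OF assms] wedge_unit_alternating)
      from cst_in_sym_tensor[OF this] show ?thesis by (simp add: cst_wedge_unit)
    qed
    have "f = (\<lambda>x. \<Sum>y\<in>I \<times> I. (case y of (i, j) \<Rightarrow> \<lambda>x. (cst (1/2) * f (i, j)) * wedge_unit i j x) x)"
      by (subst alternating_decomp[OF assms _ half_poly, of f])
        (use f in \<open>auto intro!: sum.cong simp: poly_alternating_def\<close>)
    also have "\<dots> \<in> sym_tensor I (I \<times> I) (ext2 I)"
    proof (rule sum_mem_if_closed)
      fix y assume "y \<in> I \<times> I"
      then obtain i j where y: "y = (i, j)" "i \<in> I" "j \<in> I" by auto
      have "cst (1/2) * f (i, j) \<in> polys I"
        using f by (auto simp: poly_alternating_def intro: polys_closed)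
      then show "(case y of (i, j) \<Rightarrow> \<lambda>x. (cst (1/2) * f (i, j)) * wedge_unit i j x) \<in> sym_tensor I (I \<times> I) (ext2 I)"
        using H unit[of i j] y by simp
    qed (use assms H in auto)
    finally show "f \<in> sym_tensor I (I \<times> I) (ext2 I)" .
  qed
qed

lemma sym_tensor_ext3_subset:
  "sym_tensor I (I \<times> I \<times> I) (ext3 I) \<subseteq> {t \<in> alternating3 I. \<forall>x. t x \<in> polys I}"
proof (rule sym_tensor_least)
  show "submodule {t \<in> alternating3 I. \<forall>x. t x \<in> polys I} (Sym I) (free_module (Sym I) (I \<times> I \<times> I))"
    unfolding Sym_def submodule_polys_iff
    by (auto simp: alternating3_def minus_mult_right simp del: mult_minus_right intro: lincombs_closed polys_closed)
  fix u assume "u \<in> ext3 I"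
  then have "u \<in> alternating3 I" using ext3_subset by blast
  then show "(\<lambda>j. cst (u j)) \<in> {t \<in> alternating3 I. \<forall>x. t x \<in> polys I}"
    by (auto simp: alternating3_def cst_simps cst_neg[symmetric] polys_closed)
qed

section \<open>Koszul modules as quotients of alternating tensors\<close>

lemma koszul_ambient_simps:
  "finite I \<Longrightarrow> carrier (koszul_ambient I) = poly_alternating I"
  "\<zero>\<^bsub>koszul_ambient I\<^esub> = (\<lambda>x. 0)"
  "f \<oplus>\<^bsub>koszul_ambient I\<^esub> g = (\<lambda>x. f x + g x)"
  "a \<odot>\<^bsub>koszul_ambient I\<^esub> f = (\<lambda>x. a * f x)"
  by (simp_all add: koszul_ambient_def free_module_def Sym_def sym_tensor_ext2[symmetric])

lemma carrier_Sym [simp]: "carrier (Sym I) = polys I"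
  by (simp add: Sym_def)

lemma module_koszul_ambient:
  assumes "finite I"
  shows "module (Sym I) (koszul_ambient I)"
  unfolding koszul_ambient_def
proof (rule submodule.submodule_is_module)
  show "submodule (sym_tensor I (I \<times> I) (ext2 I)) (Sym I) (free_module (Sym I) (I \<times> I))"
    by (rule sym_tensor_submodule) (simp add: ext2_eq[OF assms] alternating_outside)
qed (rule module_free_module[OF cring_Sym])

lemma poly_alternating_closed:
  "(\<lambda>x. 0) \<in> poly_alternating I"
  "f \<in> poly_alternating I \<Longrightarrow> g \<in> poly_alternating I \<Longrightarrow> (\<lambda>x. f x + g x) \<in> poly_alternating I"
  "a \<in> polys I \<Longrightarrow> f \<in> poly_alternating I \<Longrightarrow> (\<lambda>x. a * f x) \<in> poly_alternating I"
  "f \<in> poly_alternating I \<Longrightarrow> g \<in> poly_alternating I \<Longrightarrow> (\<lambda>x. f x - g x) \<in> poly_alternating I"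
  by (auto simp: poly_alternating_def alternating_def minus_mult_right simp del: mult_minus_right
      intro: lincombs_closed polys_closed simp: diff_conv_add_uminus simp del: add_uminus_conv_diff)

lemma sum_in_polys: "(\<And>i. i \<in> A \<Longrightarrow> f i \<in> polys I) \<Longrightarrow> sum f A \<in> polys I"
  by (induction A rule: infinite_finite_induct) (auto intro: lincombs_closed)

text \<open>\<open>delta3\<close> contracts the first index against the variables, and antisymmetry
  in the remaining two survives.\<close>

lemma delta3_poly_alternating:
  assumes "t \<in> sym_tensor I (I \<times> I \<times> I) (ext3 I)"
  shows "delta3 I t \<in> poly_alternating I"
proof -
  have t: "t \<in> alternating3 I" "t x \<in> polys I" for x
    using assms sym_tensor_ext3_subset by blast+
  have "delta3 I t x = 0" if "x \<notin> I \<times> I" for x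
  proof -
    obtain j k where x: "x = (j, k)" by (cases x)
    have "t (i, j, k) = 0" for i using that t(1) unfolding alternating3_def x by blast
    then show ?thesis by (simp add: delta3_def x)
  qed
  moreover have "- delta3 I t (i, j) = delta3 I t (j, i)" for i j
  proof -
    have "t (k, j, i) = - t (k, i, j)" for k using t(1) by (simp add: alternating3_def)
    then show ?thesis by (simp add: delta3_def sum_negf)
  qed
  moreover have "delta3 I t x \<in> polys I" for x
    unfolding delta3_def split_beta by (intro sum_in_polys polys_closed t(2))
  ultimately show ?thesis by (simp only: poly_alternating_def alternating_def mem_Collect_eq) blast
qed

lemma koszul_relations_eq:
  "koszul_relations I K = {\<lambda>x. delta3 I t x + k x | t k.
     t \<in> sym_tensor I (I \<times> I \<times> I) (ext3 I) \<and> k \<in> sym_tensor I (I \<times> I) K}"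
  by (simp add: koszul_relations_def koszul_ambient_simps)

lemma koszul_relationsI:
  "t \<in> sym_tensor I (I \<times> I \<times> I) (ext3 I) \<Longrightarrow> k \<in> sym_tensor I (I \<times> I) K \<Longrightarrow>
    (\<lambda>x. delta3 I t x + k x) \<in> koszul_relations I K"
  unfolding koszul_relations_eq by blast

lemma delta3_zero: "delta3 I (\<lambda>x. 0) x = 0"
  by (simp add: delta3_def split_beta)

lemma sym_tensor_mono: "U \<subseteq> U' \<Longrightarrow> sym_tensor I J U \<subseteq> sym_tensor I J U'"
  unfolding sym_tensor_def module_span_def by blast

lemma sym_tensor_ext3_closed:
  "(\<lambda>x. 0) \<in> sym_tensor I (I \<times> I \<times> I) (ext3 I)"
  "t \<in> sym_tensor I (I \<times> I \<times> I) (ext3 I) \<Longrightarrow> t' \<in> sym_tensor I (I \<times> I \<times> I) (ext3 I) \<Longrightarrow>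
    (\<lambda>x. t x + t' x) \<in> sym_tensor I (I \<times> I \<times> I) (ext3 I)"
  "a \<in> polys I \<Longrightarrow> t \<in> sym_tensor I (I \<times> I \<times> I) (ext3 I) \<Longrightarrow>
    (\<lambda>x. a * t x) \<in> sym_tensor I (I \<times> I \<times> I) (ext3 I)"
proof -
  have "u x = 0" if "u \<in> ext3 I" "x \<notin> I \<times> I \<times> I" for u x
    using subsetD[OF ext3_subset that(1)] that(2) unfolding alternating3_def by blast
  then have "submodule (sym_tensor I (I \<times> I \<times> I) (ext3 I)) (Sym I) (free_module (Sym I) (I \<times> I \<times> I))"
    by (rule sym_tensor_submodule)
  note H = this[unfolded Sym_def submodule_polys_iff]
  show "(\<lambda>x. 0) \<in> sym_tensor I (I \<times> I \<times> I) (ext3 I)"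
    and "t \<in> sym_tensor I (I \<times> I \<times> I) (ext3 I) \<Longrightarrow> t' \<in> sym_tensor I (I \<times> I \<times> I) (ext3 I) \<Longrightarrow>
    (\<lambda>x. t x + t' x) \<in> sym_tensor I (I \<times> I \<times> I) (ext3 I)"
    and "a \<in> polys I \<Longrightarrow> t \<in> sym_tensor I (I \<times> I \<times> I) (ext3 I) \<Longrightarrow>
    (\<lambda>x. a * t x) \<in> sym_tensor I (I \<times> I \<times> I) (ext3 I)"
    using H by blast+
qed

lemma sym_tensor_K_closed:
  assumes "finite I" "K \<subseteq> ext2 I"
  shows "(\<lambda>x. 0) \<in> sym_tensor I (I \<times> I) K"
  "k \<in> sym_tensor I (I \<times> I) K \<Longrightarrow> k' \<in> sym_tensor I (I \<times> I) K \<Longrightarrow>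
    (\<lambda>x. k x + k' x) \<in> sym_tensor I (I \<times> I) K"
  "a \<in> polys I \<Longrightarrow> k \<in> sym_tensor I (I \<times> I) K \<Longrightarrow> (\<lambda>x. a * k x) \<in> sym_tensor I (I \<times> I) K"
  "k \<in> sym_tensor I (I \<times> I) K \<Longrightarrow> k \<in> poly_alternating I"
proof -
  have "u x = 0" if "u \<in> K" "x \<notin> I \<times> I" for u x
    using alternating_outside[of u I x] that assms(2) ext2_eq[OF assms(1)] by blast
  then have "submodule (sym_tensor I (I \<times> I) K) (Sym I) (free_module (Sym I) (I \<times> I))"
    by (rule sym_tensor_submodule)
  note H = this[unfolded Sym_def submodule_polys_iff]
  show "(\<lambda>x. 0) \<in> sym_tensor I (I \<times> I) K"
    and "k \<in> sym_tensor I (I \<times> I) K \<Longrightarrow> k' \<in> sym_tensor I (I \<times> I) K \<Longrightarrow>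
    (\<lambda>x. k x + k' x) \<in> sym_tensor I (I \<times> I) K"
    and "a \<in> polys I \<Longrightarrow> k \<in> sym_tensor I (I \<times> I) K \<Longrightarrow> (\<lambda>x. a * k x) \<in> sym_tensor I (I \<times> I) K"
    using H by blast+
  show "k \<in> sym_tensor I (I \<times> I) K \<Longrightarrow> k \<in> poly_alternating I"
    using sym_tensor_mono[OF assms(2)] sym_tensor_ext2[OF assms(1)] by blast
qed

lemma koszul_relations_closed:
  assumes "finite I" "K \<subseteq> ext2 I"
  shows "koszul_relations I K \<subseteq> poly_alternating I"
  "(\<lambda>x. 0) \<in> koszul_relations I K"
  "f \<in> koszul_relations I K \<Longrightarrow> g \<in> koszul_relations I K \<Longrightarrow> (\<lambda>x. f x + g x) \<in> koszul_relations I K"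
  "a \<in> polys I \<Longrightarrow> f \<in> koszul_relations I K \<Longrightarrow> (\<lambda>x. a * f x) \<in> koszul_relations I K"
proof -
  note K = sym_tensor_K_closed[OF assms]
  show "koszul_relations I K \<subseteq> poly_alternating I"
    using delta3_poly_alternating K(4) by (auto simp: koszul_relations_eq intro: poly_alternating_closed)
  show "(\<lambda>x. 0) \<in> koszul_relations I K"
    using koszul_relationsI[OF sym_tensor_ext3_closed(1) K(1)] by (simp add: delta3_zero)
  show "(\<lambda>x. f x + g x) \<in> koszul_relations I K"
    if fg: "f \<in> koszul_relations I K" "g \<in> koszul_relations I K"
  proof -
    obtain t k where t: "f = (\<lambda>x. delta3 I t x + k x)"
      "t \<in> sym_tensor I (I \<times> I \<times> I) (ext3 I)" "k \<in> sym_tensor I (I \<times> I) K"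
      using fg(1) by (auto simp: koszul_relations_eq)
    obtain t' k' where t': "g = (\<lambda>x. delta3 I t' x + k' x)"
      "t' \<in> sym_tensor I (I \<times> I \<times> I) (ext3 I)" "k' \<in> sym_tensor I (I \<times> I) K"
      using fg(2) by (auto simp: koszul_relations_eq)
    have "(\<lambda>x. f x + g x) = (\<lambda>x. delta3 I (\<lambda>x. t x + t' x) x + (k x + k' x))"
      by (auto simp: t t' delta3_def fun_eq_iff sum.distrib algebra_simps)
    then show ?thesis
      using koszul_relationsI[OF sym_tensor_ext3_closed(2)[OF t(2) t'(2)] K(2)[OF t(3) t'(3)]] by simp
  qed
  show "(\<lambda>x. a * f x) \<in> koszul_relations I K"
    if a: "a \<in> polys I" and f: "f \<in> koszul_relations I K"
  proof -
    obtain t k where t: "f = (\<lambda>x. delta3 I t x + k x)"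
      "t \<in> sym_tensor I (I \<times> I \<times> I) (ext3 I)" "k \<in> sym_tensor I (I \<times> I) K"
      using f by (auto simp: koszul_relations_eq)
    have "(\<lambda>x. a * f x) = (\<lambda>x. delta3 I (\<lambda>x. a * t x) x + a * k x)"
      by (auto simp: t delta3_def fun_eq_iff sum_distrib_left algebra_simps)
    then show ?thesis
      using koszul_relationsI[OF sym_tensor_ext3_closed(3)[OF a t(2)] K(3)[OF a t(3)]] by simp
  qed
qed

lemma koszul_relations_submodule:
  assumes "finite I" "K \<subseteq> ext2 I"
  shows "submodule (koszul_relations I K) (Sym I) (koszul_ambient I)"
  unfolding module.submodule_iff[OF module_koszul_ambient[OF assms(1)]]
  using koszul_relations_closed[OF assms] by (simp add: koszul_ambient_simps assms(1))

lemma koszul_relations_mono: "K \<subseteq> K' \<Longrightarrow> koszul_relations I K \<subseteq> koszul_relations I K'"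
  using sym_tensor_mono unfolding koszul_relations_eq by blast

lemma cst_in_koszul_relations:
  assumes "finite I" "K \<subseteq> ext2 I" "u \<in> K"
  shows "(\<lambda>x. cst (u x)) \<in> koszul_relations I K"
  using koszul_relationsI[OF sym_tensor_ext3_closed(1) cst_in_sym_tensor[OF assms(3)]]
  by (simp add: delta3_zero)

lemma linform_single: "linform (Poly_Mapping.single i 1) = mvar i"
  by (simp add: linform_def cst_1)

lemma koszul_relation_wedge_unit:
  assumes "finite I" "K \<subseteq> ext2 I" "p \<in> I" "i \<in> I" "j \<in> I"
  shows "(\<lambda>x. mvar p * wedge_unit i j x - mvar i * wedge_unit p j x + mvar j * wedge_unit p i x)
    \<in> koszul_relations I K"
proof -
  let ?e = "\<lambda>i. Poly_Mapping.single i (1::complex)"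
  have "wedge3 (?e p) (?e i) (?e j) \<in> ext3 I"
    unfolding ext3_def by (rule subsetD[OF module_span_superset]) (use assms in \<open>auto intro: single_in_lincombs\<close>)
  \<comment> \<open>The factor \<open>1\<close> is the scalar \<open>s\<close> of
    \<open>delta3_wedge3\<close>; the summand from \<open>K\<close> will be zero.\<close>
  from cst_in_sym_tensor[OF this]
  have t: "(\<lambda>x. 1 * cst (wedge3 (?e p) (?e i) (?e j) x)) \<in> sym_tensor I (I \<times> I \<times> I) (ext3 I)" by simp
  have "(\<lambda>x. mvar p * wedge_unit i j x - mvar i * wedge_unit p j x + mvar j * wedge_unit p i x) =
    (\<lambda>x. delta3 I (\<lambda>x. 1 * cst (wedge3 (?e p) (?e i) (?e j) x)) x + 0)"
    using assms by (subst delta3_wedge3)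
      (simp_all add: single_in_lincombs linform_single wedge2_single cst_wedge_unit)
  then show ?thesis
    using koszul_relationsI[OF t sym_tensor_K_closed(1)[OF assms(1,2)]] by simp
qed

section \<open>Classes in the Koszul module\<close>

definition kclass :: "'i set \<Rightarrow> ('i \<times> 'i \<Rightarrow> complex) set \<Rightarrow> ('i \<times> 'i \<Rightarrow> 'i cpoly) \<Rightarrow> ('i \<times> 'i \<Rightarrow> 'i cpoly) set"
  where "kclass I K f = koszul_relations I K +>\<^bsub>koszul_ambient I\<^esub> f"

lemma koszul_module_record:
  "carrier (koszul_module I K) = carrier (quot_module (koszul_ambient I) (koszul_relations I K))"
  "add (koszul_module I K) = add (quot_module (koszul_ambient I) (koszul_relations I K))"
  "zero (koszul_module I K) = zero (quot_module (koszul_ambient I) (koszul_relations I K))"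
  "smult (koszul_module I K) = smult (quot_module (koszul_ambient I) (koszul_relations I K))"
  "hpart (koszul_module I K) = (\<lambda>d. {koszul_relations I K +>\<^bsub>koszul_ambient I\<^esub> f | f.
          f \<in> carrier (koszul_ambient I) \<and> (\<forall>x. f x \<in> Sym_part I d)})"
  by (simp_all add: koszul_module_def module.defs graded_module.defs)

context
  fixes I :: "'i set" and K :: "('i \<times> 'i \<Rightarrow> complex) set"
  assumes fin: "finite I" and K: "K \<subseteq> ext2 I"
begin

lemma module_koszul_module: "module (Sym I) (koszul_module I K)"
  by (rule module_cong[OF module.quot_module[OF module_koszul_ambient[OF fin] koszul_relations_submodule[OF fin K]]])
    (simp_all add: koszul_module_record)

lemma koszul_carrier: "carrier (koszul_module I K) = kclass I K ` poly_alternating I"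
  by (auto simp: koszul_module_record quot_module_def kclass_def A_RCOSETS_def' koszul_ambient_simps fin)

lemma koszul_hpart:
  "hpart (koszul_module I K) d = kclass I K ` {f \<in> poly_alternating I. \<forall>x. f x \<in> Sym_part I d}"
  by (auto simp: koszul_module_record kclass_def koszul_ambient_simps fin)

lemma kclass_add:
  assumes "f \<in> poly_alternating I" "g \<in> poly_alternating I"
  shows "kclass I K f \<oplus>\<^bsub>koszul_module I K\<^esub> kclass I K g = kclass I K (\<lambda>x. f x + g x)"
  using abelian_subgroup.a_rcos_sum[OF module.submodule_abelian_subgroup[OF module_koszul_ambient[OF fin]
        koszul_relations_submodule[OF fin K]], of f g] assms
  by (simp add: koszul_module_record quot_module_def kclass_def koszul_ambient_simps fin)

lemma kclass_smult:
  assumes "a \<in> polys I" "f \<in> poly_alternating I"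
  shows "a \<odot>\<^bsub>koszul_module I K\<^esub> kclass I K f = kclass I K (\<lambda>x. a * f x)"
  using module.quot_smult[OF module_koszul_ambient[OF fin] koszul_relations_submodule[OF fin K], of a f] assms
  by (simp add: koszul_module_record quot_module_def kclass_def koszul_ambient_simps fin)

lemma kclass_zero: "\<zero>\<^bsub>koszul_module I K\<^esub> = kclass I K (\<lambda>x. 0)"
proof -
  interpret module "Sym I" "koszul_ambient I" by (rule module_koszul_ambient[OF fin])
  show ?thesis
    using M.a_coset_add_zero[of "koszul_relations I K"] koszul_relations_closed(1)[OF fin K]
    by (simp add: koszul_module_record quot_module_def kclass_def koszul_ambient_simps fin)
qed

lemma kclass_eq_iff:
  assumes "f \<in> poly_alternating I" "g \<in> poly_alternating I"
  shows "kclass I K f = kclass I K g \<longleftrightarrow> (\<lambda>x. f x - g x) \<in> koszul_relations I K"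
proof -
  interpret module "Sym I" "koszul_ambient I" by (rule module_koszul_ambient[OF fin])
  have "\<ominus>\<^bsub>koszul_ambient I\<^esub> g = (\<lambda>x. - g x)"
    using M.minus_equality[of "\<lambda>x. - g x" g] assms poly_alternating_closed(4)[OF poly_alternating_closed(1) assms(2)]
    by (simp add: koszul_ambient_simps fin)
  then show ?thesis
    using a_rcos_eq_iff[OF koszul_relations_submodule[OF fin K], of f g] assms
    by (simp add: kclass_def koszul_ambient_simps fin)
qed

end

lemma module_restrict_to_complex:
  assumes "module (Sym I) M"
  shows "module complex_field (restrict_to_complex M)"
proof -
  interpret module "Sym I" M by fact
  have cst: "cst c \<in> carrier (Sym I)" for c by (simp add: polys_closed)
  have add: "cst (a + b) = cst a \<oplus>\<^bsub>Sym I\<^esub> cst b" and mult: "cst (a * b) = cst a \<otimes>\<^bsub>Sym I\<^esub> cst b"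
    and one: "cst 1 = \<one>\<^bsub>Sym I\<^esub>" for a b
    by (simp_all add: Sym_def cst_simps cst_1)
  show ?thesis
  proof (rule moduleI[OF cring_complex_field])
    show "abelian_group (restrict_to_complex M)"
      by (rule abelian_groupI) (auto simp: M.a_ac M.l_neg intro!: bexI[where x = "\<ominus>\<^bsub>M\<^esub> x" for x])
  qed (simp_all add: smult_closed[OF cst] smult_r_distr[OF cst] add mult one
      smult_l_distr[OF cst cst] smult_assoc1[OF cst cst])
qed

section \<open>Finite dimension and quotients in terms of representatives\<close>

definition complex_subspace :: "('j \<Rightarrow> 'i cpoly) set \<Rightarrow> bool"
  where "complex_subspace H \<longleftrightarrow> (\<lambda>x. 0) \<in> H \<and> (\<forall>f\<in>H. \<forall>g\<in>H. (\<lambda>x. f x + g x) \<in> H) \<and>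
    (\<forall>c. \<forall>f\<in>H. (\<lambda>x. cst c * f x) \<in> H)"

lemma complex_subspace_closed:
  assumes "complex_subspace H"
  shows "(\<lambda>x. 0) \<in> H" "f \<in> H \<Longrightarrow> g \<in> H \<Longrightarrow> (\<lambda>x. f x + g x) \<in> H"
    "f \<in> H \<Longrightarrow> (\<lambda>x. cst c * f x) \<in> H"
  using assms by (simp_all add: complex_subspace_def)

text \<open>Subspaces of a quotient correspond to subspaces above the relations. Finite dimension
  therefore says that some finite set lies, together with the relations, in no proper subspace of
  the ambient module, and cosets disappear from both finiteness criteria.\<close>

lemma finite_dim_koszul_iff:
  assumes fin: "finite I" and K: "K \<subseteq> ext2 I"
  shows "finite_dim_complex (koszul_module I K) \<longleftrightarrow>
    (\<exists>B. finite B \<and> B \<subseteq> poly_alternating I \<and> (\<forall>H \<subseteq> poly_alternating I. complex_subspace H \<longrightarrow>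
      koszul_relations I K \<subseteq> H \<longrightarrow> B \<subseteq> H \<longrightarrow> H = poly_alternating I))"
proof -
  note N = koszul_relations_closed[OF fin K]
  interpret M: module complex_field "restrict_to_complex (koszul_module I K)"
    by (rule module_restrict_to_complex[OF module_koszul_module[OF fin K]])
  have sub_iff: "submodule H complex_field (restrict_to_complex (koszul_module I K)) \<longleftrightarrow>
     H \<subseteq> kclass I K ` poly_alternating I \<and> kclass I K (\<lambda>x. 0) \<in> H \<and>
    (\<forall>x\<in>H. \<forall>y\<in>H. x \<oplus>\<^bsub>koszul_module I K\<^esub> y \<in> H) \<and> (\<forall>a. \<forall>x\<in>H. cst a \<odot>\<^bsub>koszul_module I K\<^esub> x \<in> H)" for H
    unfolding M.submodule_iff by (simp add: koszul_carrier[OF fin K] kclass_zero[OF fin K])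
  show ?thesis
  proof
    assume "finite_dim_complex (koszul_module I K)"
    then obtain B' where B': "finite B'" "B' \<subseteq> kclass I K ` poly_alternating I"
      "module_span complex_field (restrict_to_complex (koszul_module I K)) B' = kclass I K ` poly_alternating I"
      unfolding finite_dim_complex_def koszul_carrier[OF fin K] by blast
    obtain B where B: "B \<subseteq> poly_alternating I" "finite B" "B' = kclass I K ` B"
      using finite_subset_image[OF B'(1,2)] by blast
    have "H = poly_alternating I" if H: "H \<subseteq> poly_alternating I" "complex_subspace H"
      "koszul_relations I K \<subseteq> H" "B \<subseteq> H" for H
    proof
      \<comment> \<open>The image of \<open>H\<close> is a subspace containing the spanning classes
        \<open>B'\<close>, hence the whole Koszul module.\<close>
      have "submodule (kclass I K ` H) complex_field (restrict_to_complex (koszul_module I K))"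
        unfolding sub_iff
      proof (intro conjI ballI allI)
        show "kclass I K ` H \<subseteq> kclass I K ` poly_alternating I" using H(1) by blast
        show "kclass I K (\<lambda>x. 0) \<in> kclass I K ` H" using H(2) by (auto simp: complex_subspace_def)
        fix x y assume "x \<in> kclass I K ` H" "y \<in> kclass I K ` H"
        then obtain f g where fg: "f \<in> H" "g \<in> H" "x = kclass I K f" "y = kclass I K g" by auto
        then have PA: "f \<in> poly_alternating I" "g \<in> poly_alternating I" using H(1) by auto
        show "x \<oplus>\<^bsub>koszul_module I K\<^esub> y \<in> kclass I K ` H"
          unfolding fg(3,4) kclass_add[OF fin K PA] using fg(1,2) H(2) by (auto simp: complex_subspace_def)
        fix a
        show "cst a \<odot>\<^bsub>koszul_module I K\<^esub> x \<in> kclass I K ` H"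
          unfolding fg(3) kclass_smult[OF fin K polys_closed(3) PA(1)]
          using fg(1,2) H(2) by (auto simp: complex_subspace_def)
      qed
      from module_span_least[OF this, of B'] have sub: "kclass I K ` poly_alternating I \<subseteq> kclass I K ` H"
        using image_mono[OF H(4), of "kclass I K"] by (simp only: B'(3) B(3)[symmetric])
      show "poly_alternating I \<subseteq> H"
      proof
        fix f assume f: "f \<in> poly_alternating I"
        then obtain h where h: "h \<in> H" "kclass I K f = kclass I K h" using sub by blast
        \<comment> \<open>Equal classes differ by a relation, and \<open>H\<close> contains all
          relations.\<close>
        then have "(\<lambda>x. f x - h x) \<in> H"
          using kclass_eq_iff[OF fin K f, of h] H(1,3) by blast
        from complex_subspace_closed(2)[OF H(2) this h(1)] show "f \<in> H" by simp
      qed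
    qed (rule H(1))
    then show "\<exists>B. finite B \<and> B \<subseteq> poly_alternating I \<and> (\<forall>H \<subseteq> poly_alternating I. complex_subspace H \<longrightarrow>
      koszul_relations I K \<subseteq> H \<longrightarrow> B \<subseteq> H \<longrightarrow> H = poly_alternating I)"
      using B by blast
  next
    assume "\<exists>B. finite B \<and> B \<subseteq> poly_alternating I \<and> (\<forall>H \<subseteq> poly_alternating I. complex_subspace H \<longrightarrow>
      koszul_relations I K \<subseteq> H \<longrightarrow> B \<subseteq> H \<longrightarrow> H = poly_alternating I)"
    then obtain B where B: "finite B" "B \<subseteq> poly_alternating I"
      "\<And>H. H \<subseteq> poly_alternating I \<Longrightarrow> complex_subspace H \<Longrightarrow> koszul_relations I K \<subseteq> H \<Longrightarrow> B \<subseteq> H \<Longrightarrow>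
        H = poly_alternating I" by blast
    define S where "S = module_span complex_field (restrict_to_complex (koszul_module I K)) (kclass I K ` B)"
    have B_sub: "kclass I K ` B \<subseteq> carrier (restrict_to_complex (koszul_module I K))"
      using B(2) by (auto simp: koszul_carrier[OF fin K])
    have "submodule S complex_field (restrict_to_complex (koszul_module I K))"
      unfolding S_def using B_sub by (rule M.module_span_submodule)
    note S = this[unfolded sub_iff]
    \<comment> \<open>The preimage of the span is a subspace containing \<open>B\<close> and, as
      their class is zero, the relations.\<close>
    have "{f \<in> poly_alternating I. kclass I K f \<in> S} = poly_alternating I"
    proof (rule B(3))
      show "complex_subspace {f \<in> poly_alternating I. kclass I K f \<in> S}"
        unfolding complex_subspace_def
      proof (intro conjI ballI allI CollectI)
        fix f g assume fg: "f \<in> {f \<in> poly_alternating I. kclass I K f \<in> S}" "g \<in> {f \<in> poly_alternating I. kclass I K f \<in> S}"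
        then show "kclass I K (\<lambda>x. f x + g x) \<in> S"
          by (subst kclass_add[OF fin K, symmetric]) (use S in auto)
        show "(\<lambda>x. f x + g x) \<in> poly_alternating I" using fg by (auto intro: poly_alternating_closed)
        fix c
        show "(\<lambda>x. cst c * f x) \<in> poly_alternating I" using fg by (auto intro: poly_alternating_closed polys_closed)
        show "kclass I K (\<lambda>x. cst c * f x) \<in> S"
          by (subst kclass_smult[OF fin K polys_closed(3), symmetric]) (use fg S in auto)
      qed (use S in \<open>auto intro: poly_alternating_closed\<close>)
      show "koszul_relations I K \<subseteq> {f \<in> poly_alternating I. kclass I K f \<in> S}"
      proof safe
        fix f assume f: "f \<in> koszul_relations I K"
        then show PA: "f \<in> poly_alternating I" using N(1) by blast
        have "kclass I K f = kclass I K (\<lambda>x. 0)"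
          using f by (subst kclass_eq_iff[OF fin K PA poly_alternating_closed(1)]) simp
        then show "kclass I K f \<in> S" using S by simp
      qed
      show "B \<subseteq> {f \<in> poly_alternating I. kclass I K f \<in> S}"
        unfolding S_def using B(2) module_span_superset[of "kclass I K ` B" complex_field
          "restrict_to_complex (koszul_module I K)"] by auto
    qed blast
    then have "carrier (koszul_module I K) \<subseteq> S" by (auto simp: koszul_carrier[OF fin K])
    moreover have "S \<subseteq> carrier (koszul_module I K)" using S by (auto simp: koszul_carrier[OF fin K])
    ultimately show "finite_dim_complex (koszul_module I K)"
      unfolding finite_dim_complex_def using B(1) B_sub by (intro exI[of _ "kclass I K ` B"]) (auto simp: S_def)
  qed
qed

text \<open>The preimage of the span of \<open_image> is avoided here by nothing more than
  linearity: the elements sent into the span of the images of \<open>B\<close> form a subspace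
  containing \<open>B\<close>.\<close>

lemma finite_dim_graded_quotient:
  assumes quot: "graded_quotient_of (Sym I) M' M" and M: "module (Sym I) M" and M': "module (Sym I) M'"
    and fd: "finite_dim_complex M"
  shows "finite_dim_complex M'"
proof -
  interpret M: module complex_field "restrict_to_complex M" by (rule module_restrict_to_complex[OF M])
  interpret M': module complex_field "restrict_to_complex M'" by (rule module_restrict_to_complex[OF M'])
  interpret A: module "Sym I" M by fact
  interpret A': module "Sym I" M' by fact
  obtain \<phi> where \<phi>: "\<phi> ` carrier M = carrier M'"
    "\<And>x y. x \<in> carrier M \<Longrightarrow> y \<in> carrier M \<Longrightarrow> \<phi> (x \<oplus>\<^bsub>M\<^esub> y) = \<phi> x \<oplus>\<^bsub>M'\<^esub> \<phi> y"
    "\<And>a x. a \<in> polys I \<Longrightarrow> x \<in> carrier M \<Longrightarrow> \<phi> (a \<odot>\<^bsub>M\<^esub> x) = a \<odot>\<^bsub>M'\<^esub> \<phi> x"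
    using quot unfolding graded_quotient_of_def by auto
  \<comment> \<open>Preservation of zero is not among the conditions on a quotient map; it follows
    from compatibility with the scalar 0.\<close>
  have zero: "\<phi> \<zero>\<^bsub>M\<^esub> = \<zero>\<^bsub>M'\<^esub>"
  proof -
    have "\<phi> \<zero>\<^bsub>M\<^esub> = \<phi> (0 \<odot>\<^bsub>M\<^esub> \<zero>\<^bsub>M\<^esub>)"
      using A.smult_r_null[of 0] by (simp add: lincombs_closed)
    also have "\<dots> = 0 \<odot>\<^bsub>M'\<^esub> \<phi> \<zero>\<^bsub>M\<^esub>" by (rule \<phi>(3)) (simp_all add: lincombs_closed)
    also have "\<dots> = \<zero>\<^bsub>M'\<^esub>" using A'.smult_l_null[of "\<phi> \<zero>\<^bsub>M\<^esub>"] \<phi>(1) by (auto simp: Sym_def)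
    finally show ?thesis .
  qed
  obtain B where B: "finite B" "B \<subseteq> carrier M"
    "module_span complex_field (restrict_to_complex M) B = carrier M"
    using fd unfolding finite_dim_complex_def by blast
  define S where "S = module_span complex_field (restrict_to_complex M') (\<phi> ` B)"
  have B_sub: "\<phi> ` B \<subseteq> carrier (restrict_to_complex M')" using B(2) \<phi>(1) by auto
  have "submodule S complex_field (restrict_to_complex M')"
    unfolding S_def using B_sub by (rule M'.module_span_submodule)
  note S = this[unfolded M'.submodule_iff]
  have "submodule {x \<in> carrier M. \<phi> x \<in> S} complex_field (restrict_to_complex M)"
    unfolding M.submodule_iff using S M.smult_closed by (auto simp: \<phi> zero polys_closed)
  moreover have "B \<subseteq> {x \<in> carrier M. \<phi> x \<in> S}"
    unfolding S_def using B(2) module_span_superset[of "\<phi> ` B" complex_field "restrict_to_complex M'"]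
    by auto
  ultimately have "carrier M \<subseteq> {x \<in> carrier M. \<phi> x \<in> S}"
    using module_span_least B(3) by blast
  then have "carrier M' \<subseteq> S" unfolding \<phi>(1)[symmetric] by auto
  moreover have "S \<subseteq> carrier M'" using S by auto
  ultimately show ?thesis
    unfolding finite_dim_complex_def using B(1) B_sub by (intro exI[of _ "\<phi> ` B"]) (auto simp: S_def)
qed

text \<open>A larger \<open>K\<close> gives more relations, so the identity on tensors passes to the
  quotients and respects degrees.\<close>

lemma graded_quotient_koszul_mono:
  assumes fin: "finite I" and "K \<subseteq> K'" "K' \<subseteq> ext2 I"
  shows "graded_quotient_of (Sym I) (koszul_module I K') (koszul_module I K)"
proof -
  have K: "K \<subseteq> ext2 I" using assms by blast
  note K' = assms(3)
  define r where "r C = (SOME f. f \<in> poly_alternating I \<and> kclass I K f = C)" for C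
  have r: "r (kclass I K f) \<in> poly_alternating I \<and> kclass I K (r (kclass I K f)) = kclass I K f"
    if "f \<in> poly_alternating I" for f
    unfolding r_def by (rule someI[where x = f]) (use that in simp)
  define \<phi> where "\<phi> C = kclass I K' (r C)" for C
  \<comment> \<open>The map was defined through chosen representatives; inclusion of the relations
    makes the choice irrelevant.\<close>
  have \<phi>: "\<phi> (kclass I K f) = kclass I K' f" if f: "f \<in> poly_alternating I" for f
    unfolding \<phi>_def using r[OF f] koszul_relations_mono[OF assms(2)]
      kclass_eq_iff[OF fin K _ f] kclass_eq_iff[OF fin K' _ f] by blast
  show ?thesis
    unfolding graded_quotient_of_def koszul_carrier[OF fin K] koszul_carrier[OF fin K']
      koszul_hpart[OF fin K] koszul_hpart[OF fin K']
    by (intro exI[of _ \<phi>])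
      (auto simp: \<phi> image_image kclass_add[OF fin K] kclass_add[OF fin K'] kclass_smult[OF fin K]
        kclass_smult[OF fin K'] poly_alternating_closed)
qed

section \<open>Finiteness criteria for Koszul modules\<close>

lemma lookup_cst_mult: "Poly_Mapping.lookup (cst c * p) m = c * Poly_Mapping.lookup p m"
  unfolding cst_def mult_map_scale_conv_mult[symmetric] by (simp add: Poly_Mapping.map.rep_eq when_def)

lemma lookup_mvar_mult_eq_0: "Poly_Mapping.lookup m i = 0 \<Longrightarrow> Poly_Mapping.lookup (mvar i * p) m = 0"
proof (rule ccontr)
  assume m: "Poly_Mapping.lookup m i = 0" and "Poly_Mapping.lookup (mvar i * p) m \<noteq> 0"
  then have "m \<in> Poly_Mapping.keys (mvar i * p)" by (simp add: in_keys_iff)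
  then obtain b where "m = Poly_Mapping.single i 1 + b"
    using subsetD[OF keys_mult[of "mvar i" p]] unfolding mvar_def by auto
  with m show False by (simp add: lookup_add)
qed

lemma single_in_polys: "Poly_Mapping.keys m \<subseteq> I \<Longrightarrow> Poly_Mapping.single m c \<in> polys I"
  by (auto simp: lincombs_def)

lemma wedge_unit_in_poly_alternating:
  "i \<in> I \<Longrightarrow> j \<in> I \<Longrightarrow> wedge_unit i j \<in> poly_alternating I"
  by (auto simp: poly_alternating_def wedge_unit_alternating cst_wedge_unit[symmetric] polys_closed)

lemma poly_alternating_mem:
  assumes "f \<in> poly_alternating I"
  shows "f x \<in> polys I" "x \<notin> I \<times> I \<Longrightarrow> f x = 0"
  using assms alternating_outside unfolding poly_alternating_def by blast+

lemma cst_sum: "cst (sum g A) = (\<Sum>a\<in>A. cst (g a))"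
  by (induction A rule: infinite_finite_induct) (simp_all add: cst_simps)

text \<open>The (p, q) coordinate of \<open>delta3 I t\<close> is the sum of the e_i t(i, p, q). Its
  term i = p is zero, and the others are divisible by some e_i with i \<noteq> p, so no power of e_p
  occurs. If \<open>K\<close> vanished at (p, q) too, the coefficient of each e_p^d there would be a
  functional on the quotient.\<close>

lemma finite_dim_koszul_nonvanishing:
  assumes fin: "finite I" and K: "K \<subseteq> ext2 I" and pq: "p \<in> I" "q \<in> I" "p \<noteq> q"
    and fd: "finite_dim_complex (koszul_module I K)"
  shows "\<exists>u\<in>K. u (p, q) \<noteq> 0"
proof (rule ccontr)
  assume "\<not> (\<exists>u\<in>K. u (p, q) \<noteq> 0)"
  then have u0: "u (p, q) = 0" if "u \<in> K" for u using that by blast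
  obtain B where B: "finite B" "B \<subseteq> poly_alternating I"
    "\<And>H. H \<subseteq> poly_alternating I \<Longrightarrow> complex_subspace H \<Longrightarrow> koszul_relations I K \<subseteq> H \<Longrightarrow> B \<subseteq> H \<Longrightarrow>
        H = poly_alternating I"
    using fd unfolding finite_dim_koszul_iff[OF fin K] by blast
  have "inj (\<lambda>d. Poly_Mapping.single p (d::nat))"
    by simp
  then have "infinite (range (\<lambda>d. Poly_Mapping.single p (d::nat)))"
    using finite_imageD by blast
  moreover have "finite (\<Union>f\<in>B. Poly_Mapping.keys (f (p, q)))" using B(1) by simp
  \<comment> \<open>Finitely many tensors involve finitely many monomials, so some power of e_p is
    absent from the (p, q) coordinates of all of \<open>B\<close>.\<close>
  ultimately obtain d where d: "Poly_Mapping.single p d \<notin> (\<Union>f\<in>B. Poly_Mapping.keys (f (p, q)))"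
    by (metis finite_subset image_subsetI)
  define H where "H = {f \<in> poly_alternating I. Poly_Mapping.lookup (f (p, q)) (Poly_Mapping.single p d) = 0}"
  have K0: "sym_tensor I (I \<times> I) K \<subseteq> {k \<in> poly_alternating I. k (p, q) = 0}"
  proof (rule sym_tensor_least)
    show "submodule {k \<in> poly_alternating I. k (p, q) = 0} (Sym I) (free_module (Sym I) (I \<times> I))"
      unfolding Sym_def submodule_polys_iff
      by (auto intro: poly_alternating_closed poly_alternating_mem)
    fix u assume u: "u \<in> K"
    then show "(\<lambda>x. cst (u x)) \<in> {k \<in> poly_alternating I. k (p, q) = 0}"
      using sym_tensor_K_closed(4)[OF fin K cst_in_sym_tensor[OF u]] u0[OF u] by (simp add: cst_simps)
  qed
  have "H = poly_alternating I"
  proof (rule B(3))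
    show "complex_subspace H"
      by (auto simp: complex_subspace_def H_def lookup_add lookup_cst_mult
          intro: poly_alternating_closed polys_closed)
    show "koszul_relations I K \<subseteq> H"
    proof
      fix f assume f: "f \<in> koszul_relations I K"
      then obtain t k where t: "f = (\<lambda>x. delta3 I t x + k x)"
        "t \<in> sym_tensor I (I \<times> I \<times> I) (ext3 I)" "k \<in> sym_tensor I (I \<times> I) K"
        by (auto simp: koszul_relations_eq)
      have "t (p, p, q) = 0" using t(2) sym_tensor_ext3_subset by (auto simp: alternating3_def)
      then have "Poly_Mapping.lookup (mvar i * t (i, p, q)) (Poly_Mapping.single p d) = 0" for i
        by (cases "i = p") (auto simp: lookup_single intro: lookup_mvar_mult_eq_0)
      then have "Poly_Mapping.lookup (delta3 I t (p, q)) (Poly_Mapping.single p d) = 0"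
        by (simp add: delta3_def lookup_sum)
      moreover have "k (p, q) = 0" using K0 t(3) by blast
      ultimately show "f \<in> H"
        using f koszul_relations_closed(1)[OF fin K] by (auto simp: H_def t(1) lookup_add)
    qed
    show "B \<subseteq> H" using B(2) d by (auto simp: H_def in_keys_iff)
  qed (simp add: H_def)
  \<comment> \<open>The tensor e_p^d (e_p \<and> e_q) has coefficient 1 where every element of
    \<open>H\<close> has 0.\<close>
  moreover have "(\<lambda>x. Poly_Mapping.single (Poly_Mapping.single p d) 1 * wedge_unit p q x) \<in> poly_alternating I"
    using pq by (intro poly_alternating_closed single_in_polys wedge_unit_in_poly_alternating) auto
  ultimately have "(\<lambda>x. Poly_Mapping.single (Poly_Mapping.single p d) 1 * wedge_unit p q x) \<in> H"
    by simp
  then show False using pq(3) by (simp add: H_def wedge_unit_def)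
qed

section \<open>Nilpotent variables and finite dimension\<close>

lemma power_in_polys: "a \<in> polys I \<Longrightarrow> a ^ k \<in> polys I"
  by (induction k) (auto intro: polys_closed)

lemma mvar_power: "mvar i ^ k = Poly_Mapping.single (Poly_Mapping.single i k) 1"
  by (induction k) (simp_all add: mvar_def mult_single single_add[symmetric])

lemma finite_bounded_monomials:
  assumes "finite I"
  shows "finite {m :: 'i \<Rightarrow>\<^sub>0 nat. Poly_Mapping.keys m \<subseteq> I \<and> (\<forall>i. Poly_Mapping.lookup m i < L)}" (is "finite ?M")
proof -
  have "m \<in> (\<lambda>g. \<Sum>i\<in>I. Poly_Mapping.single i (g i)) ` (I \<rightarrow>\<^sub>E {..<L})" if "m \<in> ?M" for m
  proof (rule image_eqI)
    show "m = (\<Sum>i\<in>I. Poly_Mapping.single i (restrict (Poly_Mapping.lookup m) I i))"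
    proof (rule poly_mapping_eqI)
      fix k
      have "(\<Sum>i\<in>I. Poly_Mapping.lookup (Poly_Mapping.single i (restrict (Poly_Mapping.lookup m) I i)) k) =
        (\<Sum>i\<in>I. if i = k then Poly_Mapping.lookup m k else 0)"
        by (intro sum.cong) (auto simp: lookup_single when_def)
      also have "\<dots> = Poly_Mapping.lookup m k"
        using that assms by (auto simp: in_keys_iff)
      finally show "Poly_Mapping.lookup m k =
        Poly_Mapping.lookup (\<Sum>i\<in>I. Poly_Mapping.single i (restrict (Poly_Mapping.lookup m) I i)) k"
        by (simp add: lookup_sum)
    qed
    show "restrict (Poly_Mapping.lookup m) I \<in> I \<rightarrow>\<^sub>E {..<L}" using that by auto
  qed
  then have "?M \<subseteq> (\<lambda>g. \<Sum>i\<in>I. Poly_Mapping.single i (g i)) ` (I \<rightarrow>\<^sub>E {..<L})" by blast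
  then show ?thesis by (rule finite_subset) (use assms in \<open>simp add: finite_PiE\<close>)
qed

text \<open>Nilpotence of \<open>a\<close> on the module with relations \<open>N\<close>. The set
  \<open>N\<close> is arbitrary so that variables can be added to the relations.\<close>

definition nilpotent_mod :: "'i set \<Rightarrow> ('i \<times> 'i \<Rightarrow> 'i cpoly) set \<Rightarrow> 'i cpoly \<Rightarrow> bool"
  where "nilpotent_mod I N a \<longleftrightarrow> (\<exists>k. \<forall>f\<in>poly_alternating I. (\<lambda>x. a ^ k * f x) \<in> N)"

text \<open>Modulo the relations, only monomials with bounded exponents survive in front of the
  generators e_i \<and> e_j, and there are finitely many of them.\<close>

lemma finite_dim_koszul_if_nilpotent:
  assumes fin: "finite I" and K: "K \<subseteq> ext2 I"
    and nilp: "\<And>p. p \<in> I \<Longrightarrow> nilpotent_mod I (koszul_relations I K) (mvar p)"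
  shows "finite_dim_complex (koszul_module I K)"
proof -
  note N = koszul_relations_closed[OF fin K]
  have "\<exists>k. \<forall>p\<in>I. \<forall>f\<in>poly_alternating I. (\<lambda>x. mvar p ^ k p * f x) \<in> koszul_relations I K"
    using nilp unfolding nilpotent_mod_def by metis
  then obtain k where k: "(\<lambda>x. mvar p ^ k p * f x) \<in> koszul_relations I K"
    if "p \<in> I" "f \<in> poly_alternating I" for p f by blast
  \<comment> \<open>A common bound for all exponents. The \<open>Suc\<close> keeps it positive, so a
    variable with exponent at least \<open>L\<close> really occurs in the monomial and hence lies in
    \<open>I\<close>.\<close>
  define L where "L = Suc (\<Sum>p\<in>I. k p)"
  have kL: "k p < L" if "p \<in> I" for p
    using member_le_sum[of p I k] that fin by (simp add: L_def)
  define M where "M = {m :: 'a \<Rightarrow>\<^sub>0 nat. Poly_Mapping.keys m \<subseteq> I \<and> (\<forall>i. Poly_Mapping.lookup m i < L)}"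
  define B where "B = (\<lambda>(m, i, j). \<lambda>x. Poly_Mapping.single m (1::complex) * wedge_unit i j x) ` (M \<times> I \<times> I)"
  have "finite B"
    unfolding B_def M_def using fin finite_bounded_monomials[OF fin] by blast
  moreover have "B \<subseteq> poly_alternating I"
    by (auto simp: B_def M_def intro!: poly_alternating_closed single_in_polys wedge_unit_in_poly_alternating)
  moreover have "H = poly_alternating I"
    if H: "H \<subseteq> poly_alternating I" "complex_subspace H" "koszul_relations I K \<subseteq> H" "B \<subseteq> H" for H
  proof
    have single: "(\<lambda>x. Poly_Mapping.single m c * wedge_unit i j x) \<in> H"
      if m: "Poly_Mapping.keys m \<subseteq> I" and ij: "i \<in> I" "j \<in> I" for m c i j
    proof (cases "m \<in> M")
      case True
      have "(\<lambda>x. Poly_Mapping.single m 1 * wedge_unit i j x) \<in> B"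
        unfolding B_def by (rule image_eqI[of _ _ "(m, i, j)"]) (use True ij in auto)
      then have "(\<lambda>x. cst c * (Poly_Mapping.single m 1 * wedge_unit i j x)) \<in> H"
        using H(4) by (intro complex_subspace_closed(3)[OF H(2)]) blast
      then show ?thesis by (simp add: mult.assoc[symmetric] cst_def mult_single)
    next
      case False
      \<comment> \<open>A monomial outside \<open>M\<close> is divisible by e_p to the power
        \<open>k p\<close>, which sends everything into the relations.\<close>
      then obtain p where p: "Poly_Mapping.lookup m p \<ge> L" using m by (auto simp: M_def not_less)
      then have pI: "p \<in> I" using m by (auto simp: in_keys_iff L_def)
      define m' where "m' = m - Poly_Mapping.single p (k p)"
      have m': "m = Poly_Mapping.single p (k p) + m'"
        using kL[OF pI] p
        by (intro poly_mapping_eqI) (auto simp: m'_def lookup_add lookup_minus lookup_single when_def)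
      have "Poly_Mapping.keys m' \<subseteq> I" using m by (auto simp: m'_def in_keys_iff lookup_minus)
      then have "(\<lambda>x. Poly_Mapping.single m' c * wedge_unit i j x) \<in> poly_alternating I"
        using ij by (intro poly_alternating_closed single_in_polys wedge_unit_in_poly_alternating)
      from k[OF pI this] have "(\<lambda>x. mvar p ^ k p * (Poly_Mapping.single m' c * wedge_unit i j x)) \<in> H"
        using H(3) by blast
      then show ?thesis by (simp add: mult.assoc[symmetric] mvar_power mult_single m'[symmetric])
    qed
    have poly: "(\<lambda>x. s * wedge_unit i j x) \<in> H" if s: "s \<in> polys I" and ij: "i \<in> I" "j \<in> I" for s i j
    proof -
      have "s = (\<Sum>m\<in>Poly_Mapping.keys s. Poly_Mapping.single m (Poly_Mapping.lookup s m))"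
        by (rule poly_mapping_eqI) (simp add: lookup_sum lookup_single when_def in_keys_iff)
      then have "(\<lambda>x. s * wedge_unit i j x) =
        (\<lambda>x. \<Sum>m\<in>Poly_Mapping.keys s. Poly_Mapping.single m (Poly_Mapping.lookup s m) * wedge_unit i j x)"
        by (simp add: sum_distrib_right[symmetric])
      also have "\<dots> \<in> H"
        by (rule sum_mem_if_closed)
          (use s ij in \<open>auto intro!: complex_subspace_closed[OF H(2)] single simp: lincombs_def\<close>)
      finally show ?thesis .
    qed
    show "poly_alternating I \<subseteq> H"
    proof
      fix f assume f: "f \<in> poly_alternating I"
      then have f': "f \<in> alternating I" by (simp add: poly_alternating_def)
      have "f = (\<lambda>x. \<Sum>y\<in>I \<times> I. cst (1/2) * f y * wedge_unit (fst y) (snd y) x)"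
        by (subst alternating_decomp[OF fin f' half_poly]) (simp add: split_beta)
      also have "\<dots> \<in> H"
        by (rule sum_mem_if_closed)
          (use f fin in \<open>auto intro!: complex_subspace_closed[OF H(2)] poly polys_closed simp: poly_alternating_def\<close>)
      finally show "f \<in> H" .
    qed
  qed (rule H(1))
  ultimately show ?thesis unfolding finite_dim_koszul_iff[OF fin K] by blast
qed

text \<open>The relations of the quotient in which the variables indexed by \<open>A\<close> are set
  to zero.\<close>

definition sum_with_multiples ::
  "'i set \<Rightarrow> ('i \<times> 'i \<Rightarrow> 'i cpoly) set \<Rightarrow> 'i set \<Rightarrow> ('i \<times> 'i \<Rightarrow> 'i cpoly) set"
  where "sum_with_multiples I N A = {\<lambda>x. h x + (\<Sum>i\<in>A. mvar i * g i x) | h g.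
    h \<in> N \<and> (\<forall>i\<in>A. g i \<in> poly_alternating I)}"

definition poly_submodule :: "'i set \<Rightarrow> ('i \<times> 'i \<Rightarrow> 'i cpoly) set \<Rightarrow> bool"
  where "poly_submodule I N \<longleftrightarrow> N \<subseteq> poly_alternating I \<and> (\<lambda>x. 0) \<in> N \<and>
    (\<forall>f\<in>N. \<forall>g\<in>N. (\<lambda>x. f x + g x) \<in> N) \<and> (\<forall>a\<in>polys I. \<forall>f\<in>N. (\<lambda>x. a * f x) \<in> N)"

lemma poly_submodule_closed:
  assumes "poly_submodule I N"
  shows "(\<lambda>x. 0) \<in> N" "f \<in> N \<Longrightarrow> g \<in> N \<Longrightarrow> (\<lambda>x. f x + g x) \<in> N"
    "a \<in> polys I \<Longrightarrow> f \<in> N \<Longrightarrow> (\<lambda>x. a * f x) \<in> N" "f \<in> N \<Longrightarrow> f \<in> poly_alternating I"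
  using assms by (auto simp: poly_submodule_def)

lemma poly_submodule_diff:
  assumes "poly_submodule I N" "f \<in> N" "g \<in> N"
  shows "(\<lambda>x. f x - g x) \<in> N"
proof -
  have "(\<lambda>x. cst (-1) * g x) \<in> N" using assms by (intro poly_submodule_closed(3) polys_closed)
  from poly_submodule_closed(2)[OF assms(1,2) this] show ?thesis by (simp add: cst_neg cst_1)
qed

lemma poly_submodule_koszul_relations:
  "finite I \<Longrightarrow> K \<subseteq> ext2 I \<Longrightarrow> poly_submodule I (koszul_relations I K)"
  using koszul_relations_closed[of I K] by (auto simp: poly_submodule_def)

lemma poly_submodule_sum_with_multiples:
  assumes N: "poly_submodule I N" and A: "A \<subseteq> I" "finite I"
  shows "poly_submodule I (sum_with_multiples I N A)"
  unfolding poly_submodule_def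
proof (intro conjI ballI subsetI)
  note c = poly_submodule_closed[OF N]
  have fin: "finite A" using A finite_subset by blast
  fix f assume "f \<in> sum_with_multiples I N A"
  then obtain h g where f: "f = (\<lambda>x. h x + (\<Sum>i\<in>A. mvar i * g i x))" "h \<in> N" "\<And>i. i \<in> A \<Longrightarrow> g i \<in> poly_alternating I"
    unfolding sum_with_multiples_def by blast
  have "(\<lambda>x. \<Sum>i\<in>A. mvar i * g i x) \<in> poly_alternating I"
    by (rule sum_mem_if_closed) (use fin A f(3) in \<open>auto intro!: poly_alternating_closed polys_closed\<close>)
  then show "f \<in> poly_alternating I"
    unfolding f(1) using c(4)[OF f(2)] by (intro poly_alternating_closed)
  {
    fix f' assume "f' \<in> sum_with_multiples I N A"
    then obtain h' g' where f': "f' = (\<lambda>x. h' x + (\<Sum>i\<in>A. mvar i * g' i x))" "h' \<in> N" "\<And>i. i \<in> A \<Longrightarrow> g' i \<in> poly_alternating I"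
      unfolding sum_with_multiples_def by blast
    show "(\<lambda>x. f x + f' x) \<in> sum_with_multiples I N A"
      unfolding sum_with_multiples_def mem_Collect_eq
      by (intro exI[of _ "\<lambda>x. h x + h' x"] exI[of _ "\<lambda>i x. g i x + g' i x"])
        (use f f' c in \<open>auto simp: sum.distrib algebra_simps intro: poly_alternating_closed\<close>)
  }
  fix a assume a: "a \<in> polys I"
  show "(\<lambda>x. a * f x) \<in> sum_with_multiples I N A"
    unfolding sum_with_multiples_def mem_Collect_eq
    by (intro exI[of _ "\<lambda>x. a * h x"] exI[of _ "\<lambda>i x. a * g i x"])
      (use f c a in \<open>auto simp: sum_distrib_left algebra_simps intro: poly_alternating_closed\<close>)
next
  show "(\<lambda>x. 0) \<in> sum_with_multiples I N A"
    unfolding sum_with_multiples_def mem_Collect_eq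
    by (intro exI[of _ "\<lambda>x. 0"] exI[of _ "\<lambda>i x. 0"])
      (use poly_submodule_closed[OF N] in \<open>auto intro: poly_alternating_closed\<close>)
qed

lemma sum_with_multiples_superset: "N \<subseteq> sum_with_multiples I N A"
proof
  fix h assume "h \<in> N"
  then show "h \<in> sum_with_multiples I N A"
    unfolding sum_with_multiples_def mem_Collect_eq
    by (intro exI[of _ h] exI[of _ "\<lambda>i x. 0"]) (auto intro: poly_alternating_closed)
qed

lemma multiple_in_sum_with_multiples:
  assumes "poly_submodule I N" "finite A" "i \<in> A" "f \<in> poly_alternating I"
  shows "(\<lambda>x. mvar i * f x) \<in> sum_with_multiples I N A"
  unfolding sum_with_multiples_def mem_Collect_eq
proof (intro exI conjI)
  have "(\<Sum>k\<in>A. mvar k * (if k = i then f else (\<lambda>x. 0)) x) = (\<Sum>k\<in>A. if k = i then mvar i * f x else 0)" for x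
    by (intro sum.cong) auto
  then show "(\<lambda>x. mvar i * f x) = (\<lambda>x. 0 + (\<Sum>k\<in>A. mvar k * (if k = i then f else (\<lambda>x. 0)) x))"
    using assms(2,3) by simp
qed (use assms in \<open>auto intro: poly_submodule_closed poly_alternating_closed\<close>)

text \<open>Since \<open>a\<close> and \<open>b\<close> commute, repeating the hypothesis l times
  trades a^(kl) for b^l modulo \<open>N\<close>; for large l this power of \<open>b\<close> kills
  everything.\<close>

lemma nilpotent_mod_step:
  assumes N: "poly_submodule I N" and a: "a \<in> polys I" and x: "b \<in> polys I"
    and "nilpotent_mod I N b"
    and "\<exists>k. \<forall>f\<in>poly_alternating I. \<exists>h\<in>N. \<exists>g\<in>poly_alternating I. (\<lambda>x. a ^ k * f x) = (\<lambda>x. h x + b * g x)"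
  shows "nilpotent_mod I N a"
proof -
  note c = poly_submodule_closed[OF N]
  obtain k where k: "\<exists>h\<in>N. \<exists>g\<in>poly_alternating I. (\<lambda>x. a ^ k * f x) = (\<lambda>x. h x + b * g x)"
    if "f \<in> poly_alternating I" for f using assms(5) by blast
  have step: "\<exists>h\<in>N. \<exists>g\<in>poly_alternating I. (\<lambda>x. a ^ (k * l) * f x) = (\<lambda>x. h x + b ^ l * g x)"
    if f: "f \<in> poly_alternating I" for l f
  proof (induction l)
    case 0
    show ?case using f c(1) by (intro bexI[of _ "\<lambda>x. 0"] bexI[of _ f]) auto
  next
    case (Suc l)
    then obtain h g where hg: "h \<in> N" "g \<in> poly_alternating I" "(\<lambda>x. a ^ (k * l) * f x) = (\<lambda>x. h x + b ^ l * g x)"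
      by blast
    obtain h' g' where hg': "h' \<in> N" "g' \<in> poly_alternating I" "(\<lambda>x. a ^ k * g x) = (\<lambda>x. h' x + b * g' x)"
      using k[OF hg(2)] by blast
    have "a ^ (k * Suc l) * f x = (a ^ k * h x + b ^ l * h' x) + b ^ Suc l * g' x" for x
    proof -
      have "a ^ (k * Suc l) * f x = a ^ k * (a ^ (k * l) * f x)" by (simp add: power_add mult.assoc)
      also have "\<dots> = a ^ k * h x + b ^ l * (a ^ k * g x)"
        using fun_cong[OF hg(3), of x] by (simp add: algebra_simps)
      also have "a ^ k * g x = h' x + b * g' x" using fun_cong[OF hg'(3), of x] .
      finally show ?thesis by (simp add: algebra_simps)
    qed
    moreover have "(\<lambda>x. a ^ k * h x + b ^ l * h' x) \<in> N"
      using hg hg' a x by (intro c power_in_polys)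
    ultimately show ?case using hg'(2) by (intro bexI[of _ "\<lambda>x. a ^ k * h x + b ^ l * h' x"] bexI[of _ g']) auto
  qed
  obtain l where l: "\<And>f. f \<in> poly_alternating I \<Longrightarrow> (\<lambda>x. b ^ l * f x) \<in> N"
    using assms(4) unfolding nilpotent_mod_def by blast
  have "(\<lambda>x. a ^ (k * l) * f x) \<in> N" if f: "f \<in> poly_alternating I" for f
  proof -
    obtain h g where hg: "h \<in> N" "g \<in> poly_alternating I" "(\<lambda>x. a ^ (k * l) * f x) = (\<lambda>x. h x + b ^ l * g x)"
      using step[OF f] by blast
    then show ?thesis using c(2)[OF hg(1) l[OF hg(2)]] by simp
  qed
  then show ?thesis unfolding nilpotent_mod_def by blast
qed

text \<open>The module form of the fact that an element nilpotent modulo nilpotent generators is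
  nilpotent. The variables in \<open>A\<close> are removed one at a time, each serving as
  \<open>b\<close> in \<open>nilpotent_mod_step\<close>.\<close>

lemma nilpotent_mod_sum_with_multiples:
  assumes fin: "finite I" and N: "poly_submodule I N" and a: "a \<in> polys I" and "finite A" "A \<subseteq> I"
    and "\<And>i. i \<in> A \<Longrightarrow> nilpotent_mod I N (mvar i)"
    and "nilpotent_mod I (sum_with_multiples I N A) a"
  shows "nilpotent_mod I N a"
  using assms(4-)
proof (induction A)
  case empty
  then show ?case by (simp add: nilpotent_mod_def sum_with_multiples_def)
next
  case (insert i A)
  have "nilpotent_mod I (sum_with_multiples I N A) a"
  proof (rule nilpotent_mod_step[where b = "mvar i"])
    show "poly_submodule I (sum_with_multiples I N A)"
      using insert.prems by (intro poly_submodule_sum_with_multiples N fin) auto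
    show "mvar i \<in> polys I" using insert.prems by (auto intro: polys_closed)
    show "nilpotent_mod I (sum_with_multiples I N A) (mvar i)"
      using insert.prems(2)[of i] sum_with_multiples_superset[of N I A] unfolding nilpotent_mod_def by blast
    obtain k where k: "(\<lambda>x. a ^ k * f x) \<in> sum_with_multiples I N (insert i A)" if "f \<in> poly_alternating I" for f
      using insert.prems(3) unfolding nilpotent_mod_def by blast
    have "\<exists>h\<in>sum_with_multiples I N A. \<exists>g\<in>poly_alternating I. (\<lambda>x. a ^ k * f x) = (\<lambda>x. h x + mvar i * g x)"
      if f: "f \<in> poly_alternating I" for f
    proof -
      obtain h g where hg: "(\<lambda>x. a ^ k * f x) = (\<lambda>x. h x + (\<Sum>i\<in>insert i A. mvar i * g i x))" "h \<in> N"
        "\<And>j. j \<in> insert i A \<Longrightarrow> g j \<in> poly_alternating I"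
        using k[OF f] unfolding sum_with_multiples_def by blast
      have "(\<lambda>x. h x + (\<Sum>i\<in>A. mvar i * g i x)) \<in> sum_with_multiples I N A"
        using hg unfolding sum_with_multiples_def by blast
      moreover have "(\<lambda>x. a ^ k * f x) = (\<lambda>x. (h x + (\<Sum>i\<in>A. mvar i * g i x)) + mvar i * g i x)"
        unfolding hg(1) using insert.hyps by (simp add: add_ac)
      ultimately show ?thesis using hg(3)[of i] by (intro bexI[of _ "\<lambda>x. h x + (\<Sum>i\<in>A. mvar i * g i x)"] bexI[of _ "g i"]) auto
    qed
    then show "\<exists>k. \<forall>f\<in>poly_alternating I. \<exists>h\<in>sum_with_multiples I N A. \<exists>g\<in>poly_alternating I.
        (\<lambda>x. a ^ k * f x) = (\<lambda>x. h x + mvar i * g x)" by blast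
  qed (rule a)
  then show ?case using insert by auto
qed

text \<open>In e_p u, with u written as half the sum of the u(k, l) e_k \<and> e_l, the Koszul
  relation replaces e_p (e_k \<and> e_l) by e_k (e_p \<and> e_l) - e_l (e_p \<and> e_k).
  Antisymmetry of u makes the two halves agree.\<close>

lemma koszul_relation_contract:
  assumes fin: "finite I" and K: "K \<subseteq> ext2 I" and u: "u \<in> K" and p: "p \<in> I"
  shows "(\<lambda>x. \<Sum>k\<in>I. \<Sum>l\<in>I. cst (u (k, l)) * mvar k * wedge_unit p l x) \<in> koszul_relations I K"
proof -
  let ?N = "koszul_relations I K"
  have N: "poly_submodule I ?N" using fin K by (rule poly_submodule_koszul_relations)
  note c = poly_submodule_closed[OF N]
  let ?r = "\<lambda>k l x. mvar p * wedge_unit k l x - mvar k * wedge_unit p l x + mvar l * wedge_unit p k x"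
  have ua: "u \<in> alternating I" using u K ext2_eq[OF fin] by blast
  then have swap: "u (l, k) = - u (k, l)" for k l by (simp add: alternating_def)
  have dec: "cst (u x) = (\<Sum>k\<in>I. \<Sum>l\<in>I. cst (1/2 * u (k, l)) * wedge_unit k l x)" for x
  proof -
    have "u x = (\<Sum>k\<in>I. \<Sum>l\<in>I. (1/2 * u (k, l)) * wedge_unit k l x)"
      using fun_cong[OF alternating_decomp[OF fin ua, of "1/2"], of x] by (simp add: sum.cartesian_product)
    then show ?thesis by (simp only: cst_sum cst_simps(4) cst_wedge_unit)
  qed
  have half: "cst (1/2 * u (k, l)) - cst (1/2 * u (l, k)) = cst (u (k, l))" for k l
    unfolding cst_simps(3)[symmetric] swap[of l k] by simp
  have "(\<lambda>x. mvar p * cst (u x)) \<in> ?N"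
    using cst_in_koszul_relations[OF fin K u] by (intro c(3) polys_closed p)
  moreover have "(\<lambda>x. \<Sum>k\<in>I. (\<lambda>x. \<Sum>l\<in>I. (\<lambda>x. cst (1/2 * u (k, l)) * ?r k l x) x) x) \<in> ?N"
    by (intro sum_mem_if_closed fin c koszul_relation_wedge_unit K p polys_closed)
  ultimately have "(\<lambda>x. mvar p * cst (u x) - (\<Sum>k\<in>I. \<Sum>l\<in>I. cst (1/2 * u (k, l)) * ?r k l x)) \<in> ?N"
    by (rule poly_submodule_diff[OF N])
  also have "(\<lambda>x. mvar p * cst (u x) - (\<Sum>k\<in>I. \<Sum>l\<in>I. cst (1/2 * u (k, l)) * ?r k l x)) =
    (\<lambda>x. \<Sum>k\<in>I. \<Sum>l\<in>I. cst (u (k, l)) * mvar k * wedge_unit p l x)"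
  proof
    fix x
    have "mvar p * cst (u x) - (\<Sum>k\<in>I. \<Sum>l\<in>I. cst (1/2 * u (k, l)) * ?r k l x) =
      (\<Sum>k\<in>I. \<Sum>l\<in>I. cst (1/2 * u (k, l)) * mvar k * wedge_unit p l x) -
      (\<Sum>k\<in>I. \<Sum>l\<in>I. cst (1/2 * u (k, l)) * mvar l * wedge_unit p k x)"
      unfolding dec sum_distrib_left sum_subtractf[symmetric] by (intro sum.cong refl) (simp add: algebra_simps)
    \<comment> \<open>Exchanging the index names puts both sums over the same tensors e_k (e_p
      \<and> e_l).\<close>
    also have "(\<Sum>k\<in>I. \<Sum>l\<in>I. cst (1/2 * u (k, l)) * mvar l * wedge_unit p k x) =
      (\<Sum>k\<in>I. \<Sum>l\<in>I. cst (1/2 * u (l, k)) * mvar k * wedge_unit p l x)"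
      by (rule sum.swap)
    also have "(\<Sum>k\<in>I. \<Sum>l\<in>I. cst (1/2 * u (k, l)) * mvar k * wedge_unit p l x) -
      (\<Sum>k\<in>I. \<Sum>l\<in>I. cst (1/2 * u (l, k)) * mvar k * wedge_unit p l x) =
      (\<Sum>k\<in>I. \<Sum>l\<in>I. (cst (1/2 * u (k, l)) - cst (1/2 * u (l, k))) * mvar k * wedge_unit p l x)"
      unfolding sum_subtractf[symmetric] by (simp add: algebra_simps)
    also have "\<dots> = (\<Sum>k\<in>I. \<Sum>l\<in>I. cst (u (k, l)) * mvar k * wedge_unit p l x)"
      by (simp only: half)
    finally show "mvar p * cst (u x) - (\<Sum>k\<in>I. \<Sum>l\<in>I. cst (1/2 * u (k, l)) * ?r k l x) =
      (\<Sum>k\<in>I. \<Sum>l\<in>I. cst (u (k, l)) * mvar k * wedge_unit p l x)" .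
  qed
  finally show ?thesis .
qed

section \<open>Finiteness from homogeneous relations\<close>

lemma poly_alternating_generated:
  assumes fin: "finite I" and H: "poly_submodule I H"
    and "\<And>i j. i \<in> I \<Longrightarrow> j \<in> I \<Longrightarrow> wedge_unit i j \<in> H"
  shows "poly_alternating I \<subseteq> H"
proof
  fix f assume f: "f \<in> poly_alternating I"
  then have f': "f \<in> alternating I" by (simp add: poly_alternating_def)
  have "f = (\<lambda>x. \<Sum>y\<in>I \<times> I. cst (1/2) * f y * wedge_unit (fst y) (snd y) x)"
    by (subst alternating_decomp[OF fin f' half_poly]) (simp add: split_beta)
  also have "\<dots> \<in> H"
    by (rule sum_mem_if_closed)
      (use fin assms(3) poly_alternating_mem(1)[OF f] in \<open>auto intro!: poly_submodule_closed[OF H] polys_closed\<close>)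
  finally show "f \<in> H" .
qed

text \<open>The combinatorial core, free of sl_2: basis vectors have distinct degrees, and each pair
  occurs in a homogeneous element of \<open>K\<close>. The outer induction is on the degree of the
  variable, the inner one on the degree of its partner in e_p \<and> e_l.\<close>

lemma finite_dim_koszul_if_weights:
  fixes deg :: "'i \<Rightarrow> nat"
  assumes fin: "finite I" and K: "K \<subseteq> ext2 I" and inj: "inj_on deg I"
    and weights: "\<And>p q. p \<in> I \<Longrightarrow> q \<in> I \<Longrightarrow> p \<noteq> q \<Longrightarrow>
      \<exists>u\<in>K. u (p, q) \<noteq> 0 \<and> (\<forall>k l. u (k, l) \<noteq> 0 \<longrightarrow> deg k + deg l = deg p + deg q)"
  shows "finite_dim_complex (koszul_module I K)"
proof (rule finite_dim_koszul_if_nilpotent[OF fin K])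
  let ?N = "koszul_relations I K"
  have N: "poly_submodule I ?N" using fin K by (rule poly_submodule_koszul_relations)
  fix p assume "p \<in> I"
  then show "nilpotent_mod I ?N (mvar p)"
  proof (induction "deg p" arbitrary: p rule: less_induct)
    case less
    note p = \<open>p \<in> I\<close>
    define A where "A = {i \<in> I. deg i < deg p}"
    define N' where "N' = sum_with_multiples I ?N A"
    have A: "A \<subseteq> I" "finite A" using fin by (auto simp: A_def)
    have N': "poly_submodule I N'"
      unfolding N'_def using N A fin by (intro poly_submodule_sum_with_multiples)
    note c' = poly_submodule_closed[OF N']
    \<comment> \<open>The tensors killed by some power of e_p modulo \<open>N'\<close>. This
      submodule contains f whenever it contains e_p f, so divisions by e_p become membership
      statements and no exponents have to be tracked.\<close>
    define Z where "Z = {f \<in> poly_alternating I. \<exists>m. (\<lambda>x. mvar p ^ m * f x) \<in> N'}"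
    have pow: "(\<lambda>x. mvar p ^ (m + m') * f x) \<in> N'" if "(\<lambda>x. mvar p ^ m * f x) \<in> N'" for f m m'
    proof -
      have "(\<lambda>x. mvar p ^ m' * (mvar p ^ m * f x)) \<in> N'"
        by (rule c'(3)[OF power_in_polys[OF polys_closed(4)[OF p]] that])
      then show ?thesis by (simp add: power_add mult_ac)
    qed
    have Z: "poly_submodule I Z"
      unfolding poly_submodule_def
    proof (intro conjI ballI)
      show "(\<lambda>x. 0) \<in> Z" using c' by (auto simp: Z_def intro: poly_alternating_closed)
      fix f assume f: "f \<in> Z"
      then obtain m where m: "(\<lambda>x. mvar p ^ m * f x) \<in> N'" by (auto simp: Z_def)
      {
        fix g assume g: "g \<in> Z"
        then obtain m' where m': "(\<lambda>x. mvar p ^ m' * g x) \<in> N'" by (auto simp: Z_def)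
        have "(\<lambda>x. mvar p ^ (m + m') * f x + mvar p ^ (m' + m) * g x) \<in> N'"
          by (rule c'(2)[OF pow[OF m] pow[OF m']])
        then have "(\<lambda>x. mvar p ^ (m + m') * (f x + g x)) \<in> N'"
          by (simp add: distrib_left add.commute)
        then show "(\<lambda>x. f x + g x) \<in> Z" using f g by (auto simp: Z_def intro: poly_alternating_closed)
      }
      fix a assume a: "a \<in> polys I"
      have "(\<lambda>x. a * (mvar p ^ m * f x)) \<in> N'" by (rule c'(3)[OF a m])
      then have "(\<lambda>x. mvar p ^ m * (a * f x)) \<in> N'" by (simp add: mult_ac)
      then show "(\<lambda>x. a * f x) \<in> Z" using f a by (auto simp: Z_def intro: poly_alternating_closed)
    qed (auto simp: Z_def)
    note cz = poly_submodule_closed[OF Z]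
    have N'_Z: "f \<in> Z" if "f \<in> N'" for f
    proof -
      have "(\<lambda>x. mvar p ^ 0 * f x) \<in> N'" using that by simp
      then show ?thesis using c'(4)[OF that] unfolding Z_def by blast
    qed
    have N_Z: "f \<in> Z" if "f \<in> ?N" for f
      using sum_with_multiples_superset[of ?N I A] that by (intro N'_Z) (auto simp: N'_def)
    have A_Z: "(\<lambda>x. mvar i * f x) \<in> Z" if "i \<in> A" "f \<in> poly_alternating I" for i f
      unfolding N'_def using multiple_in_sum_with_multiples[OF N A(2) that] by (intro N'_Z) (simp add: N'_def)
    have div_Z: "f \<in> Z" if pf: "(\<lambda>x. mvar p * f x) \<in> Z" and f: "f \<in> poly_alternating I" for f
    proof -
      obtain m where "(\<lambda>x. mvar p ^ m * (mvar p * f x)) \<in> N'" using pf by (auto simp: Z_def)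
      then have "(\<lambda>x. mvar p ^ Suc m * f x) \<in> N'" by (simp add: mult_ac)
      then show ?thesis using f unfolding Z_def by blast
    qed
    have unit_p: "wedge_unit p l \<in> Z" if "l \<in> I" for l
      using that
    proof (induction "deg l" arbitrary: l rule: less_induct)
      case (less l)
      note l = \<open>l \<in> I\<close>
      show ?case
      proof (cases "l = p")
        case True
        then have "wedge_unit p l = (\<lambda>x. 0 :: 'i cpoly)" by (simp add: wedge_unit_def)
        then show ?thesis using cz(1) by simp
      next
        case False
        then obtain u where u: "u \<in> K" "u (p, l) \<noteq> 0"
          "\<And>i j. u (i, j) \<noteq> 0 \<Longrightarrow> deg i + deg j = deg p + deg l"
          using weights[of p l] p l by blast
        let ?t = "\<lambda>y x. cst (u y) * mvar (fst y) * wedge_unit p (snd y) x"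
        have total: "(\<lambda>x. \<Sum>y\<in>I \<times> I. ?t y x) \<in> Z"
          using N_Z[OF koszul_relation_contract[OF fin K u(1) p]]
          by (simp add: sum.cartesian_product split_beta)
        have rest: "(\<lambda>x. ?t y x) \<in> Z" if y: "y \<in> I \<times> I - {(p, l)}" for y
        proof (cases "u y = 0")
          case True
          then show ?thesis using cz(1) by (simp add: cst_simps)
        next
          case nz: False
          obtain i j where ij: "y = (i, j)" "i \<in> I" "j \<in> I" using y by auto
          have deg: "deg i + deg j = deg p + deg l" using u(3) nz ij by auto
          have w: "wedge_unit p j \<in> poly_alternating I"
            using p ij by (intro wedge_unit_in_poly_alternating)
          \<comment> \<open>By homogeneity, either e_i is zero modulo \<open>N'\<close>, or
            injectivity of \<open>deg\<close> makes this the excluded pair (p, l), or deg j < deg l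
            and the inner induction applies.\<close>
          consider "deg i < deg p" | "deg i = deg p" | "deg i > deg p" by linarith
          then show ?thesis
          proof cases
            case 1
            then have "(\<lambda>x. cst (u y) * (mvar i * wedge_unit p j x)) \<in> Z"
              using ij w by (intro cz(3) A_Z polys_closed) (auto simp: A_def)
            then show ?thesis by (simp add: ij mult_ac)
          next
            case 2
            then have "i = p" "j = l" using deg inj ij p l by (auto dest: inj_onD)
            then show ?thesis using y ij by simp
          next
            case 3
            then have "wedge_unit p j \<in> Z" using deg ij by (intro less.hyps) auto
            then have "(\<lambda>x. cst (u y) * mvar i * wedge_unit p j x) \<in> Z"
              using ij by (intro cz(3) polys_closed)
            then show ?thesis by (simp add: ij)
          qed
        qed
        \<comment> \<open>Subtracting the other terms isolates u(p, l) e_p (e_p \<and> e_l); its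
          coefficient is invertible and \<open>div_Z\<close> removes the e_p.\<close>
        have "(\<lambda>x. \<Sum>y\<in>I \<times> I - {(p, l)}. ?t y x) \<in> Z"
          by (rule sum_mem_if_closed) (use fin cz rest in auto)
        from poly_submodule_diff[OF Z total this]
        have "(\<lambda>x. ?t (p, l) x) \<in> Z"
          using fin p l by (simp add: sum.remove[of "I \<times> I" "(p, l)"])
        from cz(3)[OF polys_closed(3) this, of "1 / u (p, l)"]
        have "(\<lambda>x. cst (1 / u (p, l)) * (cst (u (p, l)) * mvar p * wedge_unit p l x)) \<in> Z"
          by simp
        also have "(\<lambda>x. cst (1 / u (p, l)) * (cst (u (p, l)) * mvar p * wedge_unit p l x)) =
          (\<lambda>x. mvar p * wedge_unit p l x)"
          using u(2) by (simp add: mult.assoc[symmetric] cst_simps(4)[symmetric] cst_1)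
        finally show ?thesis by (rule div_Z[OF _ wedge_unit_in_poly_alternating[OF p l]])
      qed
    qed
    \<comment> \<open>The Koszul relation expresses e_p (e_i \<and> e_j) through e_p \<and> e_i and
      e_p \<and> e_j.\<close>
    have unit_Z: "wedge_unit i j \<in> Z" if ij: "i \<in> I" "j \<in> I" for i j
    proof (rule div_Z)
      have "(\<lambda>x. (mvar p * wedge_unit i j x - mvar i * wedge_unit p j x + mvar j * wedge_unit p i x) +
          (mvar i * wedge_unit p j x - mvar j * wedge_unit p i x)) \<in> Z"
        using ij p by (intro cz(2) poly_submodule_diff[OF Z] cz(3) unit_p polys_closed N_Z
            koszul_relation_wedge_unit fin K)
      then show "(\<lambda>x. mvar p * wedge_unit i j x) \<in> Z" by simp
    qed (use ij in \<open>rule wedge_unit_in_poly_alternating\<close>)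
    then have "\<exists>m. \<forall>i\<in>I. \<forall>j\<in>I. (\<lambda>x. mvar p ^ m (i, j) * wedge_unit i j x) \<in> N'"
      unfolding Z_def by (intro exI[of _ "\<lambda>y. SOME m. (\<lambda>x. mvar p ^ m * wedge_unit (fst y) (snd y) x) \<in> N'"])
        (auto intro: someI_ex)
    then obtain m where m: "(\<lambda>x. mvar p ^ m (i, j) * wedge_unit i j x) \<in> N'"
      if "i \<in> I" "j \<in> I" for i j by blast
    \<comment> \<open>A common exponent for the finitely many generators e_i \<and> e_j.\<close>
    define M where "M = (\<Sum>y\<in>I \<times> I. m y)"
    have "poly_alternating I \<subseteq> {f \<in> poly_alternating I. (\<lambda>x. mvar p ^ M * f x) \<in> N'}"
    proof (rule poly_alternating_generated[OF fin])
      show "poly_submodule I {f \<in> poly_alternating I. (\<lambda>x. mvar p ^ M * f x) \<in> N'}"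
        unfolding poly_submodule_def
        using c'(1) c'(2)[of "\<lambda>x. mvar p ^ M * f x" "\<lambda>x. mvar p ^ M * g x" for f g]
          c'(3)[of _ "\<lambda>x. mvar p ^ M * f x" for f]
        by (auto simp: distrib_left mult.left_commute[of "mvar p ^ M"] intro: poly_alternating_closed)
      fix i j assume ij: "i \<in> I" "j \<in> I"
      have "m (i, j) \<le> M" unfolding M_def using fin ij by (intro member_le_sum) auto
      then have "(\<lambda>x. mvar p ^ M * wedge_unit i j x) \<in> N'"
        using pow[OF m[OF ij], of "M - m (i, j)"] by simp
      then show "wedge_unit i j \<in> {f \<in> poly_alternating I. (\<lambda>x. mvar p ^ M * f x) \<in> N'}"
        using ij by (simp add: wedge_unit_in_poly_alternating)
    qed
    then have "nilpotent_mod I N' (mvar p)" unfolding nilpotent_mod_def by blast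
    moreover have "nilpotent_mod I ?N (mvar i)" if "i \<in> A" for i
      using that less.hyps by (auto simp: A_def)
    ultimately show ?case
      using nilpotent_mod_sum_with_multiples[OF fin N _ A(2,1)] p by (auto simp: N'_def intro: polys_closed)
  qed
qed

section \<open>The summand of highest weight\<close>

text \<open>The exponent of the basis vector e_s. Subtraction is truncated, so the degree is n only
  for s \<le> n.\<close>

definition binary_exp :: "nat \<Rightarrow> nat \<Rightarrow> 2 \<Rightarrow>\<^sub>0 nat"
  where "binary_exp n s = Poly_Mapping.single 1 (n - s) + Poly_Mapping.single 2 s"

lemma lookup_binary_exp [simp]:
  "Poly_Mapping.lookup (binary_exp n s) 1 = n - s" "Poly_Mapping.lookup (binary_exp n s) 2 = s"
  by (simp_all add: binary_exp_def lookup_add lookup_single when_def)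

lemma exp_eq_iff: "m = m' \<longleftrightarrow> Poly_Mapping.lookup m 1 = Poly_Mapping.lookup m' 1 \<and>
  Poly_Mapping.lookup m 2 = Poly_Mapping.lookup m' 2" for m m' :: "2 \<Rightarrow>\<^sub>0 nat"
  by (auto simp: poly_mapping_eq_iff fun_eq_iff forall_2)

lemma binary_exp_eq_iff: "binary_exp n s = binary_exp n t \<longleftrightarrow> s = t"
  by (auto simp: exp_eq_iff)

lemma mem_irrep_basis: "m \<in> irrep_basis n \<longleftrightarrow> Poly_Mapping.lookup m 1 + Poly_Mapping.lookup m 2 = n"
proof -
  have "mdeg m = (\<Sum>i\<in>UNIV. Poly_Mapping.lookup m i)"
    unfolding mdeg_def by (rule sum.mono_neutral_left) (auto simp: in_keys_iff)
  then show ?thesis by (simp add: irrep_basis_def monomials_def sum_2)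
qed

lemma irrep_basis_eq: "irrep_basis n = binary_exp n ` {..n}"
proof (intro equalityI subsetI)
  fix m assume "m \<in> irrep_basis n"
  then show "m \<in> binary_exp n ` {..n}"
    by (intro image_eqI[of _ _ "Poly_Mapping.lookup m 2"]) (auto simp: mem_irrep_basis exp_eq_iff)
qed (auto simp: mem_irrep_basis)

lemma finite_irrep_basis: "finite (irrep_basis n)"
  by (simp add: irrep_basis_eq)

lemma binary_exp_in_irrep_basis: "s \<le> n \<Longrightarrow> binary_exp n s \<in> irrep_basis n"
  by (simp add: irrep_basis_eq)

lemma inj_on_lookup_irrep_basis: "inj_on (\<lambda>m. Poly_Mapping.lookup m 2) (irrep_basis n)"
  by (auto simp: inj_on_def mem_irrep_basis exp_eq_iff)

lemma sum_irrep_basis: "(\<Sum>m\<in>irrep_basis n. f m) = (\<Sum>s\<le>n. f (binary_exp n s))"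
  unfolding irrep_basis_eq by (rule sum.reindex_cong[of "binary_exp n"]) (auto simp: inj_on_def binary_exp_eq_iff)

section \<open>Coordinates of the sl_2-action\<close>

lemma lookup_single_mult: "Poly_Mapping.lookup (Poly_Mapping.single a 1 * q) (a + b) = Poly_Mapping.lookup q b"
  for q :: "'i cpoly"
  by (induction q rule: cpoly_induct) (simp_all add: mult_single lookup_single when_def distrib_left lookup_add)

lemma lookup_mvar_mult:
  "Poly_Mapping.lookup (mvar i * q) m =
    (if Poly_Mapping.lookup m i = 0 then 0 else Poly_Mapping.lookup q (m - Poly_Mapping.single i 1))"
proof (cases "Poly_Mapping.lookup m i = 0")
  case True
  then show ?thesis by (simp add: lookup_mvar_mult_eq_0)
next
  case False
  then have "m = Poly_Mapping.single i 1 + (m - Poly_Mapping.single i 1)"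
    by (intro poly_mapping_eqI) (auto simp: lookup_add lookup_minus lookup_single when_def)
  then show ?thesis
    using False lookup_single_mult[of "Poly_Mapping.single i 1" q "m - Poly_Mapping.single i 1"]
    by (simp add: mvar_def)
qed

lemma lookup_sym_act:
  "Poly_Mapping.lookup (sym_act X p) m =
    (\<Sum>j\<in>UNIV. \<Sum>i\<in>UNIV. X $ i $ j * (if Poly_Mapping.lookup m i = 0 then 0
      else of_nat (Poly_Mapping.lookup (m - Poly_Mapping.single i 1) j + 1) *
        Poly_Mapping.lookup p (m - Poly_Mapping.single i 1 + Poly_Mapping.single j 1)))"
  unfolding sym_act_def sum_distrib_right lookup_sum mult.assoc lookup_cst_mult lookup_mvar_mult
    lookup_mpoly_deriv by simp

text \<open>Coordinate s receives contributions from s, s + 1 and s - 1, each weighted by the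
  exponent of the differentiated variable in the source monomial. The guards end the weight string
  where \<open>binary_exp\<close> would leave degree n or repeat itself.\<close>

lemma lookup_sym_act_binary_exp:
  assumes "s \<le> n"
  shows "Poly_Mapping.lookup (sym_act X p) (binary_exp n s) =
    (X $ 1 $ 1 * of_nat (n - s) + X $ 2 $ 2 * of_nat s) * Poly_Mapping.lookup p (binary_exp n s) +
    X $ 1 $ 2 * (if s < n then of_nat (s + 1) * Poly_Mapping.lookup p (binary_exp n (s + 1)) else 0) +
    X $ 2 $ 1 * (if 0 < s then of_nat (n - s + 1) * Poly_Mapping.lookup p (binary_exp n (s - 1)) else 0)"
proof -
  let ?m = "binary_exp n s"
  let ?t = "\<lambda>i j. if Poly_Mapping.lookup ?m i = 0 then 0
    else of_nat (Poly_Mapping.lookup (?m - Poly_Mapping.single i 1) j + 1) *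
      Poly_Mapping.lookup p (?m - Poly_Mapping.single i 1 + Poly_Mapping.single j 1)"
  have "?m - Poly_Mapping.single 1 1 + Poly_Mapping.single 1 1 = ?m" if "s < n"
    using that by (auto simp: exp_eq_iff lookup_add lookup_minus lookup_single when_def)
  then have t11: "?t 1 1 = of_nat (n - s) * Poly_Mapping.lookup p ?m"
    by (cases "s < n") (simp_all add: lookup_minus Suc_diff_Suc del: One_nat_def)
  have "?m - Poly_Mapping.single 1 1 + Poly_Mapping.single 2 1 = binary_exp n (s + 1)" if "s < n"
    using that by (auto simp: exp_eq_iff lookup_add lookup_minus lookup_single when_def)
  then have t12: "?t 1 2 = (if s < n then of_nat (s + 1) * Poly_Mapping.lookup p (binary_exp n (s + 1)) else 0)"
    by (cases "s < n") (simp_all add: lookup_minus lookup_single del: One_nat_def)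
  have "?m - Poly_Mapping.single 2 1 + Poly_Mapping.single 2 1 = ?m" if "0 < s"
    using that by (auto simp: exp_eq_iff lookup_add lookup_minus lookup_single when_def)
  then have t22: "?t 2 2 = of_nat s * Poly_Mapping.lookup p ?m"
    by (cases "0 < s") (simp_all add: lookup_minus del: One_nat_def)
  have "?m - Poly_Mapping.single 2 1 + Poly_Mapping.single 1 1 = binary_exp n (s - 1)" if "0 < s"
    using that assms by (auto simp: exp_eq_iff lookup_add lookup_minus lookup_single when_def)
  then have t21: "?t 2 1 = (if 0 < s then of_nat (n - s + 1) * Poly_Mapping.lookup p (binary_exp n (s - 1)) else 0)"
    by (cases "0 < s") (simp_all add: lookup_minus lookup_single del: One_nat_def)
  show ?thesis
    unfolding lookup_sym_act sum_2 t11 t12 t21 t22 by (simp only: distrib_right mult.assoc add_ac)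
qed

lemma sym_act_Sym_part:
  assumes "p \<in> Sym_part UNIV n"
  shows "sym_act X p \<in> Sym_part UNIV n"
proof -
  have "Poly_Mapping.lookup (sym_act X p) m = 0" if "m \<notin> irrep_basis n" for m
  proof -
    have "Poly_Mapping.lookup p (m - Poly_Mapping.single i 1 + Poly_Mapping.single j 1) = 0"
      if "Poly_Mapping.lookup m i \<noteq> 0" for i j
    proof -
      have "m - Poly_Mapping.single i 1 + Poly_Mapping.single j 1 \<notin> irrep_basis n"
        using that \<open>m \<notin> irrep_basis n\<close> exhaust_2[of i] exhaust_2[of j]
        by (auto simp: mem_irrep_basis lookup_add lookup_minus lookup_single)
      then show ?thesis using assms by (simp add: Sym_part_def lincombs_iff irrep_basis_def)
    qed
    then show ?thesis by (auto simp: lookup_sym_act intro!: sum.neutral)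
  qed
  then show ?thesis by (simp add: Sym_part_def lincombs_iff irrep_basis_def)
qed

lemma tensor2_act_binary_exp:
  assumes s: "s \<le> n" and t: "t \<le> n"
  shows "tensor2_act (irrep_basis n) (sym_act X) u (binary_exp n s, binary_exp n t) =
    (X $ 1 $ 1 * (of_nat (n - s) + of_nat (n - t)) + X $ 2 $ 2 * (of_nat s + of_nat t)) * u (binary_exp n s, binary_exp n t) +
    X $ 1 $ 2 * ((if s < n then of_nat (s + 1) * u (binary_exp n (s + 1), binary_exp n t) else 0) +
      (if t < n then of_nat (t + 1) * u (binary_exp n s, binary_exp n (t + 1)) else 0)) +
    X $ 2 $ 1 * ((if 0 < s then of_nat (n - s + 1) * u (binary_exp n (s - 1), binary_exp n t) else 0) +
      (if 0 < t then of_nat (n - t + 1) * u (binary_exp n s, binary_exp n (t - 1)) else 0))"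
proof -
  \<comment> \<open>One tensor factor at a time: \<open>v\<close> is a row or a column of
    \<open>u\<close>.\<close>
  have row: "(\<Sum>r\<le>n. Poly_Mapping.lookup (sym_act X (Poly_Mapping.single (binary_exp n r) 1)) (binary_exp n s) * v r) =
    (X $ 1 $ 1 * of_nat (n - s) + X $ 2 $ 2 * of_nat s) * v s +
    X $ 1 $ 2 * (if s < n then of_nat (s + 1) * v (s + 1) else 0) +
    X $ 2 $ 1 * (if 0 < s then of_nat (n - s + 1) * v (s - 1) else 0)" if s: "s \<le> n" for s and v :: "nat \<Rightarrow> complex"
  proof -
    have "(\<Sum>r\<le>n. Poly_Mapping.lookup (sym_act X (Poly_Mapping.single (binary_exp n r) 1)) (binary_exp n s) * v r) =
      (\<Sum>r\<le>n. (if r = s then (X $ 1 $ 1 * of_nat (n - s) + X $ 2 $ 2 * of_nat s) * v s else 0) +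
        (if r = s + 1 then (if s < n then X $ 1 $ 2 * of_nat (s + 1) * v (s + 1) else 0) else 0) +
        (if r = s - 1 then (if 0 < s then X $ 2 $ 1 * of_nat (n - s + 1) * v (s - 1) else 0) else 0))"
      by (intro sum.cong refl)
        (auto simp: lookup_sym_act_binary_exp[OF s] lookup_single binary_exp_eq_iff when_def)
    also have "\<dots> = (X $ 1 $ 1 * of_nat (n - s) + X $ 2 $ 2 * of_nat s) * v s +
        (if s < n then X $ 1 $ 2 * of_nat (s + 1) * v (s + 1) else 0) +
        (if 0 < s then X $ 2 $ 1 * of_nat (n - s + 1) * v (s - 1) else 0)"
      unfolding sum.distrib using s by auto
    finally show ?thesis by auto
  qed
  show ?thesis
    unfolding tensor2_act_def prod.case sum.distrib sum_irrep_basis row[OF s] row[OF t]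
    by (simp add: algebra_simps)
qed

lemma tensor2_act_outside:
  assumes "\<And>x. x \<notin> irrep_basis n \<times> irrep_basis n \<Longrightarrow> u x = 0" and "x \<notin> irrep_basis n \<times> irrep_basis n"
  shows "tensor2_act (irrep_basis n) (sym_act X) u x = 0"
proof -
  have zero: "Poly_Mapping.lookup (sym_act X (Poly_Mapping.single k 1)) m = 0"
    if "k \<in> irrep_basis n" "m \<notin> irrep_basis n" for k m
  proof -
    have "Poly_Mapping.single k 1 \<in> Sym_part UNIV n"
      using that(1) by (simp add: Sym_part_def irrep_basis_def single_in_lincombs)
    then have "sym_act X (Poly_Mapping.single k 1) \<in> Sym_part UNIV n" by (rule sym_act_Sym_part)
    then show ?thesis using that(2) by (simp add: Sym_part_def lincombs_iff irrep_basis_def)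
  qed
  obtain i j where x: "x = (i, j)" by (cases x)
  show ?thesis
    unfolding tensor2_act_def x prod.case
    using assms zero[of _ i] zero[of _ j] by (intro sum.neutral) (auto simp: x)
qed

lemma sl2_trace: "X \<in> sl2 \<longleftrightarrow> X $ 2 $ 2 = - X $ 1 $ 1"
  by (auto simp: sl2_def trace_def sum_2 add_eq_0_iff)

section \<open>The wedge square as an sl_2-module\<close>

lemma wedge_square_simps:
  "carrier (wedge_square n) = alternating (irrep_basis n)"
  "\<zero>\<^bsub>wedge_square n\<^esub> = (\<lambda>x. 0)"
  "f \<oplus>\<^bsub>wedge_square n\<^esub> g = (\<lambda>x. f x + g x)"
  "c \<odot>\<^bsub>wedge_square n\<^esub> f = (\<lambda>x. c * f x)"
  "act (wedge_square n) X f = tensor2_act (irrep_basis n) (sym_act X) f"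
  by (simp_all add: wedge_square_def module.defs sl2_module.defs free_module_def ext2_eq[OF finite_irrep_basis])

lemma alternating_closed:
  "(\<lambda>x. 0) \<in> alternating I" "f \<in> alternating I \<Longrightarrow> g \<in> alternating I \<Longrightarrow> (\<lambda>x. f x + g x) \<in> alternating I"
  "f \<in> alternating I \<Longrightarrow> (\<lambda>x. c * f x) \<in> alternating I"
  by (auto simp: alternating_def minus_mult_right simp del: mult_minus_right)

lemma module_wedge_square: "module complex_field (wedge_square n)"
proof -
  have "submodule (alternating (irrep_basis n)) complex_field (free_module complex_field (irrep_basis n \<times> irrep_basis n))"
    unfolding submodule_complex_iff by (auto intro: alternating_closed alternating_outside)
  from submodule.submodule_is_module[OF this module_free_module[OF cring_complex_field]]
  show ?thesis
    by (rule module_cong)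
      (auto simp: wedge_square_def module.defs sl2_module.defs free_module_def ext2_eq[OF finite_irrep_basis])
qed

lemma sl2_submodule_wedge_square_iff:
  "sl2_submodule K (wedge_square n) \<longleftrightarrow> K \<subseteq> alternating (irrep_basis n) \<and> (\<lambda>x. 0) \<in> K \<and>
    (\<forall>f\<in>K. \<forall>g\<in>K. (\<lambda>x. f x + g x) \<in> K) \<and> (\<forall>c. \<forall>f\<in>K. (\<lambda>x. c * f x) \<in> K) \<and>
    (\<forall>X\<in>sl2. \<forall>u\<in>K. tensor2_act (irrep_basis n) (sym_act X) u \<in> K)"
  unfolding sl2_submodule_def module.submodule_iff[OF module_wedge_square] wedge_square_simps by simp

text \<open>
  With \<open>x\<^sub>i = C(n,i) e\<^sub>i\<close> in the monomial basis \<open>e\<^sub>i\<close> of \<open>V\<^sub>n\<close>, the tensor \<open>highest_tensor n g\<close> is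
  \<open>\<Sum>\<^sub>c g(c) \<Sum>\<^bsub>i + j = c\<^esub> j x\<^sub>i \<and> x\<^sub>j\<close>; the inner sums are the coefficients of \<open>x(t) \<and> x'(t)\<close> for
  \<open>x(t) = \<Sum>\<^sub>i x\<^sub>i t\<^sup>i\<close>.
\<close>

definition highest_tensor :: "nat \<Rightarrow> (nat \<Rightarrow> complex) \<Rightarrow> (2 \<Rightarrow>\<^sub>0 nat) \<times> (2 \<Rightarrow>\<^sub>0 nat) \<Rightarrow> complex"
  where "highest_tensor n g = (\<lambda>(k, l). if k \<in> irrep_basis n \<and> l \<in> irrep_basis n then
    (let i = Poly_Mapping.lookup k 2; j = Poly_Mapping.lookup l 2 in
      g (i + j) * (of_nat j - of_nat i) * of_nat (n choose i) * of_nat (n choose j)) else 0)"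

lemma highest_tensor_binary_exp:
  assumes "s \<le> n" "t \<le> n"
  shows "highest_tensor n g (binary_exp n s, binary_exp n t) =
    g (s + t) * (of_nat t - of_nat s) * of_nat (n choose s) * of_nat (n choose t)"
  using assms by (simp add: highest_tensor_def binary_exp_in_irrep_basis Let_def)

lemma highest_tensor_alternating: "highest_tensor n g \<in> alternating (irrep_basis n)"
  by (auto simp: alternating_def highest_tensor_def Let_def algebra_simps)

lemma alternating_irrep_basis_eqI:
  assumes u: "u \<in> alternating (irrep_basis n)" and v: "v \<in> alternating (irrep_basis n)"
    and eq: "\<And>s t. s \<le> n \<Longrightarrow> t \<le> n \<Longrightarrow> u (binary_exp n s, binary_exp n t) = v (binary_exp n s, binary_exp n t)"
  shows "u = v"
proof
  fix x
  show "u x = v x"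
  proof (cases "x \<in> irrep_basis n \<times> irrep_basis n")
    case True
    then obtain s t where "x = (binary_exp n s, binary_exp n t)" "s \<le> n" "t \<le> n"
      by (auto simp: irrep_basis_eq)
    then show ?thesis using eq by simp
  next
    case False
    then show ?thesis using alternating_outside u v by metis
  qed
qed

text \<open>Indices 0 and 2n arise only on the diagonal, where j - i = 0. This leaves 2n - 1
  parameters, the dimension of V_{2n-2}.\<close>

lemma highest_tensor_cong:
  assumes "\<And>c. 1 \<le> c \<Longrightarrow> c \<le> 2 * n - 1 \<Longrightarrow> g c = g' c"
  shows "highest_tensor n g = highest_tensor n g'"
proof (rule alternating_irrep_basis_eqI[OF highest_tensor_alternating highest_tensor_alternating])
  fix s t assume st: "s \<le> n" "t \<le> n"
  then have "s = t \<or> 1 \<le> s + t \<and> s + t \<le> 2 * n - 1" by linarith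
  then show "highest_tensor n g (binary_exp n s, binary_exp n t) =
      highest_tensor n g' (binary_exp n s, binary_exp n t)"
    using assms[of "s + t"] st by (auto simp: highest_tensor_binary_exp)
qed

lemma highest_tensor_add: "(\<lambda>x. highest_tensor n g x + highest_tensor n g' x) = highest_tensor n (\<lambda>c. g c + g' c)"
  by (auto simp: highest_tensor_def Let_def algebra_simps fun_eq_iff)

lemma highest_tensor_scale: "(\<lambda>x. a * highest_tensor n g x) = highest_tensor n (\<lambda>c. a * g c)"
  by (auto simp: highest_tensor_def Let_def algebra_simps fun_eq_iff)

lemma highest_tensor_zero: "highest_tensor n (\<lambda>c. 0) = (\<lambda>x. 0)"
  by (auto simp: highest_tensor_def Let_def fun_eq_iff)

lemma tensor2_act_alternating:
  assumes u: "u \<in> alternating (irrep_basis n)"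
  shows "tensor2_act (irrep_basis n) (sym_act X) u \<in> alternating (irrep_basis n)"
proof -
  have "- tensor2_act (irrep_basis n) (sym_act X) u (i, j) = tensor2_act (irrep_basis n) (sym_act X) u (j, i)" for i j
    unfolding tensor2_act_def prod.case sum_negf[symmetric]
  proof (rule sum.cong[OF refl])
    fix k
    have "u (j, k) = - u (k, j)" "u (k, i) = - u (i, k)" using u by (simp_all add: alternating_def)
    then show "- (Poly_Mapping.lookup (sym_act X (Poly_Mapping.single k 1)) i * u (k, j) +
       Poly_Mapping.lookup (sym_act X (Poly_Mapping.single k 1)) j * u (i, k)) =
      Poly_Mapping.lookup (sym_act X (Poly_Mapping.single k 1)) j * u (k, i) +
       Poly_Mapping.lookup (sym_act X (Poly_Mapping.single k 1)) i * u (j, k)"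
      by simp
  qed
  moreover have "tensor2_act (irrep_basis n) (sym_act X) u x = 0" if "x \<notin> irrep_basis n \<times> irrep_basis n" for x
    using tensor2_act_outside[OF _ that, of u X] alternating_outside[OF u] by blast
  ultimately show ?thesis unfolding alternating_def by blast
qed

text \<open>The action on V_N, N = 2n - 2, in coordinates for the basis C(N,k) e_k, shifted to c = k
  + 1. At c = 1 and c = 2n - 1 the factors of the outside neighbours vanish.\<close>

definition weight_act :: "nat \<Rightarrow> complex^2^2 \<Rightarrow> (nat \<Rightarrow> complex) \<Rightarrow> nat \<Rightarrow> complex"
  where "weight_act n X g c = X $ 1 $ 1 * (2 * of_nat n - 2 * of_nat c) * g c +
    X $ 1 $ 2 * (2 * of_nat n - 1 - of_nat c) * g (c + 1) + X $ 2 $ 1 * (of_nat c - 1) * g (c - 1)"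

lemma of_nat_binomial_Suc:
  assumes "k \<le> n"
  shows "of_nat (k + 1) * of_nat (n choose (k + 1)) = (of_nat n - of_nat k) * (of_nat (n choose k) :: complex)"
proof -
  have "Suc k * (n choose Suc k) = (n - k) * (n choose k)"
    unfolding binomial_absorption binomial_absorb_comp ..
  then have "of_nat (Suc k * (n choose Suc k)) = (of_nat ((n - k) * (n choose k)) :: complex)" by simp
  then show ?thesis using assms by (simp add: of_nat_diff distrib_right)
qed

text \<open>Absorption extracts the common factor C(n,s) C(n,t). The rest combines by (n-s)(t-s-1) +
  (n-t)(t-s+1) = (2n-1-s-t)(t-s) and s(t-s+1) + t(t-s-1) = (s+t-1)(t-s), so the shape with factor t
  - s is preserved.\<close>

lemma tensor2_act_highest_tensor:
  assumes X: "X \<in> sl2"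
  shows "tensor2_act (irrep_basis n) (sym_act X) (highest_tensor n g) = highest_tensor n (weight_act n X g)"
proof (rule alternating_irrep_basis_eqI[OF tensor2_act_alternating[OF highest_tensor_alternating] highest_tensor_alternating])
  fix s t assume st: "s \<le> n" "t \<le> n"
  note up = of_nat_binomial_Suc
  have down: "of_nat (n - s + 1) * of_nat (n choose (s - 1)) = of_nat s * (of_nat (n choose s) :: complex)"
    if "s \<le> n" "0 < s" for s
    using up[of "s - 1"] that by (simp add: of_nat_diff algebra_simps)
  let ?C = "of_nat (n choose s) * of_nat (n choose t) :: complex"
  \<comment> \<open>The factor n - s vanishes at s = n, so the formula needs no guard; the three
    analogues below behave in the same way.\<close>
  have up_s: "(if s < n then of_nat (s + 1) * highest_tensor n g (binary_exp n (s + 1), binary_exp n t) else 0) =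
    (of_nat n - of_nat s) * (of_nat t - of_nat s - 1) * ?C * g (s + t + 1)"
  proof (cases "s < n")
    case True
    then have "of_nat (s + 1) * highest_tensor n g (binary_exp n (s + 1), binary_exp n t) =
      (of_nat (s + 1) * of_nat (n choose (s + 1))) * ((of_nat t - of_nat (s + 1)) * of_nat (n choose t) * g (s + 1 + t))"
      using st by (subst highest_tensor_binary_exp) (simp_all only: mult_ac)
    then show ?thesis unfolding up[OF st(1)] using True by simp
  qed (use st in simp)
  have up_t: "(if t < n then of_nat (t + 1) * highest_tensor n g (binary_exp n s, binary_exp n (t + 1)) else 0) =
    (of_nat n - of_nat t) * (of_nat t + 1 - of_nat s) * ?C * g (s + t + 1)"
  proof (cases "t < n")
    case True
    then have "of_nat (t + 1) * highest_tensor n g (binary_exp n s, binary_exp n (t + 1)) =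
      (of_nat (t + 1) * of_nat (n choose (t + 1))) * ((of_nat (t + 1) - of_nat s) * of_nat (n choose s) * g (s + (t + 1)))"
      using st by (subst highest_tensor_binary_exp) (simp_all only: mult_ac)
    then show ?thesis unfolding up[OF st(2)] using True by (simp add: add.commute)
  qed (use st in simp)
  have down_s: "(if 0 < s then of_nat (n - s + 1) * highest_tensor n g (binary_exp n (s - 1), binary_exp n t) else 0) =
    of_nat s * (of_nat t - of_nat s + 1) * ?C * g (s + t - 1)"
  proof (cases "0 < s")
    case True
    then have "of_nat (n - s + 1) * highest_tensor n g (binary_exp n (s - 1), binary_exp n t) =
      (of_nat (n - s + 1) * of_nat (n choose (s - 1))) * ((of_nat t - of_nat (s - 1)) * of_nat (n choose t) * g (s - 1 + t))"
      using st by (subst highest_tensor_binary_exp) (simp_all only: mult_ac)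
    then show ?thesis unfolding down[OF st(1) True] using True by (simp add: of_nat_diff)
  qed simp
  have down_t: "(if 0 < t then of_nat (n - t + 1) * highest_tensor n g (binary_exp n s, binary_exp n (t - 1)) else 0) =
    of_nat t * (of_nat t - 1 - of_nat s) * ?C * g (s + t - 1)"
  proof (cases "0 < t")
    case True
    then have "of_nat (n - t + 1) * highest_tensor n g (binary_exp n s, binary_exp n (t - 1)) =
      (of_nat (n - t + 1) * of_nat (n choose (t - 1))) * ((of_nat (t - 1) - of_nat s) * of_nat (n choose s) * g (s + (t - 1)))"
      using st by (subst highest_tensor_binary_exp) (simp_all only: mult_ac)
    then show ?thesis unfolding down[OF st(2) True] using True by (simp add: of_nat_diff)
  qed simp
  have X22: "X $ 2 $ 2 = - X $ 1 $ 1" using X by (simp add: sl2_trace)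
  show "tensor2_act (irrep_basis n) (sym_act X) (highest_tensor n g) (binary_exp n s, binary_exp n t) =
    highest_tensor n (weight_act n X g) (binary_exp n s, binary_exp n t)"
    unfolding tensor2_act_binary_exp[OF st] up_s up_t down_s down_t highest_tensor_binary_exp[OF st] weight_act_def X22
    using st by (simp add: of_nat_diff algebra_simps)
qed

section \<open>The span of the u_c as a submodule\<close>

definition highest_summand :: "nat \<Rightarrow> ((2 \<Rightarrow>\<^sub>0 nat) \<times> (2 \<Rightarrow>\<^sub>0 nat) \<Rightarrow> complex) set"
  where "highest_summand n = range (highest_tensor n)"

lemma sl2_submodule_highest_summand: "sl2_submodule (highest_summand n) (wedge_square n)"
  using rangeI[of "highest_tensor n" "\<lambda>c. 0"] unfolding sl2_submodule_wedge_square_iff highest_summand_def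
  by (auto simp: highest_tensor_alternating highest_tensor_add highest_tensor_scale
      tensor2_act_highest_tensor highest_tensor_zero)

lemma sl2_submodule_closed:
  assumes "sl2_submodule K (wedge_square n)"
  shows "f \<in> K \<Longrightarrow> f \<in> alternating (irrep_basis n)" "(\<lambda>x. 0) \<in> K"
    "f \<in> K \<Longrightarrow> g \<in> K \<Longrightarrow> (\<lambda>x. f x + g x) \<in> K" "f \<in> K \<Longrightarrow> (\<lambda>x. c * f x) \<in> K"
    "X \<in> sl2 \<Longrightarrow> f \<in> K \<Longrightarrow> tensor2_act (irrep_basis n) (sym_act X) f \<in> K"
  using assms unfolding sl2_submodule_wedge_square_iff by blast+

text \<open>The tensor u_c, of weight 2n - 2c.\<close>

abbreviation weight_vector :: "nat \<Rightarrow> nat \<Rightarrow> (2 \<Rightarrow>\<^sub>0 nat) \<times> (2 \<Rightarrow>\<^sub>0 nat) \<Rightarrow> complex"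
  where "weight_vector n c \<equiv> highest_tensor n (\<lambda>i. of_bool (i = c))"

definition cartan :: "complex^2^2"
  where "cartan = (\<chi> i j. if i = j then (if i = 1 then 1 else -1) else 0)"

text \<open>Sends X_1 to X_2: weights drop by 2, so indices rise by 1.\<close>

definition lowering :: "complex^2^2"
  where "lowering = (\<chi> i j. if i = 2 \<and> j = 1 then 1 else 0)"

lemma cartan_entries [simp]: "cartan $ 1 $ 1 = 1" "cartan $ 2 $ 2 = -1" "cartan $ 1 $ 2 = 0" "cartan $ 2 $ 1 = 0"
  and lowering_entries [simp]: "lowering $ 1 $ 1 = 0" "lowering $ 2 $ 2 = 0" "lowering $ 1 $ 2 = 0" "lowering $ 2 $ 1 = 1"
  by (simp_all add: cartan_def lowering_def)

lemma cartan_lowering_sl2: "cartan \<in> sl2" "lowering \<in> sl2"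
  by (simp_all add: sl2_trace)

lemma tensor2_act_cartan:
  assumes "s \<le> n" "t \<le> n"
  shows "tensor2_act (irrep_basis n) (sym_act cartan) u (binary_exp n s, binary_exp n t) =
    (2 * of_nat n - 2 * of_nat (s + t)) * u (binary_exp n s, binary_exp n t)"
  using assms by (simp add: tensor2_act_binary_exp of_nat_diff algebra_simps)

text \<open>The weight space of \<open>V\<^sub>n \<and> V\<^sub>n\<close> of weight \<open>2n - 2\<close> is spanned by \<open>e\<^sub>0 \<and> e\<^sub>1\<close>.\<close>

lemma alternating_weight_1:
  assumes n: "n \<ge> 1" and u: "u \<in> alternating (irrep_basis n)"
    and "\<And>s t. s \<le> n \<Longrightarrow> t \<le> n \<Longrightarrow> s + t \<noteq> 1 \<Longrightarrow> u (binary_exp n s, binary_exp n t) = 0"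
  shows "u = (\<lambda>x. (u (binary_exp n 0, binary_exp n 1) / of_nat n) * weight_vector n 1 x)"
proof (rule alternating_irrep_basis_eqI[OF u alternating_closed(3)[OF highest_tensor_alternating]])
  fix s t assume st: "s \<le> n" "t \<le> n"
  \<comment> \<open>The divisor n is the coordinate C(n,0) C(n,1) of u_1 at (e_0, e_1).\<close>
  consider "s + t \<noteq> 1" | "s = 0" "t = 1" | "s = 1" "t = 0" by linarith
  then show "u (binary_exp n s, binary_exp n t) =
    (u (binary_exp n 0, binary_exp n 1) / of_nat n) * weight_vector n 1 (binary_exp n s, binary_exp n t)"
  proof cases
    case 1
    then show ?thesis using assms(3) st by (simp add: highest_tensor_binary_exp)
  next
    case 2
    then show ?thesis using n by (simp add: highest_tensor_binary_exp)
  next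
    case 3
    have "u (binary_exp n 1, binary_exp n 0) = - u (binary_exp n 0, binary_exp n 1)"
      using u by (simp add: alternating_def)
    then show ?thesis using n 3 by (simp add: highest_tensor_binary_exp)
  qed
qed

text \<open>Lowering sends u_c to c u_{c+1}, and c is never zero for c \<ge> 1, so every u_c is
  reached from u_1.\<close>

lemma highest_summand_subset_if_weight_vector:
  assumes K: "sl2_submodule K (wedge_square n)" and w: "weight_vector n 1 \<in> K"
  shows "highest_summand n \<subseteq> K"
proof -
  note c = sl2_submodule_closed[OF K]
  have vec: "weight_vector n (Suc i) \<in> K" for i
  proof (induction i)
    case 0
    then show ?case using w by simp
  next
    case (Suc i)
    have "weight_act n lowering (\<lambda>j. of_bool (j = Suc i)) = (\<lambda>j. of_nat (Suc i) * of_bool (j = Suc (Suc i)))"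
      by (auto simp: weight_act_def fun_eq_iff)
    then have "(\<lambda>x. of_nat (Suc i) * weight_vector n (Suc (Suc i)) x) \<in> K"
      using c(5)[OF cartan_lowering_sl2(2) Suc]
      by (simp only: tensor2_act_highest_tensor[OF cartan_lowering_sl2(2)] highest_tensor_scale)
    from c(4)[OF this, of "1 / of_nat (Suc i)"] show ?case
      by (simp add: field_simps del: of_nat_Suc)
  qed
  show ?thesis
  proof
    fix u assume "u \<in> highest_summand n"
    then obtain g where g: "u = highest_tensor n g" by (auto simp: highest_summand_def)
    \<comment> \<open>The index c = i + 1 runs up to 2n, where the weight vector is zero.\<close>
    have "(\<lambda>x. \<Sum>i<2 * n. (\<lambda>x. g (Suc i) * weight_vector n (Suc i) x) x) \<in> K"
      by (rule sum_mem_if_closed) (use c vec in auto)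
    also have "(\<lambda>x. \<Sum>i<2 * n. (\<lambda>x. g (Suc i) * weight_vector n (Suc i) x) x) = u"
    proof -
      have "(\<lambda>x. \<Sum>i<m. g (Suc i) * weight_vector n (Suc i) x) =
        highest_tensor n (\<lambda>c. \<Sum>i<m. g (Suc i) * of_bool (c = Suc i))" for m
      proof (induction m)
        case (Suc m)
        then show ?case
          by (simp only: sum.lessThan_Suc highest_tensor_add[symmetric] highest_tensor_scale[symmetric]
              Suc[THEN fun_cong])
      qed (simp add: highest_tensor_zero)
      moreover have "highest_tensor n (\<lambda>c. \<Sum>i<2 * n. g (Suc i) * of_bool (c = Suc i)) = highest_tensor n g"
      proof (rule highest_tensor_cong)
        fix c assume c: "1 \<le> c" "c \<le> 2 * n - 1"
        have "(\<Sum>i<2 * n. g (Suc i) * of_bool (c = Suc i)) = (\<Sum>i<2 * n. if i = c - 1 then g c else 0)"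
          using c by (intro sum.cong) auto
        moreover have "c - 1 < 2 * n" using c by linarith
        ultimately show "(\<Sum>i<2 * n. g (Suc i) * of_bool (c = Suc i)) = g c"
          by (simp only: sum.delta finite_lessThan lessThan_iff if_True)
      qed
      ultimately show ?thesis by (simp only: g)
    qed
    finally show "u \<in> K" .
  qed
qed

text \<open>The weight components of \<open>u\<close> other than the one of weight \<open>2n - 2\<close> are removed one at a time.\<close>

lemma highest_summand_subset:
  assumes n: "n \<ge> 1" and K: "sl2_submodule K (wedge_square n)"
    and u: "u \<in> K" "u (binary_exp n 0, binary_exp n 1) \<noteq> 0"
  shows "highest_summand n \<subseteq> K"
proof -
  note c = sl2_submodule_closed[OF K]
  have "\<exists>u'\<in>K. u' (binary_exp n 0, binary_exp n 1) \<noteq> 0 \<and>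
    (\<forall>s\<le>n. \<forall>t\<le>n. s + t \<in> A \<longrightarrow> u' (binary_exp n s, binary_exp n t) = 0)" if "finite A" "1 \<notin> A" for A
    using that
  proof (induction A)
    case empty
    then show ?case using u by blast
  next
    case (insert a A)
    then obtain u' where u': "u' \<in> K" "u' (binary_exp n 0, binary_exp n 1) \<noteq> 0"
      "\<And>s t. s \<le> n \<Longrightarrow> t \<le> n \<Longrightarrow> s + t \<in> A \<Longrightarrow> u' (binary_exp n s, binary_exp n t) = 0" by blast
    \<comment> \<open>The Cartan element minus its eigenvalue at index a: this kills index a and
      scales index 1 by 2(a - 1), which is nonzero since a \<noteq> 1.\<close>
    define v where "v = (\<lambda>x. tensor2_act (irrep_basis n) (sym_act cartan) u' x + - (2 * of_nat n - 2 * of_nat a) * u' x)"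
    have v: "v (binary_exp n s, binary_exp n t) = 2 * (of_nat a - of_nat (s + t)) * u' (binary_exp n s, binary_exp n t)"
      if "s \<le> n" "t \<le> n" for s t
      unfolding v_def tensor2_act_cartan[OF that] by (simp add: algebra_simps)
    have "v \<in> K" unfolding v_def by (intro c(3,4,5) cartan_lowering_sl2 u')
    moreover have "v (binary_exp n 0, binary_exp n 1) \<noteq> 0"
      using u'(2) insert.prems n by (subst v) auto
    moreover have "v (binary_exp n s, binary_exp n t) = 0" if "s \<le> n" "t \<le> n" "s + t \<in> insert a A" for s t
      using v[OF that(1,2)] u'(3)[OF that(1,2)] that(3) by auto
    ultimately show ?case by blast
  qed
  from this[of "{..2 * n} - {1}"] obtain u' where u': "u' \<in> K" "u' (binary_exp n 0, binary_exp n 1) \<noteq> 0"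
    "\<And>s t. s \<le> n \<Longrightarrow> t \<le> n \<Longrightarrow> s + t \<in> {..2 * n} - {1} \<Longrightarrow> u' (binary_exp n s, binary_exp n t) = 0"
    by auto
  define a where "a = u' (binary_exp n 0, binary_exp n 1) / of_nat n"
  have "u' = (\<lambda>x. a * weight_vector n 1 x)"
    unfolding a_def by (rule alternating_weight_1[OF n c(1)[OF u'(1)]]) (use u'(3) in auto)
  then have "(\<lambda>x. a * weight_vector n 1 x) \<in> K" using u'(1) by simp
  from c(4)[OF this, of "1 / a"] have "weight_vector n 1 \<in> K"
    using u'(2) n by (simp add: a_def)
  then show ?thesis by (rule highest_summand_subset_if_weight_vector[OF K])
qed

text \<open>On V_N with N = 2n - 2, this sends C(N,k) e_k to u_{k+1}.\<close>

definition highest_embedding :: "nat \<Rightarrow> 2 cpoly \<Rightarrow> (2 \<Rightarrow>\<^sub>0 nat) \<times> (2 \<Rightarrow>\<^sub>0 nat) \<Rightarrow> complex"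
  where "highest_embedding n f = highest_tensor n
    (\<lambda>c. Poly_Mapping.lookup f (binary_exp (2 * n - 2) (c - 1)) / of_nat ((2 * n - 2) choose (c - 1)))"

lemma highest_embedding_add:
  "highest_embedding n (f + g) = (\<lambda>x. highest_embedding n f x + highest_embedding n g x)"
  by (simp add: highest_embedding_def highest_tensor_add lookup_add add_divide_distrib)

lemma highest_embedding_scale:
  "highest_embedding n (cst c * f) = (\<lambda>x. c * highest_embedding n f x)"
  by (simp add: highest_embedding_def highest_tensor_scale lookup_cst_mult)

lemma Sym_part_binary_eqI:
  assumes "f \<in> Sym_part UNIV m" "g \<in> Sym_part UNIV m"
    and "\<And>k. k \<le> m \<Longrightarrow> Poly_Mapping.lookup f (binary_exp m k) = Poly_Mapping.lookup g (binary_exp m k)"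
  shows "f = g"
proof (rule poly_mapping_eqI)
  fix x
  show "Poly_Mapping.lookup f x = Poly_Mapping.lookup g x"
  proof (cases "x \<in> irrep_basis m")
    case True
    then show ?thesis using assms(3) by (auto simp: irrep_basis_eq)
  next
    case False
    then show ?thesis using assms(1,2) by (simp add: Sym_part_def lincombs_iff irrep_basis_def)
  qed
qed

lemma Sym_part_decomp:
  assumes "f \<in> Sym_part UNIV m"
  shows "f = (\<Sum>k\<le>m. cst (Poly_Mapping.lookup f (binary_exp m k)) * Poly_Mapping.single (binary_exp m k) 1)"
proof (rule poly_mapping_eqI)
  fix x
  have *: "Poly_Mapping.lookup (\<Sum>k\<le>m. cst (Poly_Mapping.lookup f (binary_exp m k)) * Poly_Mapping.single (binary_exp m k) 1) x =
    (\<Sum>k\<le>m. if binary_exp m k = x then Poly_Mapping.lookup f x else 0)"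
    unfolding lookup_sum lookup_cst_mult by (intro sum.cong) (auto simp: lookup_single)
  show "Poly_Mapping.lookup f x =
    Poly_Mapping.lookup (\<Sum>k\<le>m. cst (Poly_Mapping.lookup f (binary_exp m k)) * Poly_Mapping.single (binary_exp m k) 1) x"
  proof (cases "x \<in> irrep_basis m")
    case True
    then obtain k where "x = binary_exp m k" "k \<le> m" by (auto simp: irrep_basis_eq)
    then show ?thesis unfolding * by (simp add: binary_exp_eq_iff)
  next
    case False
    then have "binary_exp m k \<noteq> x" if "k \<le> m" for k using that by (auto simp: irrep_basis_eq)
    then show ?thesis unfolding * using assms False by (simp add: Sym_part_def lincombs_iff irrep_basis_def)
  qed
qed

lemma single_binary_exp_in_Sym_part: "k \<le> m \<Longrightarrow> Poly_Mapping.single (binary_exp m k) c \<in> Sym_part UNIV m"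
  unfolding Sym_part_def irrep_basis_def[symmetric] by (rule single_in_lincombs) (rule binary_exp_in_irrep_basis)

lemma Sym_part_closed:
  "0 \<in> Sym_part I m" "f \<in> Sym_part I m \<Longrightarrow> g \<in> Sym_part I m \<Longrightarrow> f + g \<in> Sym_part I m"
  "f \<in> Sym_part I m \<Longrightarrow> cst c * f \<in> Sym_part I m"
  by (auto simp: Sym_part_def lincombs_iff lookup_add lookup_cst_mult)

lemma sum_in_Sym_part: "(\<And>a. a \<in> A \<Longrightarrow> f a \<in> Sym_part I m) \<Longrightarrow> sum f A \<in> Sym_part I m"
  by (induction A rule: infinite_finite_induct) (auto intro: Sym_part_closed)

lemma highest_tensor_eqD:
  assumes eq: "highest_tensor n g = highest_tensor n g'" and c: "1 \<le> c" "c \<le> 2 * n - 1"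
  shows "g c = g' c"
proof -
  \<comment> \<open>The pair (0, c), or (c - n, n) when c > n; the bound c \<le> 2n - 1 gives s < t,
    hence a nonzero coefficient.\<close>
  obtain s t where s: "s \<le> n" "t \<le> n" "s < t" "s + t = c"
    by (rule that[of "if c \<le> n then 0 else c - n" "if c \<le> n then c else n"]) (use c in auto)
  have "highest_tensor n g (binary_exp n s, binary_exp n t) = highest_tensor n g' (binary_exp n s, binary_exp n t)"
    using eq by simp
  then show ?thesis using s by (simp add: highest_tensor_binary_exp)
qed

lemma highest_embedding_sl2:
  assumes X: "X \<in> sl2" and n: "n \<ge> 1"
  shows "highest_embedding n (sym_act X f) = tensor2_act (irrep_basis n) (sym_act X) (highest_embedding n f)"
  unfolding highest_embedding_def tensor2_act_highest_tensor[OF X]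
proof (rule highest_tensor_cong)
  fix c assume c: "1 \<le> c" "c \<le> 2 * n - 1"
  define k where "k = c - 1"
  define N where "N = 2 * n - 2"
  let ?f = "\<lambda>k. Poly_Mapping.lookup f (binary_exp N k)"
  have k: "k \<le> N" "c = Suc k" using c by (auto simp: k_def N_def)
  note up = of_nat_binomial_Suc
  have nz: "of_nat (N choose j) \<noteq> (0 :: complex)" if "j \<le> N" for j using that by simp
  have frac: "x * y / z = w * (y / r)" if "x * r = w * z" "z \<noteq> 0" "r \<noteq> 0" for x y z w r :: complex
  proof -
    have "x * y * r = w * y * z" using that(1) by (metis mult.assoc mult.commute)
    then show ?thesis using that(2,3) by (simp add: frac_eq_eq)
  qed
  \<comment> \<open>At k = N the right side divides by C(N, N + 1) = 0, but its first factor
    vanishes as well.\<close>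
  have a: "(if k < N then of_nat (k + 1) * ?f (k + 1) else 0) / of_nat (N choose k) =
    (of_nat N - of_nat k) * (?f (k + 1) / of_nat (N choose (k + 1)))"
  proof (cases "k < N")
    case True
    then show ?thesis using frac[OF up[OF k(1)] nz nz] k(1) by simp
  qed (use k in simp)
  have b: "(if 0 < k then of_nat (N - k + 1) * ?f (k - 1) else 0) / of_nat (N choose k) =
    of_nat k * (?f (k - 1) / of_nat (N choose (k - 1)))"
  proof (cases "0 < k")
    case True
    have "of_nat (N - k + 1) * of_nat (N choose (k - 1)) = of_nat k * (of_nat (N choose k) :: complex)"
      using up[of "k - 1"] True k by (simp add: of_nat_diff algebra_simps)
    from frac[OF this nz nz] show ?thesis using True k by simp
  qed simp
  have X22: "X $ 2 $ 2 = - X $ 1 $ 1" using X by (simp add: sl2_trace)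
  have N: "of_nat N = 2 * of_nat n - (2 :: complex)" using n by (simp add: N_def of_nat_diff)
  have "Poly_Mapping.lookup (sym_act X f) (binary_exp N k) / of_nat (N choose k) =
    X $ 1 $ 1 * (of_nat N - 2 * of_nat k) * (?f k / of_nat (N choose k)) +
    X $ 1 $ 2 * ((if k < N then of_nat (k + 1) * ?f (k + 1) else 0) / of_nat (N choose k)) +
    X $ 2 $ 1 * ((if 0 < k then of_nat (N - k + 1) * ?f (k - 1) else 0) / of_nat (N choose k))"
    unfolding lookup_sym_act_binary_exp[OF k(1)] X22 using k(1)
    by (simp only: add_divide_distrib times_divide_eq_right of_nat_diff) (simp add: algebra_simps)
  also have "\<dots> = weight_act n X (\<lambda>c. ?f (c - 1) / of_nat (N choose (c - 1))) c"
    unfolding a b weight_act_def k(2) N by (simp add: algebra_simps add_divide_distrib)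
  finally show "Poly_Mapping.lookup (sym_act X f) (binary_exp (2 * n - 2) (c - 1)) / of_nat ((2 * n - 2) choose (c - 1)) =
    weight_act n X (\<lambda>c. Poly_Mapping.lookup f (binary_exp (2 * n - 2) (c - 1)) / of_nat ((2 * n - 2) choose (c - 1))) c"
    by (simp only: k_def N_def)
qed

lemma bij_betw_highest_embedding:
  assumes n: "n \<ge> 1"
  shows "bij_betw (highest_embedding n) (Sym_part UNIV (2 * n - 2)) (highest_summand n)"
  unfolding bij_betw_def
proof
  show "inj_on (highest_embedding n) (Sym_part UNIV (2 * n - 2))"
  proof (rule inj_onI)
    fix f g assume fg: "f \<in> Sym_part UNIV (2 * n - 2)" "g \<in> Sym_part UNIV (2 * n - 2)"
      and eq: "highest_embedding n f = highest_embedding n g"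
    show "f = g"
    proof (rule Sym_part_binary_eqI[OF fg])
      fix k assume k: "k \<le> 2 * n - 2"
      have "Suc k \<le> 2 * n - 1" using k n by linarith
      from highest_tensor_eqD[OF eq[unfolded highest_embedding_def] _ this]
      show "Poly_Mapping.lookup f (binary_exp (2 * n - 2) k) = Poly_Mapping.lookup g (binary_exp (2 * n - 2) k)"
        using k by simp
    qed
  qed
  show "highest_embedding n ` Sym_part UNIV (2 * n - 2) = highest_summand n"
  proof
    show "highest_summand n \<subseteq> highest_embedding n ` Sym_part UNIV (2 * n - 2)"
    proof
      fix u assume "u \<in> highest_summand n"
      then obtain g where g: "u = highest_tensor n g" by (auto simp: highest_summand_def)
      define f where "f = (\<Sum>k\<le>2 * n - 2. Poly_Mapping.single (binary_exp (2 * n - 2) k)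
        (g (Suc k) * of_nat ((2 * n - 2) choose k)))"
      have "f \<in> Sym_part UNIV (2 * n - 2)"
        unfolding f_def by (rule sum_in_Sym_part) (simp add: single_binary_exp_in_Sym_part)
      moreover have "u = highest_embedding n f"
        unfolding g highest_embedding_def
      proof (rule highest_tensor_cong)
        fix c assume c: "1 \<le> c" "c \<le> 2 * n - 1"
        then have le: "c - 1 \<le> 2 * n - 2" by linarith
        have "Poly_Mapping.lookup f (binary_exp (2 * n - 2) (c - 1)) =
          (\<Sum>k\<le>2 * n - 2. if k = c - 1 then g c * of_nat ((2 * n - 2) choose (c - 1)) else 0)"
          unfolding f_def lookup_sum using c by (intro sum.cong) (auto simp: lookup_single binary_exp_eq_iff when_def)
        also have "\<dots> = g c * of_nat ((2 * n - 2) choose (c - 1))"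
          using le by (simp only: sum.delta finite_atMost atMost_iff if_True)
        finally show "g c = Poly_Mapping.lookup f (binary_exp (2 * n - 2) (c - 1)) / of_nat ((2 * n - 2) choose (c - 1))"
          using le by simp
      qed
      ultimately show "u \<in> highest_embedding n ` Sym_part UNIV (2 * n - 2)" by blast
    qed
  qed (auto simp: highest_summand_def highest_embedding_def)
qed

lemma sl2_isomorphic_highest_summand:
  assumes n: "n \<ge> 1"
  shows "sl2_isomorphic (irrep (2 * n - 2)) ((wedge_square n)\<lparr>carrier := highest_summand n\<rparr>)"
  unfolding sl2_isomorphic_def
proof (intro exI[of _ "highest_embedding n"] conjI ballI allI)
  show "bij_betw (highest_embedding n) (carrier (irrep (2 * n - 2)))
    (carrier ((wedge_square n)\<lparr>carrier := highest_summand n\<rparr>))"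
    using bij_betw_highest_embedding[OF n] by (simp add: irrep_def)
qed (simp_all add: irrep_def wedge_square_simps highest_embedding_sl2[OF _ n] highest_embedding_add
    highest_embedding_scale)

text \<open>An equivariant map sends e_0 to a vector of weight 2n - 2, hence to a multiple of u_1,
  nonzero by injectivity; so \<open>U\<close> contains all u_c. Conversely, lowering generates
  V_{2n-2} from e_0, so the image stays in their span.\<close>

lemma summand_eq_highest_summand:
  assumes n: "n \<ge> 1" and U: "sl2_submodule U (wedge_square n)"
    and iso: "sl2_isomorphic (irrep (2 * n - 2)) ((wedge_square n)\<lparr>carrier := U\<rparr>)"
  shows "U = highest_summand n"
proof -
  define N where "N = 2 * n - 2"
  obtain \<phi> where bij: "bij_betw \<phi> (Sym_part UNIV N) U"
    and add: "\<And>f g. f \<in> Sym_part UNIV N \<Longrightarrow> g \<in> Sym_part UNIV N \<Longrightarrow> \<phi> (f + g) = (\<lambda>x. \<phi> f x + \<phi> g x)"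
    and scale: "\<And>c f. f \<in> Sym_part UNIV N \<Longrightarrow> \<phi> (cst c * f) = (\<lambda>x. c * \<phi> f x)"
    and act: "\<And>X f. X \<in> sl2 \<Longrightarrow> f \<in> Sym_part UNIV N \<Longrightarrow>
      \<phi> (sym_act X f) = tensor2_act (irrep_basis n) (sym_act X) (\<phi> f)"
    using iso unfolding sl2_isomorphic_def by (auto simp: irrep_def wedge_square_simps N_def)
  let ?e = "\<lambda>k. Poly_Mapping.single (binary_exp N k) (1 :: complex)"
  have e: "?e k \<in> Sym_part UNIV N" if "k \<le> N" for k using that by (rule single_binary_exp_in_Sym_part)
  note cU = sl2_submodule_closed[OF U]
  note cH = sl2_submodule_closed[OF sl2_submodule_highest_summand[of n]]
  have mem: "\<phi> f \<in> U" if "f \<in> Sym_part UNIV N" for f using bij that by (auto simp: bij_betw_def)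
  have zero: "\<phi> 0 = (\<lambda>x. 0)" using scale[OF Sym_part_closed(1), of 0] by (simp add: cst_simps)
  define v where "v = \<phi> (?e 0)"
  have v_alt: "v \<in> alternating (irrep_basis n)" using cU(1) mem e by (simp add: v_def)
  have "sym_act cartan (?e 0) = cst (of_nat N) * ?e 0"
    by (rule Sym_part_binary_eqI[OF sym_act_Sym_part[OF e] Sym_part_closed(3)[OF e]])
      (auto simp: lookup_sym_act_binary_exp lookup_cst_mult lookup_single binary_exp_eq_iff)
  then have v_weight: "tensor2_act (irrep_basis n) (sym_act cartan) v = (\<lambda>x. of_nat N * v x)"
    using act[OF cartan_lowering_sl2(1) e, of 0] scale[OF e, of 0 "of_nat N"] by (simp add: v_def)
  have "v (binary_exp n s, binary_exp n t) = 0" if st: "s \<le> n" "t \<le> n" "s + t \<noteq> 1" for s t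
  proof -
    have "(2 * of_nat n - 2 * of_nat (s + t)) * v (binary_exp n s, binary_exp n t) =
      of_nat N * v (binary_exp n s, binary_exp n t)"
      by (simp only: tensor2_act_cartan[OF st(1,2), symmetric] v_weight)
    moreover have "of_nat N = 2 * of_nat n - (2 :: complex)" using n by (simp add: N_def of_nat_diff)
    ultimately have "2 * (1 - of_nat (s + t)) * v (binary_exp n s, binary_exp n t) = 0"
      by (simp add: algebra_simps)
    moreover have "(1 :: complex) \<noteq> of_nat (s + t)" using st(3) by (metis of_nat_1 of_nat_eq_iff)
    ultimately show ?thesis by (metis mult_eq_0_iff right_minus_eq zero_neq_numeral)
  qed
  from alternating_weight_1[OF n v_alt this]
  have v: "v = (\<lambda>x. (v (binary_exp n 0, binary_exp n 1) / of_nat n) * weight_vector n 1 x)" by blast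
  have "v \<noteq> (\<lambda>x. 0)"
  proof
    assume "v = (\<lambda>x. 0)"
    then have "\<phi> (?e 0) = \<phi> 0" by (simp add: v_def zero)
    then have "?e 0 = 0"
      using bij e[of 0] Sym_part_closed(1)[of UNIV N] by (auto simp: bij_betw_def dest: inj_onD)
    then show False by (metis lookup_single_eq lookup_zero zero_neq_one)
  qed
  then have "v (binary_exp n 0, binary_exp n 1) \<noteq> 0" using v by (metis div_0 mult_zero_left)
  then have sub: "highest_summand n \<subseteq> U"
    using mem[OF e, of 0] by (intro highest_summand_subset[OF n U]) (simp_all add: v_def)
  have \<phi>_e: "\<phi> (?e k) \<in> highest_summand n" if "k \<le> N" for k
    using that
  proof (induction k)
    case 0
    have "weight_vector n 1 \<in> highest_summand n" by (simp add: highest_summand_def)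
    then have "v \<in> highest_summand n" by (subst v) (rule cH(4))
    then show ?case by (simp add: v_def)
  next
    case (Suc k)
    \<comment> \<open>The factor N - k is nonzero for k < N, so e_{k+1} is recovered from the image
      of e_k.\<close>
    have "sym_act lowering (?e k) = cst (of_nat (N - k)) * ?e (Suc k)"
      using Suc.prems by (intro Sym_part_binary_eqI[OF sym_act_Sym_part[OF e] Sym_part_closed(3)[OF e]])
        (auto simp: lookup_sym_act_binary_exp lookup_cst_mult lookup_single binary_exp_eq_iff when_def Suc_diff_Suc)
    then have "(\<lambda>x. of_nat (N - k) * \<phi> (?e (Suc k)) x) \<in> highest_summand n"
      using cH(5)[OF cartan_lowering_sl2(2) Suc.IH] act[OF cartan_lowering_sl2(2) e[of k]] scale[OF e[OF Suc.prems]] Suc.prems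
      by simp
    from cH(4)[OF this, of "1 / of_nat (N - k)"] show ?case using Suc.prems by simp
  qed
  \<comment> \<open>Membership in V_N is carried along because additivity of \<phi> is known only
    there.\<close>
  have "\<phi> (\<Sum>k\<in>A. cst (c k) * ?e k) \<in> highest_summand n \<and> (\<Sum>k\<in>A. cst (c k) * ?e k) \<in> Sym_part UNIV N"
    if "finite A" "A \<subseteq> {..N}" for A c
    using that
  proof (induction A)
    case (insert k A)
    then show ?case
      using cH(3)[OF cH(4)[OF \<phi>_e[of k], of "c k"], of "\<phi> (\<Sum>k\<in>A. cst (c k) * ?e k)"]
      by (simp add: add scale e Sym_part_closed)
  qed (simp add: zero cH(2) Sym_part_closed)
  then have "\<phi> f \<in> highest_summand n" if "f \<in> Sym_part UNIV N" for f
    by (subst Sym_part_decomp[OF that]) auto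
  then have "U \<subseteq> highest_summand n" using bij by (auto simp: bij_betw_def)
  with sub show ?thesis by blast
qed

lemma wedge_summand_highest:
  "n \<ge> 1 \<Longrightarrow> wedge_summand n (2 * n - 2) = highest_summand n"
  unfolding wedge_summand_def
  using sl2_submodule_highest_summand sl2_isomorphic_highest_summand summand_eq_highest_summand
  by (intro the_equality conjI) blast+

theorem corollary5p3:
  fixes n :: nat
  assumes "n \<ge> 1"
  shows "finite_dim_complex (weyman_module n) \<and>
    (\<forall>K. sl2_submodule K (wedge_square n) \<longrightarrow>
      (finite_dim_complex (koszul_module (irrep_basis n) K) \<longleftrightarrow>
       graded_quotient_of (Sym (irrep_basis n)) (koszul_module (irrep_basis n) K) (weyman_module n)))"
proof -
  let ?I = "irrep_basis n" and ?U = "highest_summand n"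
  have ext2: "K \<subseteq> ext2 ?I" if "sl2_submodule K (wedge_square n)" for K
    using that by (auto simp: sl2_submodule_wedge_square_iff ext2_eq[OF finite_irrep_basis])
  note U = ext2[OF sl2_submodule_highest_summand]
  have W: "weyman_module n = koszul_module ?I ?U"
    by (simp add: weyman_module_def wedge_summand_highest[OF assms])
  have fd: "finite_dim_complex (weyman_module n)"
    unfolding W
  proof (rule finite_dim_koszul_if_weights[OF finite_irrep_basis U inj_on_lookup_irrep_basis])
    fix p q assume "p \<in> ?I" "q \<in> ?I" "p \<noteq> q"
    then obtain s t where st: "p = binary_exp n s" "q = binary_exp n t" "s \<le> n" "t \<le> n" "s \<noteq> t"
      by (auto simp: irrep_basis_eq)
    \<comment> \<open>At (e_s, e_t) this vector has coordinate (t - s) C(n,s) C(n,t), nonzero for s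
      \<noteq> t.\<close>
    have "weight_vector n (s + t) \<in> ?U" by (simp add: highest_summand_def)
    moreover have "weight_vector n (s + t) (p, q) \<noteq> 0"
      using st by (simp add: highest_tensor_binary_exp)
    moreover have "Poly_Mapping.lookup k 2 + Poly_Mapping.lookup l 2 = Poly_Mapping.lookup p 2 + Poly_Mapping.lookup q 2"
      if "weight_vector n (s + t) (k, l) \<noteq> 0" for k l
      using that st by (auto simp: highest_tensor_def Let_def split: if_splits)
    ultimately show "\<exists>u\<in>?U. u (p, q) \<noteq> 0 \<and> (\<forall>k l. u (k, l) \<noteq> 0 \<longrightarrow>
        Poly_Mapping.lookup k 2 + Poly_Mapping.lookup l 2 = Poly_Mapping.lookup p 2 + Poly_Mapping.lookup q 2)"
      by blast
  qed
  have "finite_dim_complex (koszul_module ?I K) \<longleftrightarrow>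
      graded_quotient_of (Sym ?I) (koszul_module ?I K) (weyman_module n)"
    if K: "sl2_submodule K (wedge_square n)" for K
  proof
    assume "finite_dim_complex (koszul_module ?I K)"
    \<comment> \<open>The pair (e_0, e_1) is the one that detects weight 2n - 2; it exists because n
      \<ge> 1.\<close>
    then have "\<exists>u\<in>K. u (binary_exp n 0, binary_exp n 1) \<noteq> 0"
      using assms by (intro finite_dim_koszul_nonvanishing[OF finite_irrep_basis ext2[OF K]])
        (auto simp: binary_exp_in_irrep_basis binary_exp_eq_iff)
    then have "?U \<subseteq> K" using highest_summand_subset[OF assms K] by blast
    then show "graded_quotient_of (Sym ?I) (koszul_module ?I K) (weyman_module n)"
      unfolding W by (rule graded_quotient_koszul_mono[OF finite_irrep_basis _ ext2[OF K]])
  next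
    assume "graded_quotient_of (Sym ?I) (koszul_module ?I K) (weyman_module n)"
    then show "finite_dim_complex (koszul_module ?I K)"
      using module_koszul_module[OF finite_irrep_basis U] module_koszul_module[OF finite_irrep_basis ext2[OF K]] fd
      unfolding W by (rule finite_dim_graded_quotient)
  qed
  with fd show ?thesis by blast
qed

end
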